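(* Let $d\ge 1$. Let $P(d)$ be the set of all multisets of $d+1$ points (counted with multiplicity) in $(\mathbb{Z}/2\mathbb{Z})^r$, $r\ge 0$, that affinely span the whole space $(\mathbb{Z}/2\mathbb{Z})^r$. Then the $d$-dimensional Calabi-Yau complete intersections arising from a nef-partition of codimension $d+1$ (i.e. with $d+1$ blocks) in a fake weighted projective space are in bijection with the orbits of $P(d)$ under the action of the groups $\operatorname{AGL}(r,\mathbb{Z}/2\mathbb{Z})$ induced by the affine transformations $$\operatorname{AGL}(r,\mathbb{Z}/2\mathbb{Z})\times(\mathbb{Z}/2\mathbb{Z})^r\to(\mathbb{Z}/2\mathbb{Z})^r,\qquad ((v,M),x)\mapsto Mx+v.$$
   Context: Here $r\ge 0$ varies: $P(d)$ is the disjoint union over all $r\ge 0$ of the sets of such multisets in $(\mathbb{Z}/2\mathbb{Z})^r$, and $\operatorname{AGL}(r,\mathbb{Z}/2\mathbb{Z})$, the group of pairs $(v,M)$ with $v\in(\mathbb{Z}/2\mathbb{Z})^r$ and $M\in\operatorname{GL}(r,\mathbb{Z}/2\mathbb{Z})$, acts on the part with the given $r$. Varieties are over a fixed algebraically closed field $\mathbb{K}$ of characteristic zero. A fake weighted projective space (fwps) of dimension $n$ is an $n$-dimensional $\mathbb{Q}$-factorial toric Fano variety $Z$ of Picard number one. Its divisor class group is presented in invariant factor form $\operatorname{Cl}(Z)=\mathbb{Z}\oplus\mathbb{Z}/\mu_1\mathbb{Z}\oplus\dots\oplus\mathbb{Z}/\mu_t\mathbb{Z}$ with $t\ge 0$,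 $\mu_i\ge 2$ and $\mu_t\mid\mu_{t-1}\mid\dots\mid\mu_1$. Write $\omega_i=(w_i,\eta_i)\in\operatorname{Cl}(Z)$, $i=0,\dots,n$, for the classes of the torus-invariant prime divisors, with $1\le w_0\le\dots\le w_n$; any $n$ of the $\omega_i$ generate $\operatorname{Cl}(Z)$ as a group, and $Z$ is the quotient of $\mathbb{K}^{n+1}\setminus\{0\}$ by the diagonal action, with weights $\omega_i$, of the quasitorus with character group $\operatorname{Cl}(Z)$. $\operatorname{Pic}(Z)\subseteq\operatorname{Cl}(Z)$ is the subgroup of Cartier divisor classes. A nef-partition of $Z$ is a partition $p_1\sqcup\dots\sqcup p_s=\{0,\dots,n\}$ into $s$ nonempty blocks such that $\omega_{p_j}:=\sum_{i\in p_j}\omega_i\in\operatorname{Pic}(Z)$ for $j=1,\dots,s$, and moreover $\omega_{p_j}\ne\omega_i$ for all $j$ and all $i$ (in particular no block has size one). The Calabi-Yau complete intersection (CYCI) arising from a nef-partition is the family of complete intersections in $Z$ of general sections of $\omega_{p_1},\dots,\omega_{p_s}$; it has codimension $s$ and dimension $n-s$. CYCIs are considered as pairs consisting of an isomorphism class of fwps $Z$ and a multidegree, i.e. the multiset $\{\omega_{p_1},\dots,\omega_{p_s}\}$; nef-partitions of the same $Z$ with the same multidegree are identified. *)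

theory Defs
  imports
    "HOL-Analysis.Analysis"
    "HOL-Algebra.Free_Abelian_Groups"
    "HOL-Library.Disjoint_Sets"
    "HOL-Library.Extended_Nat"
    "HOL-Library.Multiset"
    "HOL-Library.Z2"
    "Jordan_Normal_Form.Matrix"
begin

text \<open>
  A normal toric variety of dimension \<open>n = CARD('n)\<close> over an algebraically closed field of
  characteristic zero is represented by its fan in \<open>real ^ 'n\<close>, with respect to the lattice
  of integral vectors. Divisors, their classes, the Cartier condition and ampleness are expressed
  through the usual dictionary between torus-invariant divisors and fans, which does not depend
  on the field. The dual space is identified with \<open>real ^ 'n\<close> by the standard inner
  product, so that the character lattice is again the lattice of integral vectors.
\<close>

section \<open>Fans and toric varieties\<close>

definition int_lattice :: "(real ^ 'n) set" where
  "int_lattice = {x. \<forall>i. vec_nth x i \<in> \<int>}"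

definition pointed_rational_cone :: "(real ^ 'n) set \<Rightarrow> bool" where
  "pointed_rational_cone \<sigma> \<longleftrightarrow>
     (\<exists>S. finite S \<and> S \<subseteq> int_lattice \<and> \<sigma> = convex_cone hull S) \<and>
     \<sigma> \<inter> uminus ` \<sigma> = {0}"

text \<open>The library's \<open>face_of\<close> admits the empty face, which is not a cone.\<close>

definition fan :: "(real ^ 'n) set set \<Rightarrow> bool" where
  "fan \<Sigma> \<longleftrightarrow>
     finite \<Sigma> \<and> \<Sigma> \<noteq> {} \<and>
     (\<forall>\<sigma>\<in>\<Sigma>. pointed_rational_cone \<sigma>) \<and>
     (\<forall>\<sigma>\<in>\<Sigma>. \<forall>\<tau>. \<tau> face_of \<sigma> \<and> \<tau> \<noteq> {} \<longrightarrow> \<tau> \<in> \<Sigma>) \<and>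
     (\<forall>\<sigma>\<in>\<Sigma>. \<forall>\<tau>\<in>\<Sigma>. (\<sigma> \<inter> \<tau>) face_of \<sigma> \<and> (\<sigma> \<inter> \<tau>) face_of \<tau>)"

definition complete_fan :: "(real ^ 'n) set set \<Rightarrow> bool" where
  "complete_fan \<Sigma> \<longleftrightarrow> fan \<Sigma> \<and> \<Union>\<Sigma> = UNIV"

definition primitive :: "real ^ 'n \<Rightarrow> bool" where
  "primitive u \<longleftrightarrow> u \<in> int_lattice \<and> u \<noteq> 0 \<and>
     (\<forall>v\<in>int_lattice. \<forall>k::nat. u = real k *\<^sub>R v \<longrightarrow> k = 1)"

text \<open>
  A ray, and with it a torus-invariant prime divisor, is represented by its primitive lattice
  generator.
\<close>

definition rays :: "(real ^ 'n) set set \<Rightarrow> (real ^ 'n) set" where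
  "rays \<Sigma> = {u. primitive u \<and> convex_cone hull {u} \<in> \<Sigma>}"

section \<open>Divisors and divisor classes\<close>

definition WDiv :: "(real ^ 'n) set set \<Rightarrow> ((real ^ 'n) \<Rightarrow>\<^sub>0 int) monoid" where
  "WDiv \<Sigma> = free_Abelian_group (rays \<Sigma>)"

text \<open>The divisor of the character \<open>m\<close> has multiplicity \<open>inner m u\<close> along the prime
  divisor of \<open>u\<close>.\<close>

definition principal_divisors :: "(real ^ 'n) set set \<Rightarrow> ((real ^ 'n) \<Rightarrow>\<^sub>0 int) set" where
  "principal_divisors \<Sigma> = {D \<in> carrier (WDiv \<Sigma>).
     \<exists>m\<in>int_lattice. \<forall>u\<in>rays \<Sigma>. real_of_int (Poly_Mapping.lookup D u) = inner m u}"

text \<open>Principal on every affine chart; a cone \<open>\<sigma>\<close> contains the generators of exactly its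
  own rays.\<close>

definition Cartier :: "(real ^ 'n) set set \<Rightarrow> ((real ^ 'n) \<Rightarrow>\<^sub>0 int) \<Rightarrow> bool" where
  "Cartier \<Sigma> D \<longleftrightarrow> D \<in> carrier (WDiv \<Sigma>) \<and>
     (\<forall>\<sigma>\<in>\<Sigma>. \<exists>m\<in>int_lattice. \<forall>u\<in>rays \<Sigma> \<inter> \<sigma>.
        real_of_int (Poly_Mapping.lookup D u) = inner m u)"

definition Cl :: "(real ^ 'n) set set \<Rightarrow> ((real ^ 'n) \<Rightarrow>\<^sub>0 int) set monoid" where
  "Cl \<Sigma> = WDiv \<Sigma> Mod principal_divisors \<Sigma>"

definition div_class ::
  "(real ^ 'n) set set \<Rightarrow> ((real ^ 'n) \<Rightarrow>\<^sub>0 int) \<Rightarrow> ((real ^ 'n) \<Rightarrow>\<^sub>0 int) set" where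
  "div_class \<Sigma> D = principal_divisors \<Sigma> #>\<^bsub>WDiv \<Sigma>\<^esub> D"

definition Pic :: "(real ^ 'n) set set \<Rightarrow> ((real ^ 'n) \<Rightarrow>\<^sub>0 int) set monoid" where
  "Pic \<Sigma> = (Cl \<Sigma>)\<lparr>carrier := div_class \<Sigma> ` {D. Cartier \<Sigma> D}\<rparr>"

definition int_independent :: "('a, 'b) monoid_scheme \<Rightarrow> 'a set \<Rightarrow> bool" where
  "int_independent G S \<longleftrightarrow> finite S \<and> S \<subseteq> carrier G \<and>
     (\<forall>c :: 'a \<Rightarrow> int. finprod G (\<lambda>x. x [^]\<^bsub>G\<^esub> c x) S = \<one>\<^bsub>G\<^esub> \<longrightarrow> (\<forall>x\<in>S. c x = 0))"

definition abelian_rank :: "('a, 'b) monoid_scheme \<Rightarrow> enat" where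
  "abelian_rank G = (SUP S \<in> {S. int_independent G S}. enat (card S))"

section \<open>Fake weighted projective spaces\<close>

text \<open>It suffices to consider torus-invariant divisors, as they represent all divisor classes.\<close>

definition Q_factorial :: "(real ^ 'n) set set \<Rightarrow> bool" where
  "Q_factorial \<Sigma> \<longleftrightarrow>
     (\<forall>D\<in>carrier (WDiv \<Sigma>). \<exists>k>0. Cartier \<Sigma> (frag_cmul k D))"

text \<open>
  For a Cartier divisor on a complete toric variety: the support function, which is linear on
  each cone, is strictly convex. On a full-dimensional cone it is given by a character \<open>m\<close>,
  and \<open>- D u\<close> is its value at \<open>u\<close>.
\<close>

definition ample :: "(real ^ 'n) set set \<Rightarrow> ((real ^ 'n) \<Rightarrow>\<^sub>0 int) \<Rightarrow> bool" where
  "ample \<Sigma> D \<longleftrightarrow> complete_fan \<Sigma> \<and> Cartier \<Sigma> D \<and>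
     (\<forall>\<sigma>\<in>\<Sigma>. interior \<sigma> \<noteq> {} \<longrightarrow>
        (\<exists>m\<in>int_lattice.
           (\<forall>u\<in>rays \<Sigma> \<inter> \<sigma>. inner m u = - real_of_int (Poly_Mapping.lookup D u)) \<and>
           (\<forall>u\<in>rays \<Sigma> - \<sigma>. inner m u > - real_of_int (Poly_Mapping.lookup D u))))"

text \<open>The sum of all torus-invariant prime divisors is an anticanonical divisor.\<close>

definition Fano :: "(real ^ 'n) set set \<Rightarrow> bool" where
  "Fano \<Sigma> \<longleftrightarrow> complete_fan \<Sigma> \<and>
     (\<exists>k>0. ample \<Sigma> (frag_cmul k (\<Sum>u\<in>rays \<Sigma>. frag_of u)))"

definition fwps :: "(real ^ 'n) set set \<Rightarrow> bool" where
  "fwps \<Sigma> \<longleftrightarrow> fan \<Sigma> \<and> Q_factorial \<Sigma> \<and> Fano \<Sigma> \<and> abelian_rank (Pic \<Sigma>) = 1"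

text \<open>Isomorphisms of fans, i.e. of toric varieties.\<close>

definition fan_iso ::
  "(real ^ 'n \<Rightarrow> real ^ 'n) \<Rightarrow> (real ^ 'n) set set \<Rightarrow> (real ^ 'n) set set \<Rightarrow> bool" where
  "fan_iso \<phi> \<Sigma> \<Sigma>' \<longleftrightarrow>
     linear \<phi> \<and> bij \<phi> \<and> \<phi> ` int_lattice = int_lattice \<and> (image \<phi>) ` \<Sigma> = \<Sigma>'"

text \<open>The isomorphism of class groups induced by an isomorphism \<open>\<phi>\<close> of fans, which sends the
  prime divisor of \<open>u\<close> to that of \<open>\<phi> u\<close>.\<close>

definition push_class ::
  "(real ^ 'n \<Rightarrow> real ^ 'n) \<Rightarrow> ((real ^ 'n) \<Rightarrow>\<^sub>0 int) set \<Rightarrow> ((real ^ 'n) \<Rightarrow>\<^sub>0 int) set" where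
  "push_class \<phi> C = frag_extend (\<lambda>u. frag_of (\<phi> u)) ` C"

section \<open>Nef-partitions and Calabi-Yau complete intersections\<close>

definition block_class ::
  "(real ^ 'n) set set \<Rightarrow> (real ^ 'n) set \<Rightarrow> ((real ^ 'n) \<Rightarrow>\<^sub>0 int) set" where
  "block_class \<Sigma> p = finprod (Cl \<Sigma>) (\<lambda>u. div_class \<Sigma> (frag_of u)) p"

definition nef_partition :: "(real ^ 'n) set set \<Rightarrow> (real ^ 'n) set set \<Rightarrow> bool" where
  "nef_partition \<Sigma> P \<longleftrightarrow> partition_on (rays \<Sigma>) P \<and>
     (\<forall>p\<in>P. block_class \<Sigma> p \<in> carrier (Pic \<Sigma>) \<and>
        (\<forall>u\<in>rays \<Sigma>. block_class \<Sigma> p \<noteq> div_class \<Sigma> (frag_of u)))"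

definition multidegree ::
  "(real ^ 'n) set set \<Rightarrow> (real ^ 'n) set set \<Rightarrow> ((real ^ 'n) \<Rightarrow>\<^sub>0 int) set multiset" where
  "multidegree \<Sigma> P = image_mset (block_class \<Sigma>) (mset_set P)"

type_synonym 'n cyci_pair =
  "(real ^ 'n) set set \<times> ((real ^ 'n) \<Rightarrow>\<^sub>0 int) set multiset"

definition cyci_pairs :: "nat \<Rightarrow> 'n::finite cyci_pair set" where
  "cyci_pairs s = {(\<Sigma>, multidegree \<Sigma> P) | \<Sigma> P. fwps \<Sigma> \<and> nef_partition \<Sigma> P \<and> card P = s}"

definition cyci_iso :: "nat \<Rightarrow> ('n::finite cyci_pair \<times> 'n cyci_pair) set" where
  "cyci_iso s = {((\<Sigma>, \<mu>), (\<Sigma>', \<mu>')).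
     (\<Sigma>, \<mu>) \<in> cyci_pairs s \<and> (\<Sigma>', \<mu>') \<in> cyci_pairs s \<and>
     (\<exists>\<phi>. fan_iso \<phi> \<Sigma> \<Sigma>' \<and> \<mu>' = image_mset (push_class \<phi>) \<mu>)}"

text \<open>
  The Calabi-Yau complete intersections of codimension \<open>s\<close>, hence of dimension
  \<open>CARD('n) - s\<close>, that arise from nef-partitions in fake weighted projective spaces of
  dimension \<open>CARD('n)\<close>.
\<close>

definition CYCI :: "nat \<Rightarrow> 'n::finite cyci_pair set set" where
  "CYCI s = cyci_pairs s // cyci_iso s"

section \<open>Affine point configurations over the field with two elements\<close>

definition affine_span :: "nat \<Rightarrow> bit Matrix.vec set \<Rightarrow> bit Matrix.vec set" where
  "affine_span r S =
     {finsum_vec TYPE(bit) r (\<lambda>x. c x \<cdot>\<^sub>v x) S | c. (\<Sum>x\<in>S. c x) = 1}"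

text \<open>The component \<open>r\<close> makes the union over all \<open>r\<close> disjoint.\<close>

definition point_configs :: "nat \<Rightarrow> (nat \<times> bit Matrix.vec multiset) set" where
  "point_configs d = {(r, X). size X = d + 1 \<and> set_mset X \<subseteq> carrier_vec r \<and>
     affine_span r (set_mset X) = carrier_vec r}"

definition AGL :: "nat \<Rightarrow> (bit Matrix.vec \<times> bit mat) set" where
  "AGL r = {(v, M). v \<in> carrier_vec r \<and> M \<in> carrier_mat r r \<and> invertible_mat M}"

definition AGL_act :: "bit Matrix.vec \<times> bit mat \<Rightarrow> bit Matrix.vec \<Rightarrow> bit Matrix.vec" where
  "AGL_act = (\<lambda>(v, M) x. M *\<^sub>v x + v)"

definition AGL_rel ::
  "nat \<Rightarrow> ((nat \<times> bit Matrix.vec multiset) \<times> (nat \<times> bit Matrix.vec multiset)) set" where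
  "AGL_rel d = {((r, X), (r', Y)). (r, X) \<in> point_configs d \<and> (r', Y) \<in> point_configs d \<and> r = r' \<and>
     (\<exists>g\<in>AGL r. Y = image_mset (AGL_act g) X)}"

definition AGL_orbits :: "nat \<Rightarrow> (nat \<times> bit Matrix.vec multiset) set set" where
  "AGL_orbits d = point_configs d // AGL_rel d"

end

theory Submission
  imports Defs "HOL-Combinatorics.Permutations"
begin

text \<open>
  Let \<open>u\<^sub>0, \<dots>, u\<^sub>n\<close> be the primitive ray generators of a fake weighted projective space of
  dimension \<open>n = 2d + 1\<close> and \<open>\<omega>\<^sub>i\<close> the classes of their divisors. Every block of a nef-partition has
  at least two elements, so \<open>d + 1\<close> blocks on \<open>2d + 2\<close> rays are pairs. The fan consists of the
  cones on all proper subsets of the rays; hence a class is Cartier iff it is a multiple of every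
  \<open>\<omega>\<^sub>j\<close>. Applied to a block \<open>{i, k}\<close> with \<open>j = i\<close> and \<open>j = k\<close> this gives \<open>\<omega>\<^sub>i = \<omega>\<^sub>k\<close>. For the
  other \<open>j\<close>, the degrees \<open>w\<^sub>i\<close> of the \<open>\<omega>\<^sub>i\<close> satisfy \<open>2 w\<^sub>i = z w\<^sub>j\<close> with an integer \<open>z\<close>, and \<open>z \<noteq> 1\<close> because the class
  of a block is not some \<open>\<omega>\<^sub>j\<close>; so \<open>w\<^sub>i \<ge> w\<^sub>j\<close>, all degrees agree, and \<open>2 \<omega>\<^sub>i = 2 \<omega>\<^sub>j\<close> for all
  \<open>i, j\<close>. Thus the class group is \<open>\<int> \<oplus> (\<int>/2)\<^sup>r\<close>, the \<open>\<omega>\<^sub>i = (1, \<eta>\<^sub>i)\<close> come in equal pairs, and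
  every block has the class \<open>2 \<omega>\<^sub>0\<close>: the multidegree is determined by the variety. Taking one point
  \<open>\<eta>\<^sub>i\<close> from each pair gives the \<open>d + 1\<close> points, and the freedom of splitting the class group and
  choosing coordinates on its torsion is the affine group.

  The two classifications are compared through a common complete invariant, which avoids choosing
  splittings. Label the rays by \<open>{..<2d+2}\<close>; the principal divisors form a sublattice \<open>K\<close> of
  \<open>\<int>\<^sup>2\<^sup>d\<^sup>+\<^sup>2\<close>, here \<open>char_lattice\<close>. Label the points \<open>y\<^sub>i\<close> of a configuration, each taken twice,
  in the same way; the integer vectors \<open>x\<close> with \<open>\<Sum> x\<^sub>i = 0\<close> and \<open>\<Sum> x\<^sub>i y\<^sub>i = 0\<close> over the field with
  two elements form a sublattice as well, \<open>point_lattice\<close>. In both cases \<open>K\<close> is determined up to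
  the labelling, that is, up to a permutation of coordinates, and the following facts give the
  bijection.

  \<^item> Two configurations are affinely equivalent iff they share a lattice
    (\<open>AGL_rel_iff_labels_meet\<close>), and two Calabi-Yau complete intersections are isomorphic iff they
    share a lattice (\<open>cyci_iso_iff_labels_meet\<close>): a linear map is determined by its effect on
    generators, and the relations among the points, respectively the values of all characters on
    the rays, are what \<open>K\<close> records.
  \<^item> The lattices that occur are on both sides the \<open>paired_lattice\<close>s: sublattices of the
    vectors of coordinate sum zero that contain all \<open>2 e\<^sub>i - 2 e\<^sub>j\<close> and, in a suitable labelling, all
    \<open>e\<^sub>i - e\<^sub>k\<close> with \<open>k = i + d + 1\<close>. For configurations this is \<open>config_has_paired_label\<close> and
    \<open>paired_lattice_has_config\<close>; for fans it is \<open>nef_partition_lattice\<close>, which carries out the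
    argument on degrees above, and \<open>paired_lattice_has_cyci_pair\<close>, where the rays are the rows of a
    matrix whose columns are a basis of \<open>K\<close>.
\<close>

section \<open>Paired sublattices of the integer lattice\<close>

text \<open>The default simplification rules turn sums and products of bits into bitwise operations, on which
  the rules for rings do not act.\<close>

declare add_bit_eq_xor [simp del] mult_bit_eq_and [simp del]

lemma bit_add_eq_0_iff: "a + b = 0 \<longleftrightarrow> a = b" for a b :: bit
  by (cases a; cases b) auto

definition num_rays :: "nat \<Rightarrow> nat" where
  "num_rays d = 2 * d + 2"

definition unit_at :: "nat \<Rightarrow> nat \<Rightarrow> int" where
  "unit_at i = (\<lambda>j. if j = i then 1 else 0)"

text \<open>Vectors are functions on all natural numbers of which only the coordinates below
  \<open>num_rays d\<close> matter; the second condition makes the lattice insensitive to the others, so that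
  equality of lattices is equality of sets.\<close>

definition paired_lattice :: "nat \<Rightarrow> (nat \<Rightarrow> int) set \<Rightarrow> bool" where
  "paired_lattice d K \<longleftrightarrow>
     (\<forall>x\<in>K. \<forall>y\<in>K. (\<lambda>i. x i - y i) \<in> K) \<and>
     (\<forall>x\<in>K. \<forall>y. (\<forall>i<num_rays d. y i = x i) \<longrightarrow> y \<in> K) \<and>
     (\<forall>x\<in>K. (\<Sum>i<num_rays d. x i) = 0) \<and>
     (\<forall>i<num_rays d. \<forall>j<num_rays d. (\<lambda>k. 2 * unit_at i k - 2 * unit_at j k) \<in> K) \<and>
     (\<forall>i\<le>d. (\<lambda>k. unit_at i k - unit_at (i+d+1) k) \<in> K)"

context
  fixes d :: nat and K
  assumes K: "paired_lattice d K"
begin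

lemma paired_lattice_diff: "x \<in> K \<Longrightarrow> y \<in> K \<Longrightarrow> (\<lambda>i. x i - y i) \<in> K"
  using K unfolding paired_lattice_def by blast

lemma paired_lattice_cong: "x \<in> K \<Longrightarrow> (\<And>i. i < num_rays d \<Longrightarrow> y i = x i) \<Longrightarrow> y \<in> K"
  using K unfolding paired_lattice_def by blast

lemma paired_lattice_sum_eq_0: "x \<in> K \<Longrightarrow> (\<Sum>i<num_rays d. x i) = 0"
  using K unfolding paired_lattice_def by blast

lemma paired_lattice_twice:
  "i < num_rays d \<Longrightarrow> j < num_rays d \<Longrightarrow> (\<lambda>k. 2 * unit_at i k - 2 * unit_at j k) \<in> K"
  using K unfolding paired_lattice_def by blast

lemma paired_lattice_pair: "i \<le> d \<Longrightarrow> (\<lambda>k. unit_at i k - unit_at (i+d+1) k) \<in> K"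
  using K unfolding paired_lattice_def by blast

lemma paired_lattice_zero: "(\<lambda>_. 0) \<in> K"
  using paired_lattice_twice[of 0 0] by (simp add: num_rays_def)

lemma paired_lattice_minus: "x \<in> K \<Longrightarrow> (\<lambda>i. - x i) \<in> K"
  using paired_lattice_diff[OF paired_lattice_zero, of x] by simp

lemma paired_lattice_add: "x \<in> K \<Longrightarrow> y \<in> K \<Longrightarrow> (\<lambda>i. x i + y i) \<in> K"
  using paired_lattice_diff[of x "\<lambda>i. - y i"] paired_lattice_minus[of y] by simp

lemma paired_lattice_scale: "x \<in> K \<Longrightarrow> (\<lambda>i. z * x i) \<in> K"
proof (induction z rule: int_induct[of _ 0])
  case base then show ?case using paired_lattice_zero by simp
next
  case (step1 i)
  then show ?case using paired_lattice_add[of "\<lambda>k. i * x k" x] by (simp add: algebra_simps)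
next
  case (step2 i)
  then show ?case using paired_lattice_diff[of "\<lambda>k. i * x k" x] by (simp add: algebra_simps)
qed

lemma paired_lattice_lincomb:
  "finite I \<Longrightarrow> (\<And>i. i \<in> I \<Longrightarrow> x i \<in> K) \<Longrightarrow> (\<lambda>j. \<Sum>i\<in>I. z i * x i j) \<in> K"
proof (induction I rule: finite_induct)
  case empty then show ?case using paired_lattice_zero by simp
next
  case (insert i I)
  then show ?case
    using paired_lattice_add[OF paired_lattice_scale[of "x i" "z i"], of "\<lambda>j. \<Sum>i\<in>I. z i * x i j"]
    by simp
qed

text \<open>All vectors \<open>2 z\<close> with coordinate sum zero are integer combinations of the \<open>2 e\<^sub>i - 2 e\<^sub>0\<close>.
  Membership is therefore a property of the residues modulo two, which is how a lattice
  over the integers comes to describe points over the field with two elements.\<close>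

lemma paired_lattice_parity:
  assumes x: "x \<in> K" and sum: "(\<Sum>i<num_rays d. y i) = 0"
    and par: "\<And>i. i < num_rays d \<Longrightarrow> even (y i - x i)"
  shows "y \<in> K"
proof -
  define z where "z i = (y i - x i) div 2" for i
  have z: "y i = x i + 2 * z i" if "i < num_rays d" for i
    using par[OF that] by (simp add: z_def)
  have "2 * (\<Sum>i<num_rays d. z i) = (\<Sum>i<num_rays d. y i - x i)"
    unfolding sum_distrib_left by (rule sum.cong) (use z in auto)
  then have sz: "(\<Sum>i<num_rays d. z i) = 0"
    using sum paired_lattice_sum_eq_0[OF x] by (simp add: sum_subtractf)
  have "(\<lambda>j. \<Sum>i<num_rays d. z i * (2 * unit_at i j - 2 * unit_at 0 j)) \<in> K"
    by (rule paired_lattice_lincomb) (auto intro!: paired_lattice_twice simp: num_rays_def)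
  moreover have "(\<Sum>i<num_rays d. z i * (2 * unit_at i j - 2 * unit_at 0 j)) = y j - x j" if "j < num_rays d" for j
  proof -
    have "(\<Sum>i<num_rays d. z i * (2 * unit_at i j - 2 * unit_at 0 j))
        = (\<Sum>i<num_rays d. 2 * (if i = j then z i else 0)) - (\<Sum>i<num_rays d. z i) * 2 * unit_at 0 j"
      unfolding sum_distrib_right sum_subtractf[symmetric]
      by (rule sum.cong) (auto simp: unit_at_def algebra_simps)
    also have "\<dots> = 2 * z j"
      unfolding sum_distrib_left[symmetric] using that by (simp add: sz)
    finally show ?thesis using z[OF that] by simp
  qed
  ultimately have "(\<lambda>j. y j - x j) \<in> K" by (auto elim!: paired_lattice_cong)
  from paired_lattice_add[OF this x] show ?thesis by simp
qed

end

section \<open>Integer relations of a doubled point configuration\<close>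

definition point_lattice :: "nat \<Rightarrow> nat \<Rightarrow> (nat \<Rightarrow> bit Matrix.vec) \<Rightarrow> (nat \<Rightarrow> int) set" where
  "point_lattice N r y = {x. (\<Sum>i<N. x i) = 0 \<and>
     (\<forall>k<r. (\<Sum>i<N. of_int (x i) * vec_index (y i) k) = 0)}"

text \<open>Coefficients on the set of values and coefficients on the index set are exchanged by summing
  over fibres in one direction and by concentrating on one representative of each fibre in the
  other.\<close>

lemma affine_span_family:
  fixes y :: "nat \<Rightarrow> bit Matrix.vec"
  assumes y: "\<And>i. i < N \<Longrightarrow> y i \<in> carrier_vec r"
  shows "affine_span r (y ` {..<N}) =
    {v \<in> carrier_vec r. \<exists>c. (\<Sum>i<N. c i) = 1 \<and>
       (\<forall>k<r. vec_index v k = (\<Sum>i<N. c i * vec_index (y i) k))}" (is "?L = ?R")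
proof -
  let ?S = "y ` {..<N}"
  have idx: "vec_index (finsum_vec TYPE(bit) r (\<lambda>x. c x \<cdot>\<^sub>v x) ?S) k
      = (\<Sum>x\<in>?S. c x * vec_index x k)" if "k < r" for c k
  proof -
    have fin: "finite ?S" by simp
    have dim: "dim_vec (y i) = r" if "i < N" for i
      using y[OF that] by simp
    have "(\<lambda>x. c x \<cdot>\<^sub>v x) \<in> ?S \<rightarrow> carrier_vec r" using y by auto
    from index_finsum_vec[OF fin that this] show ?thesis
      using that by (auto intro!: sum.cong simp: dim)
  qed
  have car: "finsum_vec TYPE(bit) r (\<lambda>x. c x \<cdot>\<^sub>v x) ?S \<in> carrier_vec r" for c
    by (rule finsum_vec_closed) (use y in auto)
  {
    fix v assume "v \<in> ?L"
    then obtain c where c: "(\<Sum>x\<in>?S. c x) = 1" "v = finsum_vec TYPE(bit) r (\<lambda>x. c x \<cdot>\<^sub>v x) ?S"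
      by (auto simp: affine_span_def)
    define rep where "rep x = (SOME i. i < N \<and> y i = x)" for x
    have rep: "rep x < N \<and> y (rep x) = x" if "x \<in> ?S" for x
      unfolding rep_def by (rule someI_ex) (use that in auto)
    have inj: "inj_on rep ?S" by (metis inj_onI rep)
    define c' where "c' i = (if i \<in> rep ` ?S then c (y i) else 0)" for i
    have *: "(\<Sum>i<N. c' i * f (y i)) = (\<Sum>x\<in>?S. c x * f x)" for f
    proof -
      have "(\<Sum>i<N. c' i * f (y i)) = (\<Sum>i\<in>rep ` ?S. c (y i) * f (y i))"
        by (rule sum.mono_neutral_cong_right) (use rep in \<open>auto simp: c'_def\<close>)
      also have "\<dots> = (\<Sum>x\<in>?S. c x * f x)"
        unfolding sum.reindex[OF inj] by (rule sum.cong) (use rep in auto)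
      finally show ?thesis .
    qed
    have "v \<in> ?R" using c car idx *[of "\<lambda>_. 1"] by (auto intro!: exI[of _ c'] simp: *[symmetric])
  }
  moreover {
    fix v assume "v \<in> ?R"
    then obtain c where v: "v \<in> carrier_vec r" and c: "(\<Sum>i<N. c i) = 1"
      "\<forall>k<r. vec_index v k = (\<Sum>i<N. c i * vec_index (y i) k)" by auto
    define c' where "c' x = (\<Sum>i\<in>{i. i < N \<and> y i = x}. c i)" for x
    have *: "(\<Sum>x\<in>?S. c' x * f x) = (\<Sum>i<N. c i * f (y i))" for f :: "bit Matrix.vec \<Rightarrow> bit"
    proof -
      have "(\<Sum>i<N. c i * f (y i)) = (\<Sum>x\<in>?S. \<Sum>i\<in>{i\<in>{..<N}. y i = x}. c i * f (y i))"
        by (rule sum.image_gen) simp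
      also have "\<dots> = (\<Sum>x\<in>?S. c' x * f x)"
        unfolding c'_def sum_distrib_right by (intro sum.cong) auto
      finally show ?thesis ..
    qed
    have "v = finsum_vec TYPE(bit) r (\<lambda>x. c' x \<cdot>\<^sub>v x) ?S"
    proof (rule eq_vecI)
      fix k assume "k < dim_vec (finsum_vec TYPE(bit) r (\<lambda>x. c' x \<cdot>\<^sub>v x) ?S)"
      then have "k < r" using car[of c'] by simp
      then show "vec_index v k = vec_index (finsum_vec TYPE(bit) r (\<lambda>x. c' x \<cdot>\<^sub>v x) ?S) k"
        using c idx * by simp
    qed (use v car[of c'] in simp)
    moreover have "(\<Sum>x\<in>?S. c' x) = 1" using *[of "\<lambda>_. 1"] c by simp
    ultimately have "v \<in> ?L" by (auto simp: affine_span_def)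
  }
  ultimately show ?thesis by blast
qed

text \<open>Each point is taken twice, since to a point of a configuration there correspond two rays.\<close>

definition config_labels :: "nat \<Rightarrow> nat \<times> bit Matrix.vec multiset \<Rightarrow> (nat \<Rightarrow> int) set set" where
  "config_labels d = (\<lambda>(r, X).
     {point_lattice (num_rays d) r y | y. image_mset y (mset_set {..<num_rays d}) = X + X})"

lemma num_rays_two_halves: "{..<num_rays d} = {..d} \<union> (\<lambda>i. i+d+1) ` {..d}"
proof -
  have "x \<in> (\<lambda>i. i+d+1) ` {..d}" if "x < num_rays d" "\<not> x \<le> d" for x
    by (rule image_eqI[of _ _ "x-d-1"]) (use that in \<open>auto simp: num_rays_def\<close>)
  then show ?thesis by (auto simp: num_rays_def)
qed

lemma mset_two_halves:
  fixes y :: "nat \<Rightarrow> 'a"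
  assumes "\<And>i. i \<le> d \<Longrightarrow> y (i+d+1) = y i"
  shows "image_mset y (mset_set {..<num_rays d}) = image_mset y (mset_set {..d}) + image_mset y (mset_set {..d})"
proof -
  let ?T = "(\<lambda>i. i+d+1) ` {..d}"
  have "mset_set ?T = image_mset (\<lambda>i. i+d+1) (mset_set {..d})"
    by (rule image_mset_mset_set[symmetric]) (simp add: inj_on_def)
  then have "image_mset y (mset_set ?T) = image_mset (\<lambda>i. y (i+d+1)) (mset_set {..d})"
    by (simp add: multiset.map_comp comp_def)
  also have "\<dots> = image_mset y (mset_set {..d})"
    by (rule image_mset_cong) (use assms in auto)
  finally have T: "image_mset y (mset_set ?T) = image_mset y (mset_set {..d})" .
  have "mset_set {..<num_rays d} = mset_set {..d} + mset_set ?T"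
    unfolding num_rays_two_halves by (rule mset_set_Union) auto
  then show ?thesis by (simp only: image_mset_union T)
qed

lemma of_int_bit_eq_iff: "(of_int a :: bit) = of_int b \<longleftrightarrow> even (a - b)"
proof -
  have "even x \<longleftrightarrow> (of_int x :: bit) = 0" for x :: int
    by (metis bit_2_eq_0 dvd_0_left_iff even_of_int_iff)
  from this[of "a - b"] show ?thesis by (metis eq_iff_diff_eq_0 of_int_diff)
qed

text \<open>Lift the coefficients to the integers \<open>0\<close> and \<open>1\<close>.\<close>

lemma bit_lincomb_mem_reduction:
  fixes c :: "nat \<Rightarrow> bit"
  assumes "paired_lattice d K" and "finite I" "\<And>i. i \<in> I \<Longrightarrow> f i \<in> (\<lambda>x i. of_int (x i)) ` K"
  shows "(\<lambda>j. \<Sum>i\<in>I. c i * f i j) \<in> (\<lambda>x i. of_int (x i)) ` K"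
proof -
  have "\<forall>i\<in>I. \<exists>x\<in>K. f i = (\<lambda>j. of_int (x j))" using assms(3) by blast
  then obtain x where x: "\<And>i. i \<in> I \<Longrightarrow> x i \<in> K \<and> f i = (\<lambda>j. of_int (x i j))" by metis
  have c: "c i = of_int (of_bool (odd (c i)))" for i by (cases "c i") auto
  have "(\<lambda>j. \<Sum>i\<in>I. of_bool (odd (c i)) * x i j) \<in> K"
    by (rule paired_lattice_lincomb[OF assms(1,2)]) (use x in auto)
  moreover have "(\<lambda>j. \<Sum>i\<in>I. c i * f i j) = (\<lambda>j. of_int (\<Sum>i\<in>I. of_bool (odd (c i)) * x i j))"
    unfolding of_int_sum of_int_mult c[symmetric] using x by (auto intro!: sum.cong)
  ultimately show ?thesis by (intro image_eqI)
qed

lemma paired_lattice_reduction_iff: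
  assumes K: "paired_lattice d K" and x: "(\<Sum>i<num_rays d. x i) = 0"
  shows "x \<in> K \<longleftrightarrow> (\<exists>z\<in>K. \<forall>i<num_rays d. (of_int (z i) :: bit) = of_int (x i))"
  using paired_lattice_parity[OF K _ x] by (auto simp: of_int_bit_eq_iff dvd_diff_commute)

text \<open>The points have to be coordinates on the quotient of the space of bit vectors by the
  reduction \<open>R\<close> of \<open>K\<close> modulo two. A maximal
  set \<open>B\<close> of indices on which no nonzero element of \<open>R\<close> is supported indexes a basis of this
  quotient: by maximality \<open>e\<^sub>i\<close> is congruent to a vector \<open>s\<^sub>i\<close> supported on \<open>B\<close>. One element
  \<open>b 0\<close> of \<open>B\<close> becomes the origin, and \<open>y\<^sub>i\<close> consists of the entries of \<open>s\<^sub>i\<close> at the other ones.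
  Dropping the entry at \<open>b 0\<close> loses nothing, because all elements of \<open>R\<close> have sum zero. The points
  \<open>y\<^sub>b\<close> with \<open>b\<close> in \<open>B\<close> are the origin and the unit vectors, which span affinely.\<close>

lemma paired_lattice_has_config:
  assumes K: "paired_lattice d K"
  shows "\<exists>a\<in>point_configs d. K \<in> config_labels d a"
proof -
  define N where "N = num_rays d"
  define R :: "(nat \<Rightarrow> bit) set" where "R = (\<lambda>x i. of_int (x i)) ` K"
  have N0: "0 < N" by (simp add: N_def num_rays_def)
  have R_sum: "(\<Sum>i<N. c i) = 0" if "c \<in> R" for c
    using that paired_lattice_sum_eq_0[OF K]
    by (auto simp: R_def N_def simp flip: of_int_sum)
  have R_cong: "c' \<in> R" if c: "c \<in> R" and "\<And>i. i < N \<Longrightarrow> c' i = c i" for c c'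
  proof -
    obtain x where x: "x \<in> K" "c = (\<lambda>i. of_int (x i))" using c unfolding R_def by blast
    define x' where "x' i = (if i < N then x i else of_bool (odd (c' i)))" for i
    have "x' \<in> K" using x(1) by (rule paired_lattice_cong[OF K]) (simp add: x'_def N_def)
    moreover have "c' = (\<lambda>i. of_int (x' i))"
    proof
      fix i show "c' i = of_int (x' i)" using that(2)[of i] x(2)
        by (cases "c' i") (auto simp: x'_def)
    qed
    ultimately show ?thesis unfolding R_def by (intro image_eqI)
  qed
  note R_lincomb = bit_lincomb_mem_reduction[OF K, folded R_def]
  have R_zero: "(\<lambda>_. 0) \<in> R" using paired_lattice_zero[OF K] by (force simp: R_def)
  have R_add: "(\<lambda>i. c i + c' i) \<in> R" if "c \<in> R" "c' \<in> R" for c c'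
    using R_lincomb[of "{0,1::nat}" "\<lambda>i. if i = 0 then c else c'" "\<lambda>_. 1"] that by auto
  \<comment> \<open>No nonzero vector of \<open>R\<close> is supported on \<open>B\<close>.\<close>
  define indep where "indep B \<longleftrightarrow> B \<subseteq> {..<N} \<and> (\<forall>c\<in>R. (\<forall>i<N. i \<notin> B \<longrightarrow> c i = 0) \<longrightarrow> (\<forall>i<N. c i = 0))" for B
  have "indep {0}"
  proof -
    have "c 0 = 0" if "c \<in> R" "\<forall>i<N. i \<noteq> 0 \<longrightarrow> c i = 0" for c
    proof -
      have "(\<Sum>i<N. c i) = (\<Sum>i\<in>{0}. c i)"
        by (rule sum.mono_neutral_right) (use that N0 in auto)
      then show ?thesis using R_sum[OF that(1)] by simp
    qed
    then show ?thesis unfolding indep_def using N0 by (metis empty_subsetI insert_subset lessThan_iff singletonD singletonI)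
  qed
  moreover have "finite {B. indep B}" by (rule finite_subset[of _ "Pow {..<N}"]) (auto simp: indep_def)
  ultimately obtain B where B: "indep B" "\<And>B'. indep B' \<Longrightarrow> B \<subseteq> B' \<Longrightarrow> B' = B" and "{0} \<subseteq> B"
    using finite_has_maximal2[of "{B. indep B}" "{0}"] by (metis mem_Collect_eq)
  have BN: "B \<subseteq> {..<N}" and finB: "finite B"
    using B(1) finite_subset[of B "{..<N}"] by (auto simp: indep_def)
  have B_indep: "c i = 0" if "c \<in> R" "\<And>i. i < N \<Longrightarrow> i \<notin> B \<Longrightarrow> c i = 0" "i < N" for c i
    using B(1) that by (auto simp: indep_def)
  define e :: "nat \<Rightarrow> nat \<Rightarrow> bit" where "e i j = (if j = i then 1 else 0)" for i j
  have "\<exists>s. (\<forall>j. j \<notin> B \<longrightarrow> s j = 0) \<and> (\<lambda>j. e i j + s j) \<in> R" if i: "i < N" for i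
  proof (cases "i \<in> B")
    case True
    have "(\<lambda>j. e i j + e i j) = (\<lambda>_. 0)" by (auto simp: e_def)
    then show ?thesis using True R_zero by (intro exI[of _ "e i"]) (auto simp: e_def)
  next
    case False
    then have "\<not> indep (insert i B)" using B(2)[of "insert i B"] by blast
    then obtain c j where c: "c \<in> R" "\<And>i'. i' < N \<Longrightarrow> i' \<notin> insert i B \<Longrightarrow> c i' = 0" "j < N" "c j \<noteq> 0"
      unfolding indep_def using i BN by blast
    have "c i \<noteq> 0"
    proof
      assume "c i = 0"
      then have "c j = 0" by (intro B_indep[OF c(1) _ c(3)]) (metis c(2) insert_iff)
      with c(4) show False by simp
    qed
    then have "c i = 1" by simp
    have "(\<lambda>j. e i j + (if j \<in> B then c j else 0)) \<in> R"
      by (rule R_cong[OF c(1)]) (use c(2) False \<open>c i = 1\<close> in \<open>auto simp: e_def\<close>)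
    then show ?thesis by (intro exI[of _ "\<lambda>j. if j \<in> B then c j else 0"]) auto
  qed
  then obtain s where s: "\<And>i j. i < N \<Longrightarrow> j \<notin> B \<Longrightarrow> s i j = 0" "\<And>i. i < N \<Longrightarrow> (\<lambda>j. e i j + s i j) \<in> R"
    by metis
  obtain r where r: "card B = Suc r" using \<open>{0} \<subseteq> B\<close> finB by (cases "card B") auto
  obtain b where b: "bij_betw b {..<Suc r} B"
    using ex_bij_betw_nat_finite[OF finB] r by (auto simp: lessThan_atLeast0)
  have bB: "b k \<in> B" if "k < Suc r" for k using b that by (auto simp: bij_betw_def)
  have bN: "b k < N" if "k < Suc r" for k using bB[OF that] BN by auto
  have sumB: "(\<Sum>i<N. f i) = f (b 0) + (\<Sum>k<r. f (b (Suc k)))"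
    if "\<And>i. i < N \<Longrightarrow> i \<notin> B \<Longrightarrow> f i = 0" for f :: "nat \<Rightarrow> bit"
  proof -
    have "(\<Sum>i<N. f i) = (\<Sum>i\<in>B. f i)" by (rule sum.mono_neutral_right) (use BN that in auto)
    also have "\<dots> = (\<Sum>k<Suc r. f (b k))" by (rule sum.reindex_bij_betw[OF b, symmetric])
    finally show ?thesis by (simp add: sum.lessThan_Suc_shift del: sum.lessThan_Suc)
  qed
  have s_b: "s (b k) j = e (b k) j" if "k < Suc r" "j < N" for k j
  proof -
    have "e (b k) j + s (b k) j = 0"
      by (rule B_indep[OF s(2)[OF bN[OF that(1)]] _ that(2)])
         (use s(1)[OF bN[OF that(1)]] bB[OF that(1)] in \<open>auto simp: e_def\<close>)
    then show ?thesis by (cases "e (b k) j"; cases "s (b k) j") auto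
  qed
  define y where "y i = Matrix.vec r (\<lambda>k. s i (b (Suc k)))" for i
  have y_carrier: "y i \<in> carrier_vec r" for i by (simp add: y_def)
  have KL: "K = point_lattice N r y"
  proof -
    have "x \<in> K \<longleftrightarrow> x \<in> point_lattice N r y" if x: "(\<Sum>i<N. x i) = 0" for x
    proof -
      define c :: "nat \<Rightarrow> bit" where "c i = of_int (x i)" for i
      define t where "t j = (\<Sum>i<N. c i * s i j)" for j
      \<comment> \<open>So \<open>c\<close> and its image \<open>t\<close> in the coordinates of \<open>B\<close> are congruent modulo \<open>R\<close>.\<close>
      have ct: "(\<lambda>j. \<Sum>i<N. c i * (e i j + s i j)) \<in> R"
        by (rule R_lincomb) (use s(2) in auto)
      have ct': "(\<Sum>i<N. c i * (e i j + s i j)) = c j + t j" if "j < N" for j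
      proof -
        have "(\<Sum>i<N. c i * (e i j + s i j)) = (\<Sum>i<N. (if i = j then c i else 0)) + t j"
          unfolding t_def sum.distrib[symmetric] by (rule sum.cong) (auto simp: e_def algebra_simps)
        then show ?thesis using that by simp
      qed
      have ctR: "(\<lambda>j. c j + t j) \<in> R" by (rule R_cong[OF ct]) (simp add: ct')
      have "(\<Sum>j<N. c j) = 0" using x by (simp add: c_def flip: of_int_sum)
      then have "(\<Sum>j<N. t j) = 0" using R_sum[OF ctR] by (simp add: sum.distrib)
      moreover have tB: "t j = 0" if "j < N" "j \<notin> B" for j
        unfolding t_def by (rule sum.neutral) (use s(1) that in auto)
      ultimately have t_sum: "t (b 0) + (\<Sum>k<r. t (b (Suc k))) = 0" using sumB by metis
      have "x \<in> K \<longleftrightarrow> c \<in> R"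
      proof -
        have "x \<in> K" if "c \<in> R"
        proof -
          from that obtain z where "z \<in> K" "c = (\<lambda>i. of_int (z i))" unfolding R_def by blast
          then show ?thesis using paired_lattice_reduction_iff[OF K x[unfolded N_def]]
            by (metis c_def)
        qed
        moreover have "c \<in> R" if "x \<in> K"
          unfolding R_def by (rule image_eqI[OF _ that]) (simp add: c_def fun_eq_iff)
        ultimately show ?thesis by blast
      qed
      also have "\<dots> \<longleftrightarrow> t \<in> R"
      proof
        assume "c \<in> R"
        from R_add[OF this ctR] show "t \<in> R" by (rule R_cong) (simp add: add.assoc[symmetric])
      next
        assume "t \<in> R"
        from R_add[OF this ctR] show "c \<in> R" by (rule R_cong) (simp add: add.left_commute)
      qed
      also have "\<dots> \<longleftrightarrow> (\<forall>j<N. t j = 0)"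
      proof
        assume "t \<in> R" then show "\<forall>j<N. t j = 0" using B_indep[of t] tB by blast
      next
        assume "\<forall>j<N. t j = 0" then show "t \<in> R" by (intro R_cong[OF R_zero]) auto
      qed
      also have "\<dots> \<longleftrightarrow> (\<forall>k<r. t (b (Suc k)) = 0)"
      proof
        assume *: "\<forall>k<r. t (b (Suc k)) = 0"
        then have "t (b 0) = 0" using t_sum by simp
        with * have "\<forall>k<Suc r. t (b k) = 0" using less_Suc_eq_0_disj by auto
        then have "\<forall>j\<in>B. t j = 0" using b by (auto simp: bij_betw_def)
        then show "\<forall>j<N. t j = 0" using tB by blast
      qed (use bN in auto)
      also have "\<dots> \<longleftrightarrow> x \<in> point_lattice N r y"
        using x by (auto simp: point_lattice_def t_def c_def y_def)
      finally show ?thesis .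
    qed
    moreover have "(\<Sum>i<N. x i) = 0" if "x \<in> K" for x
      using paired_lattice_sum_eq_0[OF K that] by (simp add: N_def)
    ultimately show ?thesis by (auto simp: point_lattice_def)
  qed
  have y_pair: "y (i + d + 1) = y i" if "i \<le> d" for i
  proof (rule eq_vecI)
    fix k assume "k < dim_vec (y i)"
    then have k: "k < r" by (simp add: y_def)
    have iN: "i < N" "i + d + 1 < N" using that by (auto simp: N_def num_rays_def)
    have "(\<Sum>j<N. of_int (unit_at i j - unit_at (i+d+1) j) * vec_index (y j) k) = 0"
      using paired_lattice_pair[OF K that] k unfolding KL point_lattice_def by blast
    also have "(\<Sum>j<N. of_int (unit_at i j - unit_at (i+d+1) j) * vec_index (y j) k)
       = (\<Sum>j<N. if j = i then vec_index (y j) k else 0) + (\<Sum>j<N. if j = i+d+1 then vec_index (y j) k else 0)"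
      unfolding sum.distrib[symmetric] by (rule sum.cong) (auto simp: unit_at_def)
    also have "\<dots> = vec_index (y i) k + vec_index (y (i+d+1)) k"
      using iN by simp
    finally show "vec_index (y (i+d+1)) k = vec_index (y i) k"
      by (cases "vec_index (y i) k"; cases "vec_index (y (i+d+1)) k") auto
  qed (simp add: y_def)
  define X where "X = image_mset y (mset_set {..d})"
  have XX: "image_mset y (mset_set {..<N}) = X + X"
    unfolding N_def X_def by (rule mset_two_halves) (use y_pair in auto)
  have set_X: "set_mset X = y ` {..<N}"
    using arg_cong[OF XX, of set_mset] by simp
  have "affine_span r (set_mset X) = carrier_vec r"
  proof -
    have "\<exists>c. (\<Sum>i<N. c i) = 1 \<and> (\<forall>k<r. vec_index v k = (\<Sum>i<N. c i * vec_index (y i) k))"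
      if v: "v \<in> carrier_vec r" for v
    proof -
      \<comment> \<open>The coefficient at the origin \<open>y (b 0)\<close> is chosen to make the sum equal to \<open>1\<close>.\<close>
      define g where "g m = (case m of 0 \<Rightarrow> 1 + (\<Sum>k<r. vec_index v k) | Suc k \<Rightarrow> vec_index v k)" for m
      define c where "c i = (if i \<in> B then g (the_inv_into {..<Suc r} b i) else 0)" for i
      have cb: "c (b m) = g m" if "m < Suc r" for m
        using that bB[OF that] b by (simp add: c_def bij_betw_def the_inv_into_f_f)
      have "(\<Sum>i<N. c i) = 1"
      proof -
        have "(\<Sum>i<N. c i) = c (b 0) + (\<Sum>k<r. c (b (Suc k)))"
          by (rule sumB) (simp add: c_def)
        also have "\<dots> = g 0 + (\<Sum>k<r. g (Suc k))" by (simp add: cb)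
        also have "\<dots> = 1" by (simp add: g_def add.assoc)
        finally show ?thesis .
      qed
      moreover have "vec_index v k = (\<Sum>i<N. c i * vec_index (y i) k)" if k: "k < r" for k
      proof -
        have yb: "vec_index (y (b m)) k = (if m = Suc k then 1 else 0)" if "m < Suc r" for m
          using s_b[OF that bN[of "Suc k"]] k b that
          by (auto simp: y_def e_def bij_betw_def inj_on_def)
        have "(\<Sum>i<N. c i * vec_index (y i) k)
            = c (b 0) * vec_index (y (b 0)) k + (\<Sum>m<r. c (b (Suc m)) * vec_index (y (b (Suc m))) k)"
          by (rule sumB) (simp add: c_def)
        also have "\<dots> = (\<Sum>m<r. c (b (Suc m)) * vec_index (y (b (Suc m))) k)"
          by (simp add: yb)
        also have "\<dots> = (\<Sum>m<r. if m = k then g (Suc m) else 0)"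
          by (rule sum.cong) (auto simp: yb cb)
        also have "\<dots> = vec_index v k" using k by (simp add: g_def)
        finally show ?thesis by simp
      qed
      ultimately show ?thesis by blast
    qed
    then show ?thesis unfolding set_X by (subst affine_span_family) (use y_carrier in auto)
  qed
  moreover have "size X = d + 1" "set_mset X \<subseteq> carrier_vec r" using y_carrier by (auto simp: X_def)
  ultimately have "(r, X) \<in> point_configs d" by (simp add: point_configs_def)
  moreover have "K \<in> config_labels d (r, X)" using XX KL by (auto simp: config_labels_def N_def)
  ultimately show ?thesis by blast
qed

text \<open>The lattice belonging to the enumeration precomposed with \<open>p\<close>.\<close>

definition permute_lattice :: "(nat \<Rightarrow> nat) \<Rightarrow> (nat \<Rightarrow> int) set \<Rightarrow> (nat \<Rightarrow> int) set" where
  "permute_lattice p K = {x. x \<circ> inv_into UNIV p \<in> K}"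

text \<open>The labels of one object are the lattices of its different enumerations; they form a single
  orbit of the permutations of the coordinates.\<close>

definition label_orbit :: "nat \<Rightarrow> (nat \<Rightarrow> int) set set \<Rightarrow> bool" where
  "label_orbit N L \<longleftrightarrow>
     (\<forall>K\<in>L. \<forall>K'. K' \<in> L \<longleftrightarrow> (\<exists>p. p permutes {..<N} \<and> K' = permute_lattice p K))"

lemma label_orbits_eq:
  assumes "label_orbit N L" "label_orbit N L'" "L \<inter> L' \<noteq> {}"
  shows "L = L'"
proof -
  obtain K where "K \<in> L" "K \<in> L'" using assms(3) by blast
  then have "K' \<in> L \<longleftrightarrow> K' \<in> L'" for K'
    using assms(1,2) unfolding label_orbit_def by metis
  then show ?thesis by blast
qed

lemma point_lattice_cong: "(\<And>i. i < N \<Longrightarrow> y' i = y i) \<Longrightarrow> point_lattice N r y' = point_lattice N r y"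
  by (simp add: point_lattice_def)

lemma point_lattice_permute:
  assumes p: "p permutes {..<N}"
  shows "point_lattice N r (y \<circ> p) = permute_lattice p (point_lattice N r y)"
proof -
  have *: "(\<Sum>i<N. f (inv_into UNIV p i) i) = (\<Sum>i<N. f i (p i))" for f :: "nat \<Rightarrow> nat \<Rightarrow> 'a::comm_monoid_add"
    using sum.permute[OF p, of "\<lambda>i. f (inv_into UNIV p i) i"] by (simp add: comp_def permutes_inverses[OF p])
  show ?thesis
    by (simp add: point_lattice_def permute_lattice_def *[of "\<lambda>i j. _ i"] *[of "\<lambda>i j. of_int (_ i) * vec_index (y j) _"])
qed

lemma config_labels_orbit: "label_orbit (num_rays d) (config_labels d a)"
proof -
  obtain r X where a: "a = (r, X)" by (cases a)
  let ?N = "num_rays d"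
  {
    fix y K' assume y: "image_mset y (mset_set {..<?N}) = X + X"
    have "K' \<in> config_labels d a \<longleftrightarrow> (\<exists>p. p permutes {..<?N} \<and> K' = permute_lattice p (point_lattice ?N r y))"
    proof
      assume "K' \<in> config_labels d a"
      then obtain y' where y': "K' = point_lattice ?N r y'" "image_mset y' (mset_set {..<?N}) = X + X"
        by (auto simp: a config_labels_def)
      obtain p where p: "p permutes {..<?N}" "\<forall>i\<in>{..<?N}. y' i = y (p i)"
        using image_mset_eq_implies_permutes[of "{..<?N}" y' y] y y' by auto
      have "K' = point_lattice ?N r (y \<circ> p)"
        unfolding y' by (rule point_lattice_cong) (use p in auto)
      then show "\<exists>p. p permutes {..<?N} \<and> K' = permute_lattice p (point_lattice ?N r y)"
        using p point_lattice_permute by blast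
    next
      assume "\<exists>p. p permutes {..<?N} \<and> K' = permute_lattice p (point_lattice ?N r y)"
      then obtain p where p: "p permutes {..<?N}" "K' = point_lattice ?N r (y \<circ> p)"
        using point_lattice_permute by blast
      have "image_mset (y \<circ> p) (mset_set {..<?N}) = image_mset y (image_mset p (mset_set {..<?N}))"
        by (simp add: multiset.map_comp)
      also have "image_mset p (mset_set {..<?N}) = mset_set {..<?N}"
        using permutes_image_mset[OF p(1)] by simp
      finally have "image_mset (y \<circ> p) (mset_set {..<?N}) = X + X" unfolding y .
      with p(2) show "K' \<in> config_labels d a" unfolding a config_labels_def by blast
    qed
  }
  then show ?thesis by (auto simp: label_orbit_def a config_labels_def)
qed

text \<open>The enumeration lists the points once and then once more in the same order.\<close>

lemma config_has_paired_label:
  assumes "a \<in> point_configs d"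
  shows "\<exists>K\<in>config_labels d a. paired_lattice d K"
proof -
  obtain r X where a: "a = (r, X)" by (cases a)
  have size: "size X = d + 1" using assms by (auto simp: a point_configs_def)
  obtain xs where xs: "mset xs = X" using ex_mset by blast
  then have len: "length xs = d + 1" using size by auto
  define y where "y i = xs ! (if i \<le> d then i else i - d - 1)" for i
  define N where "N = num_rays d"
  define K where "K = point_lattice N r y"
  have y_pair: "y (i+d+1) = y i" if "i \<le> d" for i using that by (simp add: y_def)
  have "image_mset y (mset_set {..d}) = mset (map y [0..<d+1])"
  proof -
    have "{0..<d+1} = {..d}" by auto
    then show ?thesis by (simp only: mset_map mset_upt)
  qed
  also have "map y [0..<d+1] = xs" by (rule nth_equalityI) (auto simp: len y_def simp del: upt_Suc)
  finally have "image_mset y (mset_set {..<N}) = X + X"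
    using mset_two_halves[of d y] y_pair xs by (simp add: N_def)
  then have "K \<in> config_labels d a" by (auto simp: a config_labels_def K_def N_def)
  moreover have "paired_lattice d K"
    unfolding paired_lattice_def N_def[symmetric]
  proof (intro conjI ballI allI impI)
    fix x x' assume "x \<in> K" "x' \<in> K"
    then show "(\<lambda>i. x i - x' i) \<in> K"
      by (auto simp: K_def point_lattice_def sum_subtractf left_diff_distrib simp del: minus_bit_def)
  next
    fix x x' assume "x \<in> K" "\<forall>i<N. x' i = x i"
    then show "x' \<in> K" by (simp add: K_def point_lattice_def)
  next
    fix x assume "x \<in> K" then show "(\<Sum>i<N. x i) = 0" by (simp add: K_def point_lattice_def)
  next
    fix i j assume ij: "i < N" "j < N"
    have "(\<Sum>k<N. 2 * unit_at i k - 2 * unit_at j k) = 0"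
      using ij by (simp add: unit_at_def sum_subtractf flip: sum_distrib_left)
    then show "(\<lambda>k. 2 * unit_at i k - 2 * unit_at j k) \<in> K" by (simp add: K_def point_lattice_def)
  next
    fix i assume i: "i \<le> d"
    then have iN: "i < N" "i + d + 1 < N" by (auto simp: N_def num_rays_def)
    have "(\<Sum>k<N. unit_at i k - unit_at (i+d+1) k) = 0"
      using iN by (simp add: unit_at_def sum_subtractf)
    moreover have "(\<Sum>j<N. of_int (unit_at i j - unit_at (i+d+1) j) * vec_index (y j) k) = 0" for k
    proof -
      have "(\<Sum>j<N. of_int (unit_at i j - unit_at (i+d+1) j) * vec_index (y j) k)
         = (\<Sum>j<N. if j = i then vec_index (y j) k else 0) + (\<Sum>j<N. if j = i+d+1 then vec_index (y j) k else 0)"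
        unfolding sum.distrib[symmetric] by (rule sum.cong) (auto simp: unit_at_def)
      also have "\<dots> = vec_index (y i) k + vec_index (y i) k"
        using iN y_pair[OF i] by simp
      finally show ?thesis by (cases "vec_index (y i) k") auto
    qed
    ultimately show "(\<lambda>k. unit_at i k - unit_at (i+d+1) k) \<in> K" by (simp add: K_def point_lattice_def)
  qed
  ultimately show ?thesis by blast
qed

section \<open>The affine group of a configuration\<close>

text \<open>An affine relation with coefficients in the field of two elements lifts to an integer vector of
  coordinate sum exactly zero: all coordinates but one are lifted to \<open>0\<close> or \<open>1\<close>, and the remaining one
  corrects the sum.\<close>

lemma point_lattice_bit_relations:
  fixes c :: "nat \<Rightarrow> bit"
  assumes sub: "point_lattice N r y \<subseteq> point_lattice N r' y'" and N: "0 < N"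
    and c: "(\<Sum>i<N. c i) = 0" "\<And>k. k < r \<Longrightarrow> (\<Sum>i<N. c i * vec_index (y i) k) = 0"
    and k: "k < r'"
  shows "(\<Sum>i<N. c i * vec_index (y' i) k) = 0"
proof -
  obtain M where M: "N = Suc M" using N by (cases N) auto
  define z :: "nat \<Rightarrow> int" where "z i = of_bool (odd (c i))" for i
  have z: "of_int (z i) = c i" for i by (cases "c i") (auto simp: z_def)
  define x where "x i = (if i = 0 then - (\<Sum>j<M. z (Suc j)) else z i)" for i
  have "c 0 + (\<Sum>j<M. c (Suc j)) = 0"
    using c(1) by (simp add: M sum.lessThan_Suc_shift del: sum.lessThan_Suc)
  then have c0: "c 0 = (\<Sum>j<M. c (Suc j))"
    by (simp only: bit_add_eq_0_iff)
  have x: "of_int (x i) = c i" for i by (auto simp: x_def z c0)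
  have "x \<in> point_lattice N r y"
    using c(2) by (simp add: point_lattice_def x M sum.lessThan_Suc_shift del: sum.lessThan_Suc) (simp add: x_def)
  then have "x \<in> point_lattice N r' y'" using sub by blast
  then show ?thesis using k by (simp add: point_lattice_def x)
qed

text \<open>The unit vectors are differences of two points of the affine span, namely of themselves and the
  origin, and hence combinations with coefficient sum zero.\<close>

lemma affine_span_unit_combinations:
  fixes y :: "nat \<Rightarrow> bit Matrix.vec"
  assumes y: "\<And>i. i < N \<Longrightarrow> y i \<in> carrier_vec r"
    and span: "affine_span r (y ` {..<N}) = carrier_vec r"
  shows "\<exists>c. (\<forall>l<r. (\<Sum>i<N. c l i) = 0) \<and>
    (\<forall>l<r. \<forall>k<r. (\<Sum>i<N. c l i * vec_index (y i) k) = (if k = l then 1 else 0))"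
proof -
  have combo: "\<exists>c. (\<Sum>i<N. c i) = 1 \<and> (\<forall>k<r. vec_index v k = (\<Sum>i<N. c i * vec_index (y i) k))"
    if "v \<in> carrier_vec r" for v
    using that span affine_span_family[of N y r] y by auto
  obtain c0 where c0: "(\<Sum>i<N. c0 i) = 1" "\<And>k. k < r \<Longrightarrow> (\<Sum>i<N. c0 i * vec_index (y i) k) = 0"
    using combo[of "0\<^sub>v r"] by auto
  have "\<exists>c. (\<Sum>i<N. c i) = 0 \<and> (\<forall>k<r. (\<Sum>i<N. c i * vec_index (y i) k) = (if k = l then 1 else 0))"
    if l: "l < r" for l
  proof -
    obtain c where c: "(\<Sum>i<N. c i) = 1" "\<forall>k<r. vec_index (unit_vec r l) k = (\<Sum>i<N. c i * vec_index (y i) k)"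
      using combo[of "unit_vec r l"] by auto
    show ?thesis
      using c c0 l by (intro exI[of _ "\<lambda>i. c i + c0 i"]) (auto simp: sum.distrib distrib_right)
  qed
  then show ?thesis by metis
qed

text \<open>The map sends a unit vector, written as a combination of the \<open>y\<^sub>j\<close> with coefficient sum zero, to the
  same combination of the \<open>y'\<^sub>j\<close>. That \<open>y\<^sub>i - y\<^sub>0\<close> is sent to \<open>y'\<^sub>i - y'\<^sub>0\<close> is an affine relation among
  the \<open>y\<^sub>j\<close>, which the inclusion of lattices carries over to the \<open>y'\<^sub>j\<close>.\<close>

lemma affine_transfer:
  fixes y y' :: "nat \<Rightarrow> bit Matrix.vec"
  assumes y: "\<And>i. i < N \<Longrightarrow> y i \<in> carrier_vec r"
    and y': "\<And>i. i < N \<Longrightarrow> y' i \<in> carrier_vec r'"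
    and sub: "point_lattice N r y \<subseteq> point_lattice N r' y'" and N: "0 < N"
    and span: "affine_span r (y ` {..<N}) = carrier_vec r"
  shows "\<exists>M\<in>carrier_mat r' r. \<forall>i<N. M *\<^sub>v (y i - y 0) = y' i - y' 0"
proof -
  obtain c where c: "\<And>l. l < r \<Longrightarrow> (\<Sum>i<N. c l i) = 0"
    "\<And>l k. l < r \<Longrightarrow> k < r \<Longrightarrow> (\<Sum>i<N. c l i * vec_index (y i) k) = (if k = l then 1 else 0)"
    using affine_span_unit_combinations[OF y span] by blast
  define M where "M = mat r' r (\<lambda>(m, l). \<Sum>i<N. c l i * vec_index (y' i) m)"
  have "M *\<^sub>v (y i - y 0) = y' i - y' 0" if i: "i < N" for i
  proof (rule eq_vecI)
    fix m assume "m < dim_vec (y' i - y' 0)"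
    then have m: "m < r'" using y'[OF i] y'[OF N] by simp
    \<comment> \<open>The relation \<open>g\<close> states that \<open>y i - y 0\<close> equals the combination of unit vectors given by its entries.\<close>
    define e where "e j = (if j = i then 1 else 0) + (if j = 0 then 1 else 0::bit)" for j
    define w where "w l = vec_index (y i) l + vec_index (y 0) l" for l
    have e_sum: "(\<Sum>j<N. e j * f j) = f i + f 0" for f
    proof -
      have "(\<Sum>j<N. e j * f j) = (\<Sum>j<N. if j = i then f j else 0) + (\<Sum>j<N. if j = 0 then f j else 0)"
        unfolding sum.distrib[symmetric] by (rule sum.cong) (auto simp: e_def)
      then show ?thesis using i N by simp
    qed
    define g where "g j = e j + (\<Sum>l<r. w l * c l j)" for j
    have g_sum: "(\<Sum>j<N. g j * f j) = f i + f 0 + (\<Sum>l<r. w l * (\<Sum>j<N. c l j * f j))" for f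
    proof -
      have "(\<Sum>j<N. g j * f j) = (\<Sum>j<N. e j * f j) + (\<Sum>j<N. \<Sum>l<r. w l * (c l j * f j))"
        by (simp add: g_def distrib_right sum.distrib sum_distrib_right mult.assoc)
      also have "(\<Sum>j<N. \<Sum>l<r. w l * (c l j * f j)) = (\<Sum>l<r. w l * (\<Sum>j<N. c l j * f j))"
        by (subst sum.swap) (simp add: sum_distrib_left)
      finally show ?thesis by (simp add: e_sum)
    qed
    have "(\<Sum>j<N. g j * vec_index (y' j) m) = 0"
    proof (rule point_lattice_bit_relations[OF sub N _ _ m])
      show "(\<Sum>j<N. g j) = 0" using g_sum[of "\<lambda>_. 1"] by (simp add: c(1))
    next
      fix k assume k: "k < r"
      have "(\<Sum>l<r. w l * (\<Sum>j<N. c l j * vec_index (y j) k)) = (\<Sum>l<r. if l = k then w l else 0)"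
        by (rule sum.cong) (use k in \<open>auto simp: c(2)\<close>)
      then show "(\<Sum>j<N. g j * vec_index (y j) k) = 0" using k by (simp add: g_sum w_def)
    qed
    then have "vec_index (y' i) m + vec_index (y' 0) m
        + (\<Sum>l<r. w l * (\<Sum>j<N. c l j * vec_index (y' j) m)) = 0" by (simp add: g_sum)
    moreover have "vec_index (M *\<^sub>v (y i - y 0)) m = (\<Sum>l<r. w l * (\<Sum>j<N. c l j * vec_index (y' j) m))"
      using m y[OF i] y[OF N]
      by (simp add: M_def scalar_prod_def w_def lessThan_atLeast0 mult.commute)
    ultimately show "vec_index (M *\<^sub>v (y i - y 0)) m = vec_index (y' i - y' 0) m"
      using m y'[OF i] y'[OF N] by (simp add: bit_add_eq_0_iff)
  qed (use y'[OF i] y'[OF N] in \<open>simp add: M_def\<close>)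
  then show ?thesis by (auto simp: M_def intro!: bexI[of _ M])
qed

text \<open>Used to conclude that configurations with the same lattice live in the same dimension.\<close>

lemma card_bit_carrier_vec: "card (carrier_vec r :: bit Matrix.vec set) = 2 ^ r"
proof -
  have "bij_betw (\<lambda>v. {k. k < r \<and> vec_index v k = (1::bit)}) (carrier_vec r) (Pow {..<r})"
  proof (rule bij_betwI[where g = "\<lambda>S. Matrix.vec r (\<lambda>k. of_bool (k \<in> S))"])
    fix v :: "bit Matrix.vec" assume v: "v \<in> carrier_vec r"
    show "Matrix.vec r (\<lambda>k. of_bool (k \<in> {k. k < r \<and> vec_index v k = 1})) = v"
      by (rule eq_vecI) (use v in auto)
  qed auto
  then show ?thesis using bij_betw_same_card card_Pow by fastforce
qed

text \<open>Coefficients with sum zero ignore the translation, and the linear part is injective.\<close>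

lemma point_lattice_AGL:
  fixes y :: "nat \<Rightarrow> bit Matrix.vec"
  assumes y: "\<And>i. i < N \<Longrightarrow> y i \<in> carrier_vec r" and g: "g \<in> AGL r"
  shows "point_lattice N r (AGL_act g \<circ> y) = point_lattice N r y"
proof -
  obtain v M where vM: "g = (v, M)" "v \<in> carrier_vec r" "M \<in> carrier_mat r r" "invertible_mat M"
    using g by (auto simp: AGL_def)
  obtain B where B: "B * M = 1\<^sub>m r" "B \<in> carrier_mat r r"
  proof -
    obtain B where "M * B = 1\<^sub>m r" "B * M = 1\<^sub>m (dim_row B)"
      using vM(3,4) by (auto simp: invertible_mat_def inverts_mat_def)
    moreover from this have "B \<in> carrier_mat r r"
      using vM(3) by (metis carrier_matD(2) carrier_matI index_mult_mat(3) index_one_mat(3))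
    ultimately show ?thesis using that by auto
  qed
  have "(\<forall>k<r. (\<Sum>i<N. of_int (x i) * vec_index (AGL_act g (y i)) k) = 0)
      \<longleftrightarrow> (\<forall>k<r. (\<Sum>i<N. of_int (x i) * vec_index (y i) k) = 0)" if x: "(\<Sum>i<N. x i) = 0" for x
  proof -
    define z where "z = Matrix.vec r (\<lambda>l. \<Sum>i<N. of_int (x i) * vec_index (y i) l)"
    have zc: "z \<in> carrier_vec r" by (simp add: z_def)
    have sx: "(\<Sum>i<N. of_int (x i) :: bit) = 0" using x by (simp flip: of_int_sum)
    have "(\<Sum>i<N. of_int (x i) * vec_index (AGL_act g (y i)) k) = vec_index (M *\<^sub>v z) k" if k: "k < r" for k
    proof -
      have "(\<Sum>i<N. of_int (x i) * vec_index (AGL_act g (y i)) k)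
          = (\<Sum>i<N. (\<Sum>l<r. of_int (x i) * (M $$ (k, l) * vec_index (y i) l)) + of_int (x i) * vec_index v k)"
      proof (rule sum.cong)
        fix i assume "i \<in> {..<N}"
        then have "dim_vec (y i) = r" using y[of i] by simp
        then show "of_int (x i) * vec_index (AGL_act g (y i)) k
            = (\<Sum>l<r. of_int (x i) * (M $$ (k, l) * vec_index (y i) l)) + of_int (x i) * vec_index v k"
          using vM k by (simp add: AGL_act_def scalar_prod_def distrib_left sum_distrib_left lessThan_atLeast0)
      qed simp
      also have "\<dots> = (\<Sum>i<N. (\<Sum>l<r. of_int (x i) * (M $$ (k, l) * vec_index (y i) l)))"
        by (simp add: sum.distrib sx flip: sum_distrib_right)
      also have "\<dots> = (\<Sum>l<r. M $$ (k, l) * (\<Sum>i<N. of_int (x i) * vec_index (y i) l))"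
        by (subst sum.swap) (simp add: sum_distrib_left mult.left_commute)
      also have "\<dots> = vec_index (M *\<^sub>v z) k"
        using vM k by (simp add: z_def scalar_prod_def lessThan_atLeast0)
      finally show ?thesis .
    qed
    then have "(\<forall>k<r. (\<Sum>i<N. of_int (x i) * vec_index (AGL_act g (y i)) k) = 0) \<longleftrightarrow> M *\<^sub>v z = 0\<^sub>v r"
      using vM(3) by (auto simp: Matrix.vec_eq_iff simp del: index_mult_mat_vec)
    also have "\<dots> \<longleftrightarrow> z = 0\<^sub>v r"
    proof
      assume "M *\<^sub>v z = 0\<^sub>v r"
      then have "B *\<^sub>v (M *\<^sub>v z) = 0\<^sub>v r" using B by auto
      then show "z = 0\<^sub>v r"
        using assoc_mult_mat_vec[OF B(2) vM(3) zc] B(1) zc by simp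
    qed (use vM(3) in auto)
    also have "\<dots> \<longleftrightarrow> (\<forall>k<r. (\<Sum>i<N. of_int (x i) * vec_index (y i) k) = 0)"
      by (simp add: z_def Matrix.vec_eq_iff)
    finally show ?thesis .
  qed
  then show ?thesis by (auto simp: point_lattice_def)
qed

text \<open>The differences \<open>y\<^sub>i - y\<^sub>0\<close> span the whole space when the \<open>y\<^sub>i\<close> span it affinely.\<close>

lemma transfer_inverse:
  fixes y :: "nat \<Rightarrow> bit Matrix.vec"
  assumes y: "\<And>i. i < N \<Longrightarrow> y i \<in> carrier_vec r"
    and span: "affine_span r (y ` {..<N}) = carrier_vec r"
    and A: "(A :: bit mat) \<in> carrier_mat r r" "\<And>i. i < N \<Longrightarrow> A *\<^sub>v (y i - y 0) = y i - y 0"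
    and N: "0 < N"
  shows "A = 1\<^sub>m r"
proof -
  obtain c where c: "\<And>l. l < r \<Longrightarrow> (\<Sum>i<N. c l i) = 0"
    "\<And>l k. l < r \<Longrightarrow> k < r \<Longrightarrow> (\<Sum>i<N. c l i * vec_index (y i) k) = (if k = l then 1 else 0)"
    using affine_span_unit_combinations[OF y span] by blast
  have "A $$ (m, l) = 1\<^sub>m r $$ (m, l)" if ml: "m < r" "l < r" for m l
  proof -
    have unit: "(\<Sum>i<N. c l i * (vec_index (y i) k - vec_index (y 0) k)) = (if k = l then 1 else 0)" if "k < r" for k
    proof -
      have "(\<Sum>i<N. c l i * (vec_index (y i) k - vec_index (y 0) k))
         = (\<Sum>i<N. c l i * vec_index (y i) k) + (\<Sum>i<N. c l i) * vec_index (y 0) k"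
        by (simp add: distrib_left sum.distrib sum_distrib_right)
      then show ?thesis using c ml that by simp
    qed
    have "A $$ (m, l) = (\<Sum>k<r. if k = l then A $$ (m, k) else 0)" using ml by simp
    also have "\<dots> = (\<Sum>k<r. A $$ (m, k) * (\<Sum>i<N. c l i * (vec_index (y i) k - vec_index (y 0) k)))"
      by (rule sum.cong) (use unit in auto)
    also have "\<dots> = (\<Sum>i<N. c l i * (\<Sum>k<r. A $$ (m, k) * (vec_index (y i) k - vec_index (y 0) k)))"
      unfolding sum_distrib_left by (subst sum.swap) (simp only: mult.left_commute)
    also have "\<dots> = (\<Sum>i<N. c l i * (vec_index (y i) m - vec_index (y 0) m))"
    proof (rule sum.cong)
      fix i assume "i \<in> {..<N}"
      then have i: "i < N" by simp
      have "vec_index (A *\<^sub>v (y i - y 0)) m = vec_index (y i - y 0) m" using A(2)[OF i] by simp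
      then show "c l i * (\<Sum>k<r. A $$ (m, k) * (vec_index (y i) k - vec_index (y 0) k)) = c l i * (vec_index (y i) m - vec_index (y 0) m)"
        using A(1) ml y[OF i] y[OF N] by (simp add: scalar_prod_def lessThan_atLeast0)
    qed simp
    also have "\<dots> = 1\<^sub>m r $$ (m, l)" using unit[OF ml(1)] ml by simp
    finally show ?thesis .
  qed
  then show ?thesis using A(1) by (intro eq_matI) auto
qed

text \<open>Equality of lattices gives linear maps in both directions that are inverse to each other on the
  differences of the points; the translation is then adjusted at \<open>y\<^sub>0\<close>.\<close>

lemma AGL_rel_iff_labels_meet:
  assumes "a \<in> point_configs d" "b \<in> point_configs d"
  shows "(a, b) \<in> AGL_rel d \<longleftrightarrow> config_labels d a \<inter> config_labels d b \<noteq> {}"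
proof
  let ?N = "num_rays d"
  have N: "0 < ?N" by (simp add: num_rays_def)
  have carrier: "y i \<in> carrier_vec r"
    if "(r, X) \<in> point_configs d" "image_mset y (mset_set {..<?N}) = X + X" "i < ?N" for r X y i
  proof -
    have "y i \<in># X + X" using that(3) unfolding that(2)[symmetric] by simp
    then show ?thesis using that(1) by (auto simp: point_configs_def)
  qed
  {
    assume "(a, b) \<in> AGL_rel d"
    then obtain r X g where ab: "a = (r, X)" "b = (r, image_mset (AGL_act g) X)" "g \<in> AGL r"
      by (auto simp: AGL_rel_def)
    obtain y where y: "image_mset y (mset_set {..<?N}) = X + X"
      using config_has_paired_label[OF assms(1)] by (auto simp: ab config_labels_def)
    have "point_lattice ?N r y \<in> config_labels d a" using y by (auto simp: ab config_labels_def)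
    moreover have "point_lattice ?N r (AGL_act g \<circ> y) \<in> config_labels d b"
    proof -
      have "image_mset (AGL_act g \<circ> y) (mset_set {..<?N}) = image_mset (AGL_act g) (X + X)"
        by (simp only: y[symmetric] multiset.map_comp)
      then show ?thesis unfolding ab config_labels_def image_mset_union by blast
    qed
    moreover have "point_lattice ?N r (AGL_act g \<circ> y) = point_lattice ?N r y"
    proof (rule point_lattice_AGL[OF _ ab(3)])
      show "y i \<in> carrier_vec r" if "i < ?N" for i
        using carrier[OF _ y that] assms(1) by (simp add: ab)
    qed
    ultimately show "config_labels d a \<inter> config_labels d b \<noteq> {}" by auto
  }
  {
    assume "config_labels d a \<inter> config_labels d b \<noteq> {}"
    then obtain r X r' Y y y' where ab: "a = (r, X)" "b = (r', Y)"
      and y: "image_mset y (mset_set {..<?N}) = X + X" and y': "image_mset y' (mset_set {..<?N}) = Y + Y"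
      and eq: "point_lattice ?N r y = point_lattice ?N r' y'"
      by (cases a; cases b) (auto simp: config_labels_def)
    note c = carrier[OF assms(1)[unfolded ab] y] and c' = carrier[OF assms(2)[unfolded ab] y']
    have "y ` {..<?N} = set_mset X" "y' ` {..<?N} = set_mset Y"
      using arg_cong[OF y, of set_mset] arg_cong[OF y', of set_mset] by simp_all
    then have span: "affine_span r (y ` {..<?N}) = carrier_vec r" "affine_span r' (y' ` {..<?N}) = carrier_vec r'"
      using assms by (auto simp: ab point_configs_def)
    obtain M where M: "M \<in> carrier_mat r' r" "\<And>i. i < ?N \<Longrightarrow> M *\<^sub>v (y i - y 0) = y' i - y' 0"
      using affine_transfer[of ?N y r y' r', OF c c' _ N span(1)] eq by blast
    obtain M' where M': "M' \<in> carrier_mat r r'" "\<And>i. i < ?N \<Longrightarrow> M' *\<^sub>v (y' i - y' 0) = y i - y 0"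
      using affine_transfer[of ?N y' r' y r, OF c' c _ N span(2)] eq by blast
    have diff: "y i - y 0 \<in> carrier_vec r" "y' i - y' 0 \<in> carrier_vec r'" if "i < ?N" for i
      using c[OF that] c[OF N] c'[OF that] c'[OF N] by auto
    have M'M: "M' * M = 1\<^sub>m r"
      by (rule transfer_inverse[of ?N y, OF c span(1) _ _ N])
         (use M M' diff in \<open>auto simp: assoc_mult_mat_vec[OF M'(1) M(1)]\<close>)
    have MM': "M * M' = 1\<^sub>m r'"
      by (rule transfer_inverse[of ?N y', OF c' span(2) _ _ N])
         (use M M' diff in \<open>auto simp: assoc_mult_mat_vec[OF M(1) M'(1)]\<close>)
    have "bij_betw (\<lambda>v. M *\<^sub>v v) (carrier_vec r) (carrier_vec r')"
    proof (rule bij_betwI[where g = "\<lambda>v. M' *\<^sub>v v"])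
      fix v :: "bit Matrix.vec" assume v: "v \<in> carrier_vec r"
      then show "M' *\<^sub>v (M *\<^sub>v v) = v" using assoc_mult_mat_vec[OF M'(1) M(1) v] M'M by simp
    next
      fix v :: "bit Matrix.vec" assume v: "v \<in> carrier_vec r'"
      then show "M *\<^sub>v (M' *\<^sub>v v) = v" using assoc_mult_mat_vec[OF M(1) M'(1) v] MM' by simp
    qed (use M M' in auto)
    then have "(2::nat) ^ r = 2 ^ r'" using bij_betw_same_card card_bit_carrier_vec by metis
    then have r: "r' = r" by simp
    define v where "v = y' 0 - M *\<^sub>v y 0"
    have My: "M *\<^sub>v y i \<in> carrier_vec r" for i using M(1) by (intro carrier_vecI) (simp add: r)
    have vc: "v \<in> carrier_vec r" using c'[OF N] My by (simp add: v_def r)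
    have gAGL: "(v, M) \<in> AGL r"
      using M(1) M'(1) M'M MM' vc by (auto simp: AGL_def invertible_mat_def inverts_mat_def r)
    have act: "AGL_act (v, M) (y i) = y' i" if i: "i < ?N" for i
    proof -
      have "M *\<^sub>v y i - M *\<^sub>v y 0 = y' i - y' 0"
        using M(2)[OF i] mult_minus_distrib_mat_vec[OF M(1) c[OF i] c[OF N]] by simp
      then have *: "vec_index (M *\<^sub>v y i - M *\<^sub>v y 0) k = vec_index (y' i - y' 0) k" for k by simp
      show ?thesis
      proof (rule eq_vecI)
        fix k assume "k < dim_vec (y' i)"
        then have k: "k < r" using c'[OF i] r by simp
        have "p + (q + p') = q'" if "p + p' = q' + q" for p p' q q' :: bit
          using that by (cases p; cases q; cases p'; cases q') auto
        then show "vec_index (AGL_act (v, M) (y i)) k = vec_index (y' i) k"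
          using *[of k] k M(1) c'[OF i] c'[OF N]
          by (simp add: AGL_act_def v_def r del: index_mult_mat_vec)
      qed (use vc c'[OF i] r in \<open>simp add: AGL_act_def\<close>)
    qed
    have "image_mset (AGL_act (v, M)) X + image_mset (AGL_act (v, M)) X
        = image_mset (AGL_act (v, M)) (image_mset y (mset_set {..<?N}))" by (simp add: y)
    also have "\<dots> = image_mset y' (mset_set {..<?N})"
      unfolding multiset.map_comp by (rule image_mset_cong) (simp add: act)
    also have "\<dots> = Y + Y" by (fact y')
    finally have double: "image_mset (AGL_act (v, M)) X + image_mset (AGL_act (v, M)) X = Y + Y" .
    have "image_mset (AGL_act (v, M)) X = Y"
    proof (rule multiset_eqI)
      fix z
      from arg_cong[OF double, of "\<lambda>Z. count Z z"]
      show "count (image_mset (AGL_act (v, M)) X) z = count Y z"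
        unfolding count_union by linarith
    qed
    then have "\<exists>g\<in>AGL r. Y = image_mset (AGL_act g) X" using gAGL by blast
    then show "(a, b) \<in> AGL_rel d"
      using assms unfolding AGL_rel_def ab r by blast
  }
qed

section \<open>Divisor classes and the Picard number\<close>

lemma int_lattice_add: "m \<in> int_lattice \<Longrightarrow> m' \<in> int_lattice \<Longrightarrow> m + m' \<in> int_lattice"
  by (simp add: int_lattice_def)

lemma int_lattice_minus: "m \<in> int_lattice \<Longrightarrow> - m \<in> int_lattice"
  by (simp add: int_lattice_def)

lemma int_lattice_zero: "0 \<in> int_lattice"
  by (simp add: int_lattice_def)

lemma int_lattice_scale: "m \<in> int_lattice \<Longrightarrow> of_int z *\<^sub>R m \<in> int_lattice"
  by (simp add: int_lattice_def)

lemma int_lattice_inner: "m \<in> int_lattice \<Longrightarrow> u \<in> int_lattice \<Longrightarrow> inner m u \<in> \<int>"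
  by (auto simp: inner_vec_def int_lattice_def intro!: Ints_sum Ints_mult)

lemma int_lattice_inner_ints:
  assumes "m \<in> int_lattice" "u \<in> int_lattice"
  shows "\<exists>z::int. inner m u = of_int z"
  using int_lattice_inner[OF assms] Ints_cases by metis

lemma principal_iff:
  "D \<in> principal_divisors \<Sigma> \<longleftrightarrow> Poly_Mapping.keys D \<subseteq> rays \<Sigma> \<and>
     (\<exists>m\<in>int_lattice. \<forall>u\<in>rays \<Sigma>. real_of_int (Poly_Mapping.lookup D u) = inner m u)"
  by (simp add: principal_divisors_def WDiv_def)

lemma Cartier_iff:
  "Cartier \<Sigma> D \<longleftrightarrow> Poly_Mapping.keys D \<subseteq> rays \<Sigma> \<and>
     (\<forall>\<sigma>\<in>\<Sigma>. \<exists>m\<in>int_lattice. \<forall>u\<in>rays \<Sigma> \<inter> \<sigma>. real_of_int (Poly_Mapping.lookup D u) = inner m u)"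
  by (simp add: Cartier_def WDiv_def)

lemma principal_imp_Cartier: "D \<in> principal_divisors \<Sigma> \<Longrightarrow> Cartier \<Sigma> D"
  unfolding principal_iff Cartier_iff by blast

lemma Cartier_add:
  assumes "Cartier \<Sigma> D" "Cartier \<Sigma> E" shows "Cartier \<Sigma> (D + E)"
  unfolding Cartier_iff
proof (intro conjI ballI)
  show "Poly_Mapping.keys (D + E) \<subseteq> rays \<Sigma>"
    using assms keys_add[of D E] by (auto simp: Cartier_iff)
  fix \<sigma> assume "\<sigma> \<in> \<Sigma>"
  then obtain m m' where m: "m \<in> int_lattice" "\<forall>u\<in>rays \<Sigma> \<inter> \<sigma>. real_of_int (Poly_Mapping.lookup D u) = inner m u"
    "m' \<in> int_lattice" "\<forall>u\<in>rays \<Sigma> \<inter> \<sigma>. real_of_int (Poly_Mapping.lookup E u) = inner m' u"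
    using assms unfolding Cartier_iff by meson
  then show "\<exists>m\<in>int_lattice. \<forall>u\<in>rays \<Sigma> \<inter> \<sigma>. real_of_int (Poly_Mapping.lookup (D + E) u) = inner m u"
    by (intro bexI[of _ "m + m'"]) (auto simp: lookup_add inner_add_left intro: int_lattice_add)
qed

lemma Cartier_cmul:
  assumes "Cartier \<Sigma> D" shows "Cartier \<Sigma> (frag_cmul z D)"
  unfolding Cartier_iff
proof (intro conjI ballI)
  show "Poly_Mapping.keys (frag_cmul z D) \<subseteq> rays \<Sigma>"
    using assms keys_cmul[of z D] by (auto simp: Cartier_iff)
  fix \<sigma> assume "\<sigma> \<in> \<Sigma>"
  then obtain m where m: "m \<in> int_lattice" "\<forall>u\<in>rays \<Sigma> \<inter> \<sigma>. real_of_int (Poly_Mapping.lookup D u) = inner m u"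
    using assms unfolding Cartier_iff by meson
  then show "\<exists>m\<in>int_lattice. \<forall>u\<in>rays \<Sigma> \<inter> \<sigma>. real_of_int (Poly_Mapping.lookup (frag_cmul z D) u) = inner m u"
    by (intro bexI[of _ "of_int z *\<^sub>R m"]) (auto intro: int_lattice_scale)
qed

lemma principal_add:
  assumes "D \<in> principal_divisors \<Sigma>" "E \<in> principal_divisors \<Sigma>"
  shows "D + E \<in> principal_divisors \<Sigma>"
proof -
  obtain m m' where m: "m \<in> int_lattice" "\<forall>u\<in>rays \<Sigma>. real_of_int (Poly_Mapping.lookup D u) = inner m u"
    "m' \<in> int_lattice" "\<forall>u\<in>rays \<Sigma>. real_of_int (Poly_Mapping.lookup E u) = inner m' u"
    using assms unfolding principal_iff by meson
  have "Poly_Mapping.keys (D + E) \<subseteq> rays \<Sigma>"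
    using assms keys_add[of D E] by (auto simp: principal_iff)
  then show ?thesis
    unfolding principal_iff using m
    by (intro conjI bexI[of _ "m + m'"]) (auto simp: lookup_add inner_add_left intro: int_lattice_add)
qed

lemma principal_uminus: "D \<in> principal_divisors \<Sigma> \<Longrightarrow> - D \<in> principal_divisors \<Sigma>"
  unfolding principal_iff
  by (auto intro!: bexI[where x = "- _"] intro: int_lattice_minus)

lemma principal_zero: "0 \<in> principal_divisors \<Sigma>"
  unfolding principal_iff by (auto intro!: bexI[where x = 0] int_lattice_zero)

lemma principal_diff:
  "D \<in> principal_divisors \<Sigma> \<Longrightarrow> E \<in> principal_divisors \<Sigma> \<Longrightarrow> D - E \<in> principal_divisors \<Sigma>"
  using principal_add[OF _ principal_uminus, of D \<Sigma> E] by simp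

lemma div_class_eq: "div_class \<Sigma> D = (\<lambda>P. P + D) ` principal_divisors \<Sigma>"
  by (auto simp: div_class_def r_coset_def WDiv_def)

lemma div_class_eq_iff: "div_class \<Sigma> D = div_class \<Sigma> E \<longleftrightarrow> D - E \<in> principal_divisors \<Sigma>"
proof
  assume "div_class \<Sigma> D = div_class \<Sigma> E"
  moreover have "0 + D \<in> div_class \<Sigma> D" unfolding div_class_eq using principal_zero by blast
  ultimately obtain P where "P \<in> principal_divisors \<Sigma>" "D = P + E" by (auto simp: div_class_eq)
  then show "D - E \<in> principal_divisors \<Sigma>" by simp
next
  assume *: "D - E \<in> principal_divisors \<Sigma>"
  have "P + D \<in> (\<lambda>P. P + E) ` principal_divisors \<Sigma>" if "P \<in> principal_divisors \<Sigma>" for P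
    by (rule image_eqI[of _ _ "P + (D - E)"]) (use principal_add[OF that *] in auto)
  moreover have "P + E \<in> (\<lambda>P. P + D) ` principal_divisors \<Sigma>" if "P \<in> principal_divisors \<Sigma>" for P
    by (rule image_eqI[of _ _ "P - (D - E)"]) (use principal_diff[OF that *] in auto)
  ultimately show "div_class \<Sigma> D = div_class \<Sigma> E" unfolding div_class_eq by blast
qed

lemma WDiv_comm_group: "comm_group (WDiv \<Sigma>)"
  unfolding WDiv_def by (rule abelian_free_Abelian_group)

lemma principal_subgroup: "subgroup (principal_divisors \<Sigma>) (WDiv \<Sigma>)"
proof -
  interpret comm_group "WDiv \<Sigma>" by (rule WDiv_comm_group)
  show ?thesis
    by (rule subgroupI)
       (use principal_zero[of \<Sigma>] principal_add[of _ \<Sigma>] principal_uminus[of _ \<Sigma>]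
        in \<open>auto simp: WDiv_def principal_iff[THEN iffD1]\<close>)
qed

lemma Cl_comm_group: "comm_group (Cl \<Sigma>)"
  unfolding Cl_def by (rule comm_group.abelian_FactGroup[OF WDiv_comm_group principal_subgroup])

lemma div_class_hom: "div_class \<Sigma> \<in> hom (WDiv \<Sigma>) (Cl \<Sigma>)"
proof -
  have "principal_divisors \<Sigma> \<lhd> WDiv \<Sigma>"
    by (rule comm_group.subgroup_imp_normal[OF WDiv_comm_group principal_subgroup])
  from normal.r_coset_hom_Mod[OF this] show ?thesis
    unfolding Cl_def div_class_def .
qed

lemma div_class_group_hom: "group_hom (WDiv \<Sigma>) (Cl \<Sigma>) (div_class \<Sigma>)"
  using WDiv_comm_group[of \<Sigma>] Cl_comm_group[of \<Sigma>] div_class_hom[of \<Sigma>]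
  by (simp add: group_hom_def group_hom_axioms_def comm_group_def)

lemma div_class_carrier: "Poly_Mapping.keys D \<subseteq> rays \<Sigma> \<Longrightarrow> div_class \<Sigma> D \<in> carrier (Cl \<Sigma>)"
  using hom_in_carrier[OF div_class_hom, of D \<Sigma>] by (simp add: WDiv_def)

lemma div_class_mult:
  "Poly_Mapping.keys D \<subseteq> rays \<Sigma> \<Longrightarrow> Poly_Mapping.keys E \<subseteq> rays \<Sigma> \<Longrightarrow>
   div_class \<Sigma> D \<otimes>\<^bsub>Cl \<Sigma>\<^esub> div_class \<Sigma> E = div_class \<Sigma> (D + E)"
  using hom_mult[OF div_class_hom, of D \<Sigma> E] by (simp add: WDiv_def)

lemma div_class_zero: "div_class \<Sigma> 0 = \<one>\<^bsub>Cl \<Sigma>\<^esub>"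
  using group_hom.hom_one[OF div_class_group_hom, of \<Sigma>] by (simp add: WDiv_def)

lemma div_class_int_pow:
  "Poly_Mapping.keys D \<subseteq> rays \<Sigma> \<Longrightarrow> div_class \<Sigma> D [^]\<^bsub>Cl \<Sigma>\<^esub> (z::int) = div_class \<Sigma> (frag_cmul z D)"
  using group_hom.hom_int_pow[OF div_class_group_hom, of D \<Sigma> z] by (simp add: WDiv_def)

lemma block_class_eq:
  assumes "finite p" "p \<subseteq> rays \<Sigma>"
  shows "block_class \<Sigma> p = div_class \<Sigma> (\<Sum>u\<in>p. frag_of u)"
  using assms
proof (induction p rule: finite_induct)
  case empty
  then show ?case by (simp add: block_class_def div_class_zero comm_monoid.finprod_empty[OF comm_group.axioms(1)[OF Cl_comm_group]])
next
  case (insert u p)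
  interpret comm_group "Cl \<Sigma>" by (rule Cl_comm_group)
  have sub: "Poly_Mapping.keys (\<Sum>u\<in>p. frag_of u) \<subseteq> rays \<Sigma>"
    using sum_closed_free_Abelian_group[of p frag_of "rays \<Sigma>"] insert.prems by auto
  have "block_class \<Sigma> (insert u p) = div_class \<Sigma> (frag_of u) \<otimes>\<^bsub>Cl \<Sigma>\<^esub> block_class \<Sigma> p"
    unfolding block_class_def using insert by (intro finprod_insert) (auto intro!: div_class_carrier)
  then show ?case using insert sub by (simp add: div_class_mult)
qed

lemma Pic_subgroup: "subgroup (div_class \<Sigma> ` {D. Cartier \<Sigma> D}) (Cl \<Sigma>)"
proof -
  interpret comm_group "Cl \<Sigma>" by (rule Cl_comm_group)
  show ?thesis
  proof (rule subgroupI)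
    show "div_class \<Sigma> ` {D. Cartier \<Sigma> D} \<subseteq> carrier (Cl \<Sigma>)"
      by (auto intro: div_class_carrier simp: Cartier_iff)
    show "div_class \<Sigma> ` {D. Cartier \<Sigma> D} \<noteq> {}"
      using principal_imp_Cartier[OF principal_zero] by blast
  next
    fix A assume "A \<in> div_class \<Sigma> ` {D. Cartier \<Sigma> D}"
    then obtain D where D: "Cartier \<Sigma> D" "A = div_class \<Sigma> D" by blast
    then have "inv\<^bsub>Cl \<Sigma>\<^esub> A = div_class \<Sigma> (frag_cmul (-1) D)"
      using div_class_int_pow[of D \<Sigma> "-1"] div_class_carrier[of D \<Sigma>]
      by (simp add: Cartier_iff int_pow_neg del: frag_cmul_minus_one)
    then show "inv\<^bsub>Cl \<Sigma>\<^esub> A \<in> div_class \<Sigma> ` {D. Cartier \<Sigma> D}" using Cartier_cmul[OF D(1)] by blast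
  next
    fix A B assume "A \<in> div_class \<Sigma> ` {D. Cartier \<Sigma> D}" "B \<in> div_class \<Sigma> ` {D. Cartier \<Sigma> D}"
    then obtain D E where "Cartier \<Sigma> D" "A = div_class \<Sigma> D" "Cartier \<Sigma> E" "B = div_class \<Sigma> E" by blast
    then show "A \<otimes>\<^bsub>Cl \<Sigma>\<^esub> B \<in> div_class \<Sigma> ` {D. Cartier \<Sigma> D}"
      using div_class_mult[of D \<Sigma> E] Cartier_add[of \<Sigma> D E]
      by (auto simp: Cartier_iff[THEN iffD1] intro!: imageI)
  qed
qed

lemma Pic_comm_group: "comm_group (Pic \<Sigma>)"
proof -
  interpret comm_group "Cl \<Sigma>" by (rule Cl_comm_group)
  have "group (Pic \<Sigma>)" unfolding Pic_def by (rule subgroup_imp_group[OF Pic_subgroup])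
  moreover have "x \<otimes>\<^bsub>Pic \<Sigma>\<^esub> y = y \<otimes>\<^bsub>Pic \<Sigma>\<^esub> x" if "x \<in> carrier (Pic \<Sigma>)" "y \<in> carrier (Pic \<Sigma>)" for x y
    using that subgroup.subset[OF Pic_subgroup, of \<Sigma>] by (auto simp: Pic_def intro!: m_comm)
  ultimately show ?thesis by (rule group.group_comm_groupI)
qed

lemma Pic_int_pow:
  assumes "Cartier \<Sigma> D"
  shows "div_class \<Sigma> D [^]\<^bsub>Pic \<Sigma>\<^esub> (z::int) = div_class \<Sigma> (frag_cmul z D)"
proof -
  interpret comm_group "Cl \<Sigma>" by (rule Cl_comm_group)
  have "div_class \<Sigma> D [^]\<^bsub>Pic \<Sigma>\<^esub> z = div_class \<Sigma> D [^]\<^bsub>Cl \<Sigma>\<^esub> z"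
    unfolding Pic_def by (rule int_pow_consistent[OF Pic_subgroup, symmetric]) (use assms in blast)
  also have "\<dots> = div_class \<Sigma> (frag_cmul z D)"
    by (rule div_class_int_pow) (use assms in \<open>simp add: Cartier_iff\<close>)
  finally show ?thesis .
qed

lemma Pic_finprod:
  assumes "finite I" "\<And>i. i \<in> I \<Longrightarrow> Cartier \<Sigma> (D i)"
  shows "Cartier \<Sigma> (\<Sum>i\<in>I. D i) \<and> finprod (Pic \<Sigma>) (\<lambda>i. div_class \<Sigma> (D i)) I = div_class \<Sigma> (\<Sum>i\<in>I. D i)"
  using assms
proof (induction I rule: finite_induct)
  case empty
  interpret comm_group "Pic \<Sigma>" by (rule Pic_comm_group)
  show ?case using principal_imp_Cartier[OF principal_zero] by (simp add: div_class_zero) (simp add: Pic_def)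
next
  case (insert i I)
  interpret comm_group "Pic \<Sigma>" by (rule Pic_comm_group)
  have "finprod (Pic \<Sigma>) (\<lambda>i. div_class \<Sigma> (D i)) (insert i I)
      = div_class \<Sigma> (D i) \<otimes>\<^bsub>Pic \<Sigma>\<^esub> finprod (Pic \<Sigma>) (\<lambda>i. div_class \<Sigma> (D i)) I"
    using insert by (intro finprod_insert) (auto simp: Pic_def)
  also have "\<dots> = div_class \<Sigma> (D i) \<otimes>\<^bsub>Cl \<Sigma>\<^esub> div_class \<Sigma> (\<Sum>i\<in>I. D i)"
    using insert by (simp add: Pic_def)
  also have "\<dots> = div_class \<Sigma> (D i + (\<Sum>i\<in>I. D i))"
    using insert by (intro div_class_mult) (auto simp: Cartier_iff)
  finally show ?case using insert by (auto intro: Cartier_add)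
qed

text \<open>Turns independence of classes in the Picard group into a statement on principal divisors, by
  choosing representatives \<open>D A\<close> of the classes \<open>A\<close>.\<close>

lemma int_independent_Pic_iff:
  assumes "finite S" "\<And>A. A \<in> S \<Longrightarrow> Cartier \<Sigma> (D A) \<and> A = div_class \<Sigma> (D A)"
  shows "int_independent (Pic \<Sigma>) S \<longleftrightarrow>
    (\<forall>c. (\<Sum>A\<in>S. frag_cmul (c A) (D A)) \<in> principal_divisors \<Sigma> \<longrightarrow> (\<forall>A\<in>S. c A = 0))"
proof -
  interpret comm_group "Pic \<Sigma>" by (rule Pic_comm_group)
  have "finprod (Pic \<Sigma>) (\<lambda>A. A [^]\<^bsub>Pic \<Sigma>\<^esub> c A) S = div_class \<Sigma> (\<Sum>A\<in>S. frag_cmul (c A) (D A))" for c :: "_ \<Rightarrow> int"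
  proof -
    have "finprod (Pic \<Sigma>) (\<lambda>A. A [^]\<^bsub>Pic \<Sigma>\<^esub> c A) S = finprod (Pic \<Sigma>) (\<lambda>A. div_class \<Sigma> (frag_cmul (c A) (D A))) S"
    proof (rule finprod_cong')
      show "(\<lambda>A. div_class \<Sigma> (frag_cmul (c A) (D A))) \<in> S \<rightarrow> carrier (Pic \<Sigma>)"
        using assms(2) by (auto simp: Pic_def intro!: imageI Cartier_cmul)
      show "A [^]\<^bsub>Pic \<Sigma>\<^esub> c A = div_class \<Sigma> (frag_cmul (c A) (D A))" if "A \<in> S" for A
        using assms(2)[OF that] Pic_int_pow[of \<Sigma> "D A" "c A"] by simp
    qed simp
    also have "\<dots> = div_class \<Sigma> (\<Sum>A\<in>S. frag_cmul (c A) (D A))"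
      using Pic_finprod[OF assms(1), of \<Sigma> "\<lambda>A. frag_cmul (c A) (D A)"] assms(2) Cartier_cmul by blast
    finally show ?thesis .
  qed
  moreover have "\<one>\<^bsub>Pic \<Sigma>\<^esub> = div_class \<Sigma> 0" by (simp add: Pic_def div_class_zero)
  moreover have "S \<subseteq> carrier (Pic \<Sigma>)" using assms(2) by (auto simp: Pic_def)
  ultimately show ?thesis using assms(1) by (simp add: int_independent_def div_class_eq_iff)
qed

text \<open>The form in which Picard number one is used: any two Cartier divisors are related. If their
  classes coincide, the relation is \<open>D - E\<close>.\<close>

lemma Picard_number_le_1_iff:
  "abelian_rank (Pic \<Sigma>) \<le> 1 \<longleftrightarrow> (\<forall>D E. Cartier \<Sigma> D \<longrightarrow> Cartier \<Sigma> E \<longrightarrow>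
     (\<exists>a b. (a \<noteq> 0 \<or> b \<noteq> 0) \<and> frag_cmul a D + frag_cmul b E \<in> principal_divisors \<Sigma>))"
proof (intro iffI allI impI)
  fix D E assume le: "abelian_rank (Pic \<Sigma>) \<le> 1" and DE: "Cartier \<Sigma> D" "Cartier \<Sigma> E"
  show "\<exists>a b. (a \<noteq> 0 \<or> b \<noteq> 0) \<and> frag_cmul a D + frag_cmul b E \<in> principal_divisors \<Sigma>"
  proof (cases "div_class \<Sigma> D = div_class \<Sigma> E")
    case True
    then show ?thesis
      by (intro exI[of _ 1] exI[of _ "-1"]) (simp add: div_class_eq_iff)
  next
    case False
    let ?S = "{div_class \<Sigma> D, div_class \<Sigma> E}"
    let ?D = "\<lambda>A. if A = div_class \<Sigma> D then D else E"
    have "\<not> int_independent (Pic \<Sigma>) ?S"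
    proof
      assume "int_independent (Pic \<Sigma>) ?S"
      then have "enat (card ?S) \<le> abelian_rank (Pic \<Sigma>)" unfolding abelian_rank_def by (intro SUP_upper) simp
      also note le
      finally have "enat 2 \<le> 1" using False by (simp add: numeral_2_eq_2)
      then show False by (simp add: one_enat_def)
    qed
    then obtain c where c: "(\<Sum>A\<in>?S. frag_cmul (c A) (?D A)) \<in> principal_divisors \<Sigma>" "\<not> (\<forall>A\<in>?S. c A = 0)"
    proof -
      have "Cartier \<Sigma> (?D A) \<and> A = div_class \<Sigma> (?D A)" if "A \<in> ?S" for A
        using that DE by auto
      from int_independent_Pic_iff[of ?S \<Sigma> ?D, OF _ this] show ?thesis
        using \<open>\<not> int_independent (Pic \<Sigma>) ?S\<close> that by blast
    qed
    then show ?thesis using False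
      by (intro exI[of _ "c (div_class \<Sigma> D)"] exI[of _ "c (div_class \<Sigma> E)"]) auto
  qed
next
  assume dep: "\<forall>D E. Cartier \<Sigma> D \<longrightarrow> Cartier \<Sigma> E \<longrightarrow>
     (\<exists>a b. (a \<noteq> 0 \<or> b \<noteq> 0) \<and> frag_cmul a D + frag_cmul b E \<in> principal_divisors \<Sigma>)"
  have "card S \<le> 1" if S: "int_independent (Pic \<Sigma>) S" for S
  proof (rule ccontr)
    assume "\<not> card S \<le> 1"
    then obtain A B where AB: "A \<in> S" "B \<in> S" "A \<noteq> B"
      by (metis One_nat_def card_le_Suc0_iff_eq S int_independent_def)
    have fin: "finite S" and "\<forall>A\<in>S. \<exists>D. Cartier \<Sigma> D \<and> A = div_class \<Sigma> D"
      using S by (auto simp: int_independent_def Pic_def)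
    then obtain D where D: "\<And>A. A \<in> S \<Longrightarrow> Cartier \<Sigma> (D A) \<and> A = div_class \<Sigma> (D A)" by metis
    obtain a b where ab: "a \<noteq> 0 \<or> b \<noteq> 0" "frag_cmul a (D A) + frag_cmul b (D B) \<in> principal_divisors \<Sigma>"
      using dep D AB by metis
    define c where "c C = (if C = A then a else if C = B then b else 0)" for C
    have "(\<Sum>C\<in>S. frag_cmul (c C) (D C)) = (\<Sum>C\<in>{A,B}. frag_cmul (c C) (D C))"
      by (rule sum.mono_neutral_right) (use AB fin in \<open>auto simp: c_def\<close>)
    also have "\<dots> = frag_cmul a (D A) + frag_cmul b (D B)" using AB by (simp add: c_def)
    finally have "\<forall>C\<in>S. c C = 0" using S ab(2) int_independent_Pic_iff[OF fin D] by auto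
    then have "c A = 0" "c B = 0" using AB by auto
    then show False using ab(1) AB by (auto simp: c_def)
  qed
  then show "abelian_rank (Pic \<Sigma>) \<le> 1"
    unfolding abelian_rank_def by (intro SUP_least) (auto simp: one_enat_def)
qed

lemma Picard_number_ge_1:
  assumes D: "Cartier \<Sigma> D" and ntor: "\<And>a. frag_cmul a D \<in> principal_divisors \<Sigma> \<Longrightarrow> a = 0"
  shows "1 \<le> abelian_rank (Pic \<Sigma>)"
proof -
  have "int_independent (Pic \<Sigma>) {div_class \<Sigma> D}"
    using int_independent_Pic_iff[of "{div_class \<Sigma> D}" \<Sigma> "\<lambda>_. D"] D ntor by auto
  then have "enat (card {div_class \<Sigma> D}) \<le> abelian_rank (Pic \<Sigma>)"
    unfolding abelian_rank_def by (intro SUP_upper) simp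
  then show ?thesis by (simp add: one_enat_def)
qed

section \<open>Rational cones and their rays\<close>

text \<open>Stated for a family instead of a set, so that coefficients are indexed by the labels of the
  generators.\<close>

lemma convex_cone_hull_image:
  fixes u :: "'i \<Rightarrow> 'a::real_vector"
  assumes "finite I"
  shows "convex_cone hull (u ` I) = {\<Sum>i\<in>I. c i *\<^sub>R u i | c. \<forall>i\<in>I. 0 \<le> c i}" (is "_ = ?R")
proof (rule subset_antisym)
  show "convex_cone hull (u ` I) \<subseteq> ?R"
  proof (rule hull_minimal)
    show "u ` I \<subseteq> ?R"
    proof clarify
      fix i assume "i \<in> I"
      then have "u i = (\<Sum>j\<in>I. (if j = i then 1 else 0) *\<^sub>R u j)"
        using assms by (simp add: if_distrib[of "\<lambda>x. x *\<^sub>R _"] cong: if_cong)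
      then show "\<exists>c. u i = (\<Sum>i\<in>I. c i *\<^sub>R u i) \<and> (\<forall>i\<in>I. 0 \<le> c i)"
        by (intro exI[of _ "\<lambda>j. if j = i then 1 else 0"]) auto
    qed
    show "convex_cone ?R"
      unfolding convex_cone_iff
    proof (intro conjI ballI allI impI)
      show "0 \<in> ?R" by (auto intro!: exI[of _ "\<lambda>_. 0"])
    next
      fix x y assume "x \<in> ?R" "y \<in> ?R"
      then obtain c c' where "x = (\<Sum>i\<in>I. c i *\<^sub>R u i)" "\<forall>i\<in>I. 0 \<le> c i"
        "y = (\<Sum>i\<in>I. c' i *\<^sub>R u i)" "\<forall>i\<in>I. 0 \<le> c' i" by blast
      then show "x + y \<in> ?R"
        by (auto intro!: exI[of _ "\<lambda>i. c i + c' i"] simp: sum.distrib scaleR_add_left)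
    next
      fix x and t :: real assume "x \<in> ?R" "0 \<le> t"
      then obtain c where "x = (\<Sum>i\<in>I. c i *\<^sub>R u i)" "\<forall>i\<in>I. 0 \<le> c i" by blast
      then show "t *\<^sub>R x \<in> ?R" using \<open>0 \<le> t\<close>
        by (auto intro!: exI[of _ "\<lambda>i. t * c i"] simp: scaleR_sum_right)
    qed
  qed
  have "(\<Sum>i\<in>J. c i *\<^sub>R u i) \<in> convex_cone hull (u ` I)" if "finite J" "J \<subseteq> I" "\<forall>i\<in>I. 0 \<le> c i" for J c
    using that by (induction J rule: finite_induct)
      (auto intro!: convex_cone_hull_add convex_cone_hull_contains_0 convex_cone_hull_mul[OF hull_inc])
  then show "?R \<subseteq> convex_cone hull (u ` I)" using assms by blast
qed

lemma convex_cone_hull_singleton: "convex_cone hull {u} = {t *\<^sub>R u | t. 0 \<le> t}"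
  using convex_cone_hull_image[of "{0::nat}" "\<lambda>_. u"] by auto

text \<open>Writing the factor as a reduced fraction \<open>p / q\<close>, the denominator divides all coordinates of \<open>v\<close> and
  the numerator all coordinates of \<open>u\<close>, so both are \<open>1\<close>.\<close>

lemma primitive_eq:
  assumes u: "primitive u" and v: "primitive v" and uv: "u = k *\<^sub>R v" and k: "0 < k"
  shows "u = v"
proof -
  obtain i where i: "vec_nth v i \<noteq> 0" using v by (auto simp: primitive_def Finite_Cartesian_Product.vec_eq_iff)
  have "vec_nth u j \<in> \<int>" "vec_nth v j \<in> \<int>" for j using u v by (auto simp: primitive_def int_lattice_def)
  then have "vec_nth u j = of_int \<lfloor>vec_nth u j\<rfloor>" "vec_nth v j = of_int \<lfloor>vec_nth v j\<rfloor>" for j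
    by (metis Ints_cases floor_of_int)+
  then obtain a b where ab: "\<And>j. vec_nth u j = of_int (a j)" "\<And>j. vec_nth v j = of_int (b j)"
    by (rule that)
  have "k = of_int (a i) / of_int (b i)" using uv i ab by (auto simp: field_simps)
  then have "k \<in> \<rat>" by simp
  then obtain p q :: nat where pq: "q \<noteq> 0" "\<bar>k\<bar> = real p / real q" "coprime p q"
    by (rule Rats_abs_nat_div_natE)
  have qb: "int q dvd b j" for j
  proof -
    have "real q * of_int (a j) = real p * of_int (b j)"
      using uv ab pq k by (simp add: Finite_Cartesian_Product.vec_eq_iff field_simps)
    then have "int q * a j = int p * b j" by (metis of_int_eq_iff of_int_mult of_int_of_nat_eq)
    then have "int q dvd int p * b j" by (metis dvd_triv_left)
    then show ?thesis using pq(3) by (simp add: coprime_commute coprime_dvd_mult_right_iff)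
  qed
  define w where "w = (\<chi> j. real_of_int (b j div int q))"
  have "v = real q *\<^sub>R w"
    unfolding Finite_Cartesian_Product.vec_eq_iff
  proof
    fix j
    have "b j = int q * (b j div int q)" using qb[of j] by simp
    then have "real_of_int (b j) = real q * of_int (b j div int q)"
      by (metis of_int_mult of_int_of_nat_eq)
    then show "vec_nth v j = vec_nth (real q *\<^sub>R w) j" by (simp add: ab w_def)
  qed
  moreover have "w \<in> int_lattice" by (simp add: w_def int_lattice_def)
  ultimately have "q = 1" using v by (auto simp: primitive_def)
  then have "u = real p *\<^sub>R v" using uv pq k by simp
  moreover have "v \<in> int_lattice" using v by (simp add: primitive_def)
  ultimately have "p = 1" using u by (auto simp: primitive_def)
  then show ?thesis using \<open>u = real p *\<^sub>R v\<close> by simp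
qed

text \<open>The largest factor that can be taken out of \<open>x\<close> leaves a primitive vector.\<close>

lemma int_lattice_primitive_multiple:
  assumes x: "x \<in> int_lattice" "x \<noteq> 0"
  shows "\<exists>u k. primitive u \<and> 0 < k \<and> x = real k *\<^sub>R u"
proof -
  define A where "A = {k::nat. \<exists>v\<in>int_lattice. x = real k *\<^sub>R v}"
  obtain i where i: "vec_nth x i \<noteq> 0" using x by (auto simp: Finite_Cartesian_Product.vec_eq_iff)
  obtain a where a: "vec_nth x i = of_int a" using x by (auto simp: int_lattice_def Ints_def)
  have "k \<le> nat \<bar>a\<bar>" if k: "k \<in> A" for k
  proof -
    obtain v where v: "v \<in> int_lattice" "x = real k *\<^sub>R v" using k by (auto simp: A_def)
    obtain b where b: "vec_nth v i = of_int b" using v by (auto simp: int_lattice_def Ints_def)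
    have "real_of_int a = of_int (int k * b)" using a b v by simp
    then have "a = int k * b" by (simp only: of_int_eq_iff)
    moreover have "a \<noteq> 0" using i a by simp
    ultimately show ?thesis using dvd_imp_le_int[of a "int k"] by simp
  qed
  then have fin: "finite A" using finite_nat_set_iff_bounded_le by blast
  have "1 \<in> A" using x by (auto simp: A_def)
  then have "Max A \<in> A" using fin by (intro Max_in) auto
  then obtain v where v: "v \<in> int_lattice" "x = real (Max A) *\<^sub>R v" by (auto simp: A_def)
  have pos: "0 < Max A" using v x by (cases "Max A = 0") auto
  have "primitive v"
    unfolding primitive_def
  proof (intro conjI ballI allI impI)
    show "v \<noteq> 0" using v x by auto
  next
    fix w k assume w: "w \<in> int_lattice" "v = real k *\<^sub>R w"
    then have "Max A * k \<in> A" using v by (auto simp: A_def intro!: bexI[of _ w])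
    then have "Max A * k \<le> Max A" using fin by simp
    moreover have "k \<noteq> 0" using w v x by auto
    ultimately show "k = 1" using pos by simp
  qed (fact v)
  then show ?thesis using v pos by blast
qed

text \<open>The extreme rays of a pointed cone are found in any finite generating set by discarding redundant
  elements. If \<open>S0\<close> is minimal and a convex combination of elements of the cone lies on the ray of
  \<open>s\<close>, compare coefficients: by irredundancy of \<open>s\<close> its coefficient in the combination is at least
  the one on the ray, and then the other terms sum to an element whose negative is in the cone as
  well, so each of them vanishes.\<close>

lemma pointed_cone_generated_by_rays:
  fixes \<sigma> :: "'a::real_vector set"
  assumes S: "finite S" "\<sigma> = convex_cone hull S" and pointed: "\<sigma> \<inter> uminus ` \<sigma> = {0}"
  shows "\<exists>S0\<subseteq>S. \<sigma> = convex_cone hull S0 \<and> (\<forall>s\<in>S0. s \<noteq> 0 \<and> (convex_cone hull {s}) face_of \<sigma>)"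
proof -
  define \<G> where "\<G> = {S'. S' \<subseteq> S \<and> convex_cone hull S' = \<sigma>}"
  have "finite \<G>" by (rule finite_subset[of _ "Pow S"]) (use S in \<open>auto simp: \<G>_def\<close>)
  moreover have "S \<in> \<G>" using S by (simp add: \<G>_def)
  ultimately obtain S0 where S0: "S0 \<in> \<G>" and min: "\<And>S'. S' \<in> \<G> \<Longrightarrow> S' \<subseteq> S0 \<Longrightarrow> S' = S0"
    using finite_has_minimal2[of \<G> S] by metis
  have S0S: "S0 \<subseteq> S" and hull: "convex_cone hull S0 = \<sigma>" using S0 by (auto simp: \<G>_def)
  have fin: "finite S0" using S0S S finite_subset by blast
  have rep: "convex_cone hull T = {\<Sum>t\<in>T. c t *\<^sub>R t | c. \<forall>t\<in>T. 0 \<le> c t}" if "T \<subseteq> S0" for T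
    using convex_cone_hull_image[of T "\<lambda>t. t"] finite_subset[OF that fin] by simp
  have irredundant: "s \<notin> convex_cone hull (S0 - {s})" if s: "s \<in> S0" for s
  proof
    assume *: "s \<in> convex_cone hull (S0 - {s})"
    have "S0 \<subseteq> convex_cone hull (S0 - {s})"
      using * hull_subset[of "S0 - {s}" convex_cone] by blast
    then have "convex_cone hull S0 \<subseteq> convex_cone hull (S0 - {s})"
      by (rule hull_minimal) (rule convex_cone_convex_cone_hull)
    moreover have "convex_cone hull (S0 - {s}) \<subseteq> convex_cone hull S0" by (rule hull_mono) auto
    ultimately have "S0 - {s} \<in> \<G>" using S0S hull by (auto simp: \<G>_def)
    then show False using min s by blast
  qed
  have face: "(convex_cone hull {s}) face_of \<sigma>" if s: "s \<in> S0" for s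
    unfolding face_of_def
  proof (intro conjI ballI impI)
    show "convex_cone hull {s} \<subseteq> \<sigma>" unfolding hull[symmetric] by (rule hull_mono) (use s in auto)
    show "convex (convex_cone hull {s})" by (rule convex_convex_cone_hull)
    fix a b x assume ab: "a \<in> \<sigma>" "b \<in> \<sigma>" and x: "x \<in> convex_cone hull {s}" "x \<in> open_segment a b"
    obtain \<alpha> where \<alpha>: "a = (\<Sum>t\<in>S0. \<alpha> t *\<^sub>R t)" "\<forall>t\<in>S0. 0 \<le> \<alpha> t"
      using ab(1) rep[of S0] hull by auto
    obtain \<beta> where \<beta>: "b = (\<Sum>t\<in>S0. \<beta> t *\<^sub>R t)" "\<forall>t\<in>S0. 0 \<le> \<beta> t"
      using ab(2) rep[of S0] hull by auto
    obtain l where l: "0 < l" "l < 1" "x = (1 - l) *\<^sub>R a + l *\<^sub>R b" using x(2) by (auto simp: in_segment)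
    obtain c where c: "0 \<le> c" "x = c *\<^sub>R s" using x(1) by (auto simp: convex_cone_hull_singleton)
    define \<gamma> where "\<gamma> t = (1 - l) * \<alpha> t + l * \<beta> t" for t
    have \<gamma>0: "0 \<le> \<gamma> t" if "t \<in> S0" for t using that \<alpha> \<beta> l by (simp add: \<gamma>_def)
    have "x = (\<Sum>t\<in>S0. \<gamma> t *\<^sub>R t)"
      by (simp add: l \<alpha> \<beta> \<gamma>_def scaleR_sum_right scaleR_add_left sum.distrib)
    also have "\<dots> = \<gamma> s *\<^sub>R s + (\<Sum>t\<in>S0-{s}. \<gamma> t *\<^sub>R t)"
      using fin s by (rule sum.remove)
    finally have eq: "(c - \<gamma> s) *\<^sub>R s = (\<Sum>t\<in>S0-{s}. \<gamma> t *\<^sub>R t)" using c by (simp add: scaleR_diff_left)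
    have le: "c \<le> \<gamma> s"
    proof (rule ccontr)
      assume "\<not> c \<le> \<gamma> s"
      then have pos: "0 < c - \<gamma> s" by simp
      have "s = (1 / (c - \<gamma> s)) *\<^sub>R ((c - \<gamma> s) *\<^sub>R s)" using pos by simp
      also have "\<dots> = (\<Sum>t\<in>S0-{s}. (\<gamma> t / (c - \<gamma> s)) *\<^sub>R t)" unfolding eq by (simp add: scaleR_sum_right)
      also have "\<dots> \<in> convex_cone hull (S0 - {s})"
        using rep[of "S0 - {s}"] \<gamma>0 pos by auto
      finally show False using irredundant[OF s] by simp
    qed
    have zero: "\<gamma> t = 0" if t: "t \<in> S0 - {s}" for t
    proof (rule ccontr)
      assume "\<gamma> t \<noteq> 0"
      then have pos: "0 < \<gamma> t" using \<gamma>0 t by (metis DiffD1 order_le_less)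
      have "\<gamma> t *\<^sub>R t \<in> \<sigma>"
        using t pos hull by (intro convex_cone_hull_mul[of t S0, unfolded hull]) (auto intro: hull_inc)
      moreover have "- (\<gamma> t *\<^sub>R t) \<in> \<sigma>"
      proof -
        have "(\<Sum>t\<in>S0-{s}. \<gamma> t *\<^sub>R t) = \<gamma> t *\<^sub>R t + (\<Sum>t\<in>S0-{s}-{t}. \<gamma> t *\<^sub>R t)"
          by (rule sum.remove) (use fin t in auto)
        then have "- (\<gamma> t *\<^sub>R t) = (\<gamma> s - c) *\<^sub>R s + (\<Sum>t\<in>S0-{s}-{t}. \<gamma> t *\<^sub>R t)"
          using eq by (simp add: algebra_simps)
        moreover have "(\<Sum>t\<in>S0-{s}-{t}. \<gamma> t *\<^sub>R t) \<in> convex_cone hull (S0-{s}-{t})"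
          using rep[of "S0-{s}-{t}"] \<gamma>0 by auto
        then have "(\<Sum>t\<in>S0-{s}-{t}. \<gamma> t *\<^sub>R t) \<in> \<sigma>"
          using hull_mono[of "S0-{s}-{t}" S0 convex_cone] hull by auto
        moreover have "(\<gamma> s - c) *\<^sub>R s \<in> \<sigma>"
          using s le hull by (intro convex_cone_hull_mul[of s S0, unfolded hull]) (auto intro: hull_inc)
        ultimately show ?thesis using convex_cone_hull_add[of _ S0] hull by metis
      qed
      ultimately have "\<gamma> t *\<^sub>R t \<in> \<sigma> \<inter> uminus ` \<sigma>" by (metis IntI image_eqI minus_minus)
      then have "\<gamma> t *\<^sub>R t = 0" using pointed by blast
      then have "t = 0" using pos by simp
      then show False using irredundant[of t] t convex_cone_hull_contains_0 by auto
    qed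
    have *: "\<alpha> t = 0 \<and> \<beta> t = 0" if "t \<in> S0 - {s}" for t
    proof -
      have "0 \<le> (1 - l) * \<alpha> t" "0 \<le> l * \<beta> t" "(1 - l) * \<alpha> t + l * \<beta> t = 0"
        using zero[OF that] that \<alpha> \<beta> l by (auto simp: \<gamma>_def)
      then have "(1 - l) * \<alpha> t = 0" "l * \<beta> t = 0" by linarith+
      then show ?thesis using l by simp
    qed
    have "a = \<alpha> s *\<^sub>R s" "b = \<beta> s *\<^sub>R s"
      using * unfolding \<alpha>(1) \<beta>(1) sum.remove[OF fin s] by simp_all
    then show "a \<in> convex_cone hull {s}" "b \<in> convex_cone hull {s}"
      using \<alpha> \<beta> s by (auto simp: convex_cone_hull_singleton)
  qed
  moreover have "s \<noteq> 0" if "s \<in> S0" for s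
    using irredundant[OF that] convex_cone_hull_contains_0 by metis
  ultimately show ?thesis using S0S hull by blast
qed

lemma fan_cone_generated_by_rays:
  assumes fan: "fan \<Sigma>" and \<sigma>: "\<sigma> \<in> \<Sigma>"
  shows "\<sigma> = convex_cone hull (rays \<Sigma> \<inter> \<sigma>)"
proof -
  have "pointed_rational_cone \<sigma>" using assms by (simp add: fan_def)
  then obtain S where S: "finite S" "S \<subseteq> int_lattice" "\<sigma> = convex_cone hull S" "\<sigma> \<inter> uminus ` \<sigma> = {0}"
    by (auto simp: pointed_rational_cone_def)
  obtain S0 where S0: "S0 \<subseteq> S" "\<sigma> = convex_cone hull S0"
    "\<And>s. s \<in> S0 \<Longrightarrow> s \<noteq> 0 \<and> (convex_cone hull {s}) face_of \<sigma>"
    using pointed_cone_generated_by_rays[OF S(1,3,4)] by blast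
  have "s \<in> convex_cone hull (rays \<Sigma> \<inter> \<sigma>)" if s: "s \<in> S0" for s
  proof -
    obtain u k where u: "primitive u" "0 < k" "s = real k *\<^sub>R u"
      using int_lattice_primitive_multiple[of s] S S0 s by blast
    have "convex_cone hull {u} = convex_cone hull {s}"
    proof -
      have "t *\<^sub>R u = (t / real k) *\<^sub>R s" for t using u by simp
      moreover have "t *\<^sub>R s = (t * real k) *\<^sub>R u" for t using u by simp
      ultimately show ?thesis unfolding convex_cone_hull_singleton
        by (metis (no_types, opaque_lifting) divide_nonneg_nonneg mult_nonneg_nonneg of_nat_0_le_iff)
    qed
    moreover have "convex_cone hull {s} \<in> \<Sigma>"
      using fan \<sigma> S0(3)[OF s] convex_cone_hull_nonempty unfolding fan_def by metis
    ultimately have "u \<in> rays \<Sigma>" using u by (simp add: rays_def)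
    moreover have "u \<in> \<sigma>"
    proof -
      have "(1 / real k) *\<^sub>R s \<in> convex_cone hull S0" by (rule convex_cone_hull_mul[OF hull_inc[OF s]]) simp
      then show ?thesis using u S0(2) by simp
    qed
    ultimately show ?thesis using u(3) by (auto intro!: convex_cone_hull_mul[OF hull_inc])
  qed
  then have "convex_cone hull S0 \<subseteq> convex_cone hull (rays \<Sigma> \<inter> \<sigma>)"
    by (intro hull_minimal convex_cone_convex_cone_hull) auto
  moreover have "convex_cone hull (rays \<Sigma> \<inter> \<sigma>) \<subseteq> \<sigma>"
    by (rule hull_minimal) (auto simp: S0(2) convex_cone_convex_cone_hull)
  ultimately show ?thesis using S0(2) by blast
qed

lemma fan_finite_rays:
  assumes "fan \<Sigma>" shows "finite (rays \<Sigma>)"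
proof (rule inj_on_finite)
  show "inj_on (\<lambda>u. convex_cone hull {u}) (rays \<Sigma>)"
  proof (rule inj_onI)
    fix u v assume uv: "u \<in> rays \<Sigma>" "v \<in> rays \<Sigma>" "convex_cone hull {u} = convex_cone hull {v}"
    have "u \<in> convex_cone hull {v}" using uv(3) hull_inc[of u "{u}"] by auto
    then obtain t where t: "0 \<le> t" "u = t *\<^sub>R v" by (auto simp: convex_cone_hull_singleton)
    moreover have "t \<noteq> 0" using t uv by (auto simp: rays_def primitive_def)
    ultimately show "u = v" using uv primitive_eq[of u v t] by (auto simp: rays_def)
  qed
  show "(\<lambda>u. convex_cone hull {u}) ` rays \<Sigma> \<subseteq> \<Sigma>" by (auto simp: rays_def)
  show "finite \<Sigma>" using assms by (simp add: fan_def)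
qed

section \<open>Fans on the proper subsets of a circuit\<close>

text \<open>Vectors that span the space and have a single linear relation up to scaling, with positive
  coefficients \<open>a\<close>. For the rays of a fake weighted projective space these are, up to a common factor,
  the degrees of the divisor classes.\<close>

definition circuit :: "nat \<Rightarrow> (nat \<Rightarrow> real) \<Rightarrow> (nat \<Rightarrow> 'a::real_vector) \<Rightarrow> bool" where
  "circuit N a u \<longleftrightarrow> (\<forall>i<N. 0 < a i) \<and> (\<Sum>i<N. a i *\<^sub>R u i) = 0 \<and>
     (\<forall>c. (\<Sum>i<N. c i *\<^sub>R u i) = 0 \<longrightarrow> (\<exists>t. \<forall>i<N. c i = t * a i)) \<and>
     (\<forall>x. \<exists>c. x = (\<Sum>i<N. c i *\<^sub>R u i))"

definition proper_cones :: "nat \<Rightarrow> (nat \<Rightarrow> 'a::real_vector) \<Rightarrow> 'a set set" where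
  "proper_cones N u = {convex_cone hull (u ` I) | I. I \<subset> {..<N}}"

text \<open>A relation among the remaining vectors extends by zero to one of the whole family, whose constant value
  is then zero.\<close>

lemma constant_relations_independent:
  fixes u :: "nat \<Rightarrow> 'a::real_vector"
  assumes inj: "inj_on u {..<N}"
    and const: "\<And>c i. (\<Sum>i<N. c i *\<^sub>R u i) = 0 \<Longrightarrow> i < N \<Longrightarrow> c i = c 0"
  shows "independent (u ` {1..<N})"
proof (rule independent_if_scalars_zero)
  have inj': "inj_on u {1..<N}" by (rule inj_on_subset[OF inj]) auto
  fix f x assume f: "(\<Sum>x\<in>u ` {1..<N}. f x *\<^sub>R x) = 0" and "x \<in> u ` {1..<N}"
  then obtain i where i: "i \<in> {1..<N}" "x = u i" by blast
  define c where "c k = (if k = 0 then 0 else f (u k))" for k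
  have "(\<Sum>k<N. c k *\<^sub>R u k) = (\<Sum>k\<in>{1..<N}. f (u k) *\<^sub>R u k)"
    by (rule sum.mono_neutral_cong_right) (auto simp: c_def)
  also have "\<dots> = 0" using f unfolding sum.reindex[OF inj'] o_def .
  finally have "c i = c 0" using const i(1) by auto
  then show "f x = 0" using i by (simp add: c_def)
qed simp

lemma mem_cone_iff:
  fixes u :: "nat \<Rightarrow> 'a::real_vector"
  assumes I: "I \<subseteq> {..<N}"
  shows "x \<in> convex_cone hull (u ` I) \<longleftrightarrow>
    (\<exists>c. (\<forall>i. 0 \<le> c i) \<and> (\<forall>i. i \<notin> I \<longrightarrow> c i = 0) \<and> x = (\<Sum>i<N. c i *\<^sub>R u i))"
proof
  have fin: "finite I" using I finite_subset by blast
  assume "x \<in> convex_cone hull (u ` I)"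
  then obtain c where c: "x = (\<Sum>i\<in>I. c i *\<^sub>R u i)" "\<forall>i\<in>I. 0 \<le> c i"
    unfolding convex_cone_hull_image[OF fin] by blast
  have "(\<Sum>i<N. (if i \<in> I then c i else 0) *\<^sub>R u i) = (\<Sum>i\<in>I. c i *\<^sub>R u i)"
    by (rule sum.mono_neutral_cong_right) (use I in auto)
  then show "\<exists>c. (\<forall>i. 0 \<le> c i) \<and> (\<forall>i. i \<notin> I \<longrightarrow> c i = 0) \<and> x = (\<Sum>i<N. c i *\<^sub>R u i)"
    using c by (intro exI[of _ "\<lambda>i. if i \<in> I then c i else 0"]) auto
next
  have fin: "finite I" using I finite_subset by blast
  assume "\<exists>c. (\<forall>i. 0 \<le> c i) \<and> (\<forall>i. i \<notin> I \<longrightarrow> c i = 0) \<and> x = (\<Sum>i<N. c i *\<^sub>R u i)"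
  then obtain c where c: "\<forall>i. 0 \<le> c i" "\<forall>i. i \<notin> I \<longrightarrow> c i = 0" "x = (\<Sum>i<N. c i *\<^sub>R u i)" by blast
  have "(\<Sum>i<N. c i *\<^sub>R u i) = (\<Sum>i\<in>I. c i *\<^sub>R u i)"
    by (rule sum.mono_neutral_right) (use I c in auto)
  then show "x \<in> convex_cone hull (u ` I)"
    unfolding convex_cone_hull_image[OF fin] using c by blast
qed

context
  fixes N :: nat and a :: "nat \<Rightarrow> real" and u :: "nat \<Rightarrow> real ^ 'n"
  assumes circuit: "circuit N a u" and N: "N = CARD('n) + 1"
begin

lemma circuit_pos: "i < N \<Longrightarrow> 0 < a i"
  using circuit by (simp add: circuit_def)

lemma circuit_sum: "(\<Sum>i<N. a i *\<^sub>R u i) = 0"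
  using circuit by (simp add: circuit_def)

lemma circuit_relation:
  "(\<Sum>i<N. c i *\<^sub>R u i) = 0 \<Longrightarrow> \<exists>t. \<forall>i<N. c i = t * a i"
  using circuit by (simp add: circuit_def)

lemma circuit_span: "\<exists>c. x = (\<Sum>i<N. c i *\<^sub>R u i)"
  using circuit by (simp add: circuit_def)

text \<open>The source of all separation properties of the cones below: two nonnegative combinations that each
  omit some generator differ by a multiple of the positive relation, and the omitted generators
  force this multiple to be zero from both sides.\<close>

lemma circuit_unique:
  assumes eq: "(\<Sum>i<N. c i *\<^sub>R u i) = (\<Sum>i<N. c' i *\<^sub>R u i)"
    and c: "\<And>i. 0 \<le> c i" "j < N" "c j = 0" and c': "\<And>i. 0 \<le> c' i" "k < N" "c' k = 0"
    and i: "i < N"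
  shows "c i = c' i"
proof -
  have "(\<Sum>i<N. (c i - c' i) *\<^sub>R u i) = 0" using eq by (simp add: scaleR_diff_left sum_subtractf)
  then obtain t where t: "\<forall>i<N. c i - c' i = t * a i" using circuit_relation[of "\<lambda>i. c i - c' i"] by blast
  have "t * a j \<le> 0" using t c c' by (metis diff_le_0_iff_le)
  then have "t \<le> 0" using circuit_pos[OF c(2)] by (simp add: mult_le_0_iff)
  moreover have "0 \<le> t * a k" using t c(1)[of k] c'(2,3) by (metis diff_zero)
  then have "0 \<le> t" using circuit_pos[OF c'(2)] by (simp add: zero_le_mult_iff)
  ultimately have "t = 0" by simp
  then show ?thesis using t i by simp
qed

lemma psubset_missing: "I \<subset> {..<N} \<Longrightarrow> \<exists>j<N. j \<notin> I"
  by auto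

lemma mem_cone_generator_iff:
  assumes I: "I \<subset> {..<N}" and i: "i < N"
  shows "u i \<in> convex_cone hull (u ` I) \<longleftrightarrow> i \<in> I"
proof
  assume "u i \<in> convex_cone hull (u ` I)"
  then obtain c where c: "\<forall>i. 0 \<le> c i" "\<forall>i. i \<notin> I \<longrightarrow> c i = 0" "u i = (\<Sum>i<N. c i *\<^sub>R u i)"
    using mem_cone_iff[of I N] I by blast
  obtain j where j: "j < N" "j \<notin> I" using psubset_missing[OF I] by blast
  have "\<exists>k<N. k \<noteq> i"
    using N by (cases "i = 0") (auto intro: exI[of _ "1::nat"] exI[of _ "0::nat"])
  then obtain k where k: "k < N" "k \<noteq> i" by blast
  have "u i = (\<Sum>k<N. (if k = i then 1 else 0) *\<^sub>R u k)"
    using i by (simp add: if_distrib[of "\<lambda>x. x *\<^sub>R _"] cong: if_cong)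
  then have "(\<Sum>k<N. (if k = i then 1 else 0) *\<^sub>R u k) = (\<Sum>i<N. c i *\<^sub>R u i)" using c by simp
  from circuit_unique[OF this _ k(1) _ _ j(1) _ i] have "1 = c i" using c j k by auto
  then show "i \<in> I" using c(2) by force
qed (auto intro: hull_inc)

lemma cone_Int:
  assumes I: "I \<subset> {..<N}" and J: "J \<subset> {..<N}"
  shows "convex_cone hull (u ` I) \<inter> convex_cone hull (u ` J) = convex_cone hull (u ` (I \<inter> J))"
proof (rule subset_antisym)
  show "convex_cone hull (u ` I) \<inter> convex_cone hull (u ` J) \<subseteq> convex_cone hull (u ` (I \<inter> J))"
  proof
    fix x assume x: "x \<in> convex_cone hull (u ` I) \<inter> convex_cone hull (u ` J)"
    obtain c where c: "\<forall>i. 0 \<le> c i" "\<forall>i. i \<notin> I \<longrightarrow> c i = 0" "x = (\<Sum>i<N. c i *\<^sub>R u i)"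
      using mem_cone_iff[of I N] I x by blast
    obtain c' where c': "\<forall>i. 0 \<le> c' i" "\<forall>i. i \<notin> J \<longrightarrow> c' i = 0" "x = (\<Sum>i<N. c' i *\<^sub>R u i)"
      using mem_cone_iff[of J N] J x by blast
    obtain j where j: "j < N" "j \<notin> I" using psubset_missing[OF I] by blast
    obtain k where k: "k < N" "k \<notin> J" using psubset_missing[OF J] by blast
    have eq: "c i = c' i" if "i < N" for i
      using circuit_unique[of c c' j k i] c c' j k that by auto
    have "c i = 0" if "i \<notin> I \<inter> J" for i
      using that c(2) c'(2) eq[of i] I by (cases "i \<in> I") auto
    then show "x \<in> convex_cone hull (u ` (I \<inter> J))"
      using mem_cone_iff[of "I \<inter> J" N x u] I c by blast
  qed
qed (auto dest: hull_mono[THEN subsetD, rotated] intro: hull_mono[THEN subsetD, rotated])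

lemma cone_pointed:
  assumes I: "I \<subset> {..<N}"
  shows "convex_cone hull (u ` I) \<inter> uminus ` (convex_cone hull (u ` I)) = {0}"
proof -
  have "x = 0" if x: "x \<in> convex_cone hull (u ` I)" "- x \<in> convex_cone hull (u ` I)" for x
  proof -
    obtain c where c: "\<forall>i. 0 \<le> c i" "\<forall>i. i \<notin> I \<longrightarrow> c i = 0" "x = (\<Sum>i<N. c i *\<^sub>R u i)"
      using mem_cone_iff[of I N] I x by blast
    obtain c' where c': "\<forall>i. 0 \<le> c' i" "\<forall>i. i \<notin> I \<longrightarrow> c' i = 0" "- x = (\<Sum>i<N. c' i *\<^sub>R u i)"
      using mem_cone_iff[of I N] I x by blast
    obtain j where j: "j < N" "j \<notin> I" using psubset_missing[OF I] by blast
    have "(\<Sum>i<N. (c i + c' i) *\<^sub>R u i) = x + - x"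
      unfolding c'(3) by (subst c(3)) (simp add: scaleR_add_left sum.distrib)
    then have "(\<Sum>i<N. (c i + c' i) *\<^sub>R u i) = (\<Sum>i<N. 0 *\<^sub>R u i)" by simp
    from circuit_unique[OF this _ j(1) _ _ j(1)] have "c i + c' i = 0" if "i < N" for i
      using c c' j that by auto
    then have "c i = 0" if "i < N" for i using c c' that by (metis add_nonneg_eq_0_iff)
    then show "x = 0" using c by simp
  qed
  then show ?thesis using convex_cone_hull_contains_0 by force
qed

lemma cone_face:
  assumes I: "I \<subset> {..<N}" and J: "J \<subseteq> I"
  shows "(convex_cone hull (u ` J)) face_of (convex_cone hull (u ` I))"
  unfolding face_of_def
proof (intro conjI ballI impI)
  show "convex_cone hull (u ` J) \<subseteq> convex_cone hull (u ` I)" using J by (intro hull_mono) auto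
  show "convex (convex_cone hull (u ` J))" by (rule convex_convex_cone_hull)
  fix p q x assume p: "p \<in> convex_cone hull (u ` I)" and q: "q \<in> convex_cone hull (u ` I)"
    and x: "x \<in> convex_cone hull (u ` J)" "x \<in> open_segment p q"
  obtain l where l: "0 < l" "l < 1" "x = (1 - l) *\<^sub>R p + l *\<^sub>R q" using x(2) by (auto simp: in_segment)
  obtain c where c: "\<forall>i. 0 \<le> c i" "\<forall>i. i \<notin> I \<longrightarrow> c i = 0" "p = (\<Sum>i<N. c i *\<^sub>R u i)"
    using mem_cone_iff[of I N] I p by blast
  obtain c' where c': "\<forall>i. 0 \<le> c' i" "\<forall>i. i \<notin> I \<longrightarrow> c' i = 0" "q = (\<Sum>i<N. c' i *\<^sub>R u i)"
    using mem_cone_iff[of I N] I q by blast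
  have JN: "J \<subseteq> {..<N}" using I J by blast
  obtain e where e: "\<forall>i. 0 \<le> e i" "\<forall>i. i \<notin> J \<longrightarrow> e i = 0" "x = (\<Sum>i<N. e i *\<^sub>R u i)"
    using mem_cone_iff[OF JN] x(1) by blast
  obtain j where j: "j < N" "j \<notin> I" using psubset_missing[OF I] by blast
  have "(\<Sum>i<N. ((1 - l) * c i + l * c' i) *\<^sub>R u i) = (1 - l) *\<^sub>R p + l *\<^sub>R q"
    by (simp add: c c' scaleR_add_left sum.distrib scaleR_sum_right)
  then have "(\<Sum>i<N. ((1 - l) * c i + l * c' i) *\<^sub>R u i) = (\<Sum>i<N. e i *\<^sub>R u i)" using e l by simp
  from circuit_unique[OF this _ j(1) _ _ j(1)]
  have *: "(1 - l) * c i + l * c' i = e i" if "i < N" for i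
    using c c' e l j J that by auto
  have **: "c i = 0 \<and> c' i = 0" if "i \<notin> J" for i
  proof (cases "i < N")
    case True
    have "0 \<le> (1 - l) * c i" "0 \<le> l * c' i" using c c' l by simp_all
    moreover have "(1 - l) * c i + l * c' i = 0" using *[OF True] e that by simp
    ultimately have "(1 - l) * c i = 0" "l * c' i = 0" by linarith+
    then show ?thesis using l by simp
  next
    case False
    then show ?thesis using c(2) c'(2) I by auto
  qed
  show "p \<in> convex_cone hull (u ` J)" "q \<in> convex_cone hull (u ` J)"
    using mem_cone_iff[OF JN] ** c c' by blast+
qed

text \<open>A face is closed under nonnegative multiples, because it contains with \<open>x\<close>, the midpoint of
  \<open>0\<close> and \<open>2 x\<close>, both of these points. So it is a cone, and an element of it has all generators
  occurring in it on the face.\<close>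

lemma face_of_cone:
  assumes I: "I \<subset> {..<N}" and F: "F face_of (convex_cone hull (u ` I))" "F \<noteq> {}"
  shows "F = convex_cone hull (u ` {i\<in>I. u i \<in> F})"
proof -
  let ?\<sigma> = "convex_cone hull (u ` I)" and ?J = "{i\<in>I. u i \<in> F}"
  have sub: "F \<subseteq> ?\<sigma>" using F(1) by (rule face_of_imp_subset)
  have face: "p \<in> F \<and> q \<in> F" if "p \<in> ?\<sigma>" "q \<in> ?\<sigma>" "(1/2) *\<^sub>R p + (1/2) *\<^sub>R q \<in> F" for p q
  proof (cases "p = q")
    case True
    then show ?thesis using that by (simp flip: scaleR_add_left)
  next
    case False
    then have "(1/2) *\<^sub>R p + (1/2) *\<^sub>R q \<in> open_segment p q"
      by (auto simp: in_segment intro!: exI[of _ "1/2"])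
    then show ?thesis using F(1) that unfolding face_of_def by blast
  qed
  have scale: "t *\<^sub>R x \<in> F" if x: "x \<in> F" and t: "0 \<le> t" for x t
  proof -
    have double: "2 *\<^sub>R x \<in> F \<and> 0 \<in> F" if "x \<in> F" for x
    proof (rule face)
      show "2 *\<^sub>R x \<in> ?\<sigma>" using sub that by (intro convex_cone_hull_mul) auto
      show "0 \<in> ?\<sigma>" by (rule convex_cone_hull_contains_0)
    qed (use that in simp)
    have pow: "(2 ^ k) *\<^sub>R x \<in> F" for k
    proof (induction k)
      case (Suc k)
      then show ?case using double[of "2 ^ k *\<^sub>R x"] by simp
    qed (use x in simp)
    obtain k where k: "t < 2 ^ k" using real_arch_pow[of 2 t] by auto
    have "convex F" using F(1) by (rule face_of_imp_convex)
    then have "(1 - t / 2 ^ k) *\<^sub>R 0 + (t / 2 ^ k) *\<^sub>R (2 ^ k *\<^sub>R x) \<in> F"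
      using k t pow[of k] double[OF x] by (intro convexD_alt) auto
    then show ?thesis by simp
  qed
  have add: "x + y \<in> F" if "x \<in> F" "y \<in> F" for x y
  proof -
    have "convex F" using F(1) by (rule face_of_imp_convex)
    then have "(1/2) *\<^sub>R (2 *\<^sub>R x) + (1/2) *\<^sub>R (2 *\<^sub>R y) \<in> F"
      using scale that by (intro convexD) auto
    then show ?thesis by simp
  qed
  have zero: "0 \<in> F" using F(2) scale[of _ 0] by auto
  have "F \<subseteq> convex_cone hull (u ` ?J)"
  proof
    fix x assume x: "x \<in> F"
    obtain c where c: "\<forall>i. 0 \<le> c i" "\<forall>i. i \<notin> I \<longrightarrow> c i = 0" "x = (\<Sum>i<N. c i *\<^sub>R u i)"
      using mem_cone_iff[of I N] I x sub by blast
    have "c i = 0" if i: "i \<notin> ?J" for i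
    proof (rule ccontr)
      assume ci: "c i \<noteq> 0"
      then have iI: "i \<in> I" using c(2) by blast
      then have iN: "i < N" using I by auto
      have pos: "0 < c i" using c(1) ci by (metis order_le_less)
      define p where "p = c i *\<^sub>R u i"
      define q where "q = (\<Sum>k\<in>{..<N}-{i}. c k *\<^sub>R u k)"
      have xpq: "x = p + q" unfolding c(3) p_def q_def by (rule sum.remove) (use iN in auto)
      have "p \<in> ?\<sigma>" unfolding p_def using iI pos by (intro convex_cone_hull_mul hull_inc) auto
      moreover have "q = (\<Sum>k<N. (if k = i then 0 else c k) *\<^sub>R u k)"
        unfolding q_def by (rule sum.mono_neutral_cong_left) auto
      then have "q \<in> ?\<sigma>" using c I
        by (subst mem_cone_iff[of I N]) (auto intro!: exI[of _ "\<lambda>k. if k = i then 0 else c k"])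
      ultimately have "2 *\<^sub>R p \<in> F"
        using face[of "2 *\<^sub>R p" "2 *\<^sub>R q"] x xpq
          convex_cone_hull_mul[of p _ 2] convex_cone_hull_mul[of q _ 2] by simp
      then have "(1 / (2 * c i)) *\<^sub>R (2 *\<^sub>R p) \<in> F" by (rule scale) (use pos in simp_all)
      then have "u i \<in> F" using pos by (simp add: p_def)
      then show False using i iI by blast
    qed
    then show "x \<in> convex_cone hull (u ` ?J)"
      using mem_cone_iff[of ?J N x u] I c by blast
  qed
  moreover have "convex_cone hull (u ` ?J) \<subseteq> F"
    by (rule hull_minimal) (use zero add scale in \<open>auto simp: convex_cone_iff\<close>)
  ultimately show ?thesis by blast
qed

text \<open>Subtract from any combination the multiple of the positive relation that makes the smallest ratio of
  coefficients zero.\<close>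

lemma cones_cover: "\<exists>I. I \<subset> {..<N} \<and> x \<in> convex_cone hull (u ` I)"
proof -
  obtain c where c: "x = (\<Sum>i<N. c i *\<^sub>R u i)" using circuit_span by blast
  have "N > 0" using N by simp
  then have ne: "(\<lambda>i. c i / a i) ` {..<N} \<noteq> {}" by auto
  define t where "t = Min ((\<lambda>i. c i / a i) ` {..<N})"
  have "t \<in> (\<lambda>i. c i / a i) ` {..<N}" unfolding t_def using ne by (intro Min_in) auto
  then obtain j where j: "j < N" "t = c j / a j" by auto
  have le: "t \<le> c i / a i" if "i < N" for i unfolding t_def using that by auto
  define e where "e i = (if i < N then c i - t * a i else 0)" for i
  have "(\<Sum>i<N. e i *\<^sub>R u i) = x - t *\<^sub>R (\<Sum>i<N. a i *\<^sub>R u i)"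
    by (simp add: e_def c scaleR_diff_left sum_subtractf scaleR_sum_right)
  then have "x = (\<Sum>i<N. e i *\<^sub>R u i)" by (simp add: circuit_sum)
  moreover have "0 \<le> e i" for i using le[of i] circuit_pos[of i] by (auto simp: e_def field_simps)
  moreover have "e i = 0" if "i \<notin> {..<N} - {j}" for i using that j circuit_pos[of j] by (auto simp: e_def)
  ultimately have "x \<in> convex_cone hull (u ` ({..<N} - {j}))"
    using mem_cone_iff[of "{..<N} - {j}" N x u] by blast
  then show ?thesis using j by (intro exI[of _ "{..<N} - {j}"]) auto
qed

text \<open>This singles out the maximal cones, on which alone ampleness has to be tested.\<close>

lemma cone_interior_empty:
  assumes I: "I \<subseteq> {..<N}" and ij: "i < N" "j < N" "i \<noteq> j" "i \<notin> I" "j \<notin> I"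
  shows "interior (convex_cone hull (u ` I)) = {}"
proof (rule empty_interior_lowdim)
  have fin: "finite I" using I finite_subset by blast
  have "convex_cone hull (u ` I) \<subseteq> span (u ` I)"
    by (rule hull_minimal) (auto simp: span_base convex_cone_span)
  then have "dim (convex_cone hull (u ` I)) \<le> dim (span (u ` I))" by (rule dim_subset)
  also have "\<dots> \<le> card (u ` I)" using fin by (simp add: dim_le_card')
  also have "\<dots> \<le> card I" using fin by (rule card_image_le)
  also have "\<dots> < card (insert i (insert j I)) - 1" using ij fin by simp
  also have "\<dots> \<le> card {..<N} - 1" using I ij by (intro diff_le_mono card_mono) auto
  also have "\<dots> = CARD('n)" using N by simp
  finally show "dim (convex_cone hull (u ` I)) < DIM(real ^ 'n)" by simp
qed

lemma proper_cones_complete_fan: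
  assumes u: "\<And>i. i < N \<Longrightarrow> u i \<in> int_lattice"
  shows "complete_fan (proper_cones N u)"
  unfolding complete_fan_def fan_def
proof (intro conjI ballI allI impI)
  have "proper_cones N u \<subseteq> (\<lambda>I. convex_cone hull (u ` I)) ` Pow {..<N}" by (auto simp: proper_cones_def)
  then show "finite (proper_cones N u)" by (rule finite_subset) auto
  show "proper_cones N u \<noteq> {}" using N by (auto simp: proper_cones_def intro!: exI[of _ "{}"])
  have "x \<in> \<Union> (proper_cones N u)" for x using cones_cover[of x] unfolding proper_cones_def by blast
  then show "\<Union> (proper_cones N u) = UNIV" by blast
  fix \<sigma> assume "\<sigma> \<in> proper_cones N u"
  then obtain I where I: "I \<subset> {..<N}" "\<sigma> = convex_cone hull (u ` I)" by (auto simp: proper_cones_def)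
  then have "finite I" using finite_subset[of I "{..<N}"] by auto
  then show "pointed_rational_cone \<sigma>"
    unfolding pointed_rational_cone_def I(2) using cone_pointed[OF I(1)] u I(1)
    by (intro conjI exI[of _ "u ` I"]) auto
  {
    fix \<tau> assume "\<tau> face_of \<sigma> \<and> \<tau> \<noteq> {}"
    then have "\<tau> = convex_cone hull (u ` {i\<in>I. u i \<in> \<tau>})" using face_of_cone I by blast
    moreover have "{i\<in>I. u i \<in> \<tau>} \<subset> {..<N}" using I by auto
    ultimately show "\<tau> \<in> proper_cones N u" unfolding proper_cones_def by blast
  }
  fix \<tau> assume "\<tau> \<in> proper_cones N u"
  then obtain J where J: "J \<subset> {..<N}" "\<tau> = convex_cone hull (u ` J)" by (auto simp: proper_cones_def)
  have eq: "\<sigma> \<inter> \<tau> = convex_cone hull (u ` (I \<inter> J))" unfolding I(2) J(2) by (rule cone_Int[OF I(1) J(1)])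
  show "(\<sigma> \<inter> \<tau>) face_of \<sigma>" unfolding eq using cone_face[OF I(1), of "I \<inter> J"] I(2) by simp
  show "(\<sigma> \<inter> \<tau>) face_of \<tau>" unfolding eq using cone_face[OF J(1), of "I \<inter> J"] J(2) by simp
qed

lemma rays_proper_cones:
  assumes prim: "\<And>i. i < N \<Longrightarrow> primitive (u i)"
  shows "rays (proper_cones N u) = u ` {..<N}"
proof (intro subset_antisym subsetI)
  fix v assume "v \<in> u ` {..<N}"
  then obtain i where i: "i < N" "v = u i" by auto
  have "card {i} < N" using N by simp
  then have "{i} \<subset> {..<N}" using i by (metis card_lessThan lessThan_iff nat_neq_iff psubsetI subsetI singletonD)
  then have "convex_cone hull {v} \<in> proper_cones N u" using i by (auto simp: proper_cones_def intro!: exI[of _ "{i}"])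
  then show "v \<in> rays (proper_cones N u)" using prim i by (simp add: rays_def)
next
  fix v assume "v \<in> rays (proper_cones N u)"
  then obtain I where v: "primitive v" and I: "I \<subset> {..<N}" "convex_cone hull {v} = convex_cone hull (u ` I)"
    by (auto simp: rays_def proper_cones_def)
  have "I \<noteq> {}"
  proof
    assume "I = {}"
    then have "v \<in> convex_cone hull {}" using I(2) hull_inc[of v "{v}"] by auto
    then show False using v by (auto simp: primitive_def)
  qed
  then obtain i where i: "i \<in> I" by blast
  then have "u i \<in> convex_cone hull {v}" unfolding I(2) by (auto intro: hull_inc)
  then obtain t where t: "0 \<le> t" "u i = t *\<^sub>R v" by (auto simp: convex_cone_hull_singleton)
  have "primitive (u i)" using prim i I by auto
  then have "t \<noteq> 0" using t by (auto simp: primitive_def)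
  then have "u i = v" using primitive_eq[of "u i" v t] t v \<open>primitive (u i)\<close> by simp
  then show "v \<in> u ` {..<N}" using i I by auto
qed

text \<open>A cone of the fan is generated by its rays, and these are not all rays, as otherwise the cone would be
  the whole space. Conversely, given \<open>j\<close>, the sum of all \<open>u\<^sub>i\<close> with \<open>i \<noteq> j\<close> lies in some cone of the
  fan, and by uniqueness of coefficients this cone is generated by exactly these \<open>u\<^sub>i\<close>. The
  remaining cones are its faces.\<close>

lemma complete_fan_eq_proper_cones:
  assumes fan: "complete_fan \<Sigma>" and rays: "rays \<Sigma> = u ` {..<N}"
  shows "\<Sigma> = proper_cones N u"
proof (intro subset_antisym subsetI)
  have fan': "fan \<Sigma>" using fan by (simp add: complete_fan_def)
  have *: "{i. i < N \<and> u i \<in> \<sigma>} \<subset> {..<N} \<and> \<sigma> = convex_cone hull (u ` {i. i < N \<and> u i \<in> \<sigma>})"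
    if \<sigma>: "\<sigma> \<in> \<Sigma>" for \<sigma>
  proof -
    have "u ` {i. i < N \<and> u i \<in> \<sigma>} = rays \<Sigma> \<inter> \<sigma>" unfolding rays by auto
    then have eq: "\<sigma> = convex_cone hull (u ` {i. i < N \<and> u i \<in> \<sigma>})"
      using fan_cone_generated_by_rays[OF fan' \<sigma>] by simp
    moreover have "{i. i < N \<and> u i \<in> \<sigma>} \<noteq> {..<N}"
    proof
      assume all: "{i. i < N \<and> u i \<in> \<sigma>} = {..<N}"
      have "x \<in> \<sigma>" for x
      proof -
        obtain I where "I \<subset> {..<N}" "x \<in> convex_cone hull (u ` I)" using cones_cover by blast
        then show ?thesis using eq all hull_mono[of "u ` I" "u ` {..<N}" convex_cone] by auto
      qed
      then have "\<sigma> \<inter> uminus ` \<sigma> = UNIV" by (metis (no_types, lifting) Int_UNIV UNIV_eq_I image_eqI minus_minus)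
      moreover have "\<sigma> \<inter> uminus ` \<sigma> = {0}"
        using fan' \<sigma> by (simp add: fan_def pointed_rational_cone_def)
      ultimately have "(axis undefined 1 :: real ^ 'n) = 0" by blast
      then show False by (simp add: axis_eq_0_iff)
    qed
    ultimately show ?thesis by blast
  qed
  {
    fix \<sigma> assume "\<sigma> \<in> \<Sigma>"
    from *[OF this] show "\<sigma> \<in> proper_cones N u" unfolding proper_cones_def by blast
  }
  fix \<tau> assume "\<tau> \<in> proper_cones N u"
  then obtain J where J: "J \<subset> {..<N}" "\<tau> = convex_cone hull (u ` J)" by (auto simp: proper_cones_def)
  obtain j where j: "j < N" "j \<notin> J" using psubset_missing[OF J(1)] by blast
  define x where "x = (\<Sum>i<N. (if i = j then 0 else 1) *\<^sub>R u i)"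
  have "x \<in> \<Union>\<Sigma>" using fan by (simp add: complete_fan_def)
  then obtain \<sigma> where \<sigma>: "\<sigma> \<in> \<Sigma>" "x \<in> \<sigma>" by blast
  define I where "I = {i. i < N \<and> u i \<in> \<sigma>}"
  have I: "I \<subset> {..<N}" "\<sigma> = convex_cone hull (u ` I)" using *[OF \<sigma>(1)] by (auto simp: I_def)
  obtain c where c: "\<forall>i. 0 \<le> c i" "\<forall>i. i \<notin> I \<longrightarrow> c i = 0" "x = (\<Sum>i<N. c i *\<^sub>R u i)"
    using mem_cone_iff[of I N] I \<sigma>(2) by blast
  obtain k where k: "k < N" "k \<notin> I" using psubset_missing[OF I(1)] by blast
  have "(if i = j then 0 else 1) = c i" if "i < N" for i
    by (rule circuit_unique[of "\<lambda>i. if i = j then 0 else 1" c j k])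
       (use c k j that in \<open>auto simp: x_def\<close>)
  then have "i \<in> I" if "i < N" "i \<noteq> j" for i using c(2) that by (metis zero_neq_one)
  then have "J \<subseteq> I" using J j by auto
  then have "\<tau> face_of \<sigma>" unfolding J(2) I(2) by (rule cone_face[OF I(1)])
  moreover have "\<forall>\<sigma>\<in>\<Sigma>. \<forall>\<tau>. \<tau> face_of \<sigma> \<and> \<tau> \<noteq> {} \<longrightarrow> \<tau> \<in> \<Sigma>" using fan' by (simp add: fan_def)
  moreover have "\<tau> \<noteq> {}" unfolding J(2) by (rule convex_cone_hull_nonempty)
  ultimately show "\<tau> \<in> \<Sigma>" using \<sigma>(1) by blast
qed

end

section \<open>Nef-partitions into pairs\<close>

text \<open>The values of the characters on the rays, that is, the principal divisors in the coordinates given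
  by an enumeration of the rays.\<close>

definition char_lattice :: "nat \<Rightarrow> (nat \<Rightarrow> real ^ 'n) \<Rightarrow> (nat \<Rightarrow> int) set" where
  "char_lattice N u = {x. \<exists>m\<in>int_lattice. \<forall>i<N. real_of_int (x i) = inner m (u i)}"

lemma char_lattice_add:
  assumes "x \<in> char_lattice N u" "y \<in> char_lattice N u"
  shows "(\<lambda>i. x i + y i) \<in> char_lattice N u"
proof -
  obtain m m' where "m \<in> int_lattice" "\<forall>i<N. real_of_int (x i) = inner m (u i)"
    "m' \<in> int_lattice" "\<forall>i<N. real_of_int (y i) = inner m' (u i)"
    using assms unfolding char_lattice_def by blast
  then show ?thesis unfolding char_lattice_def
    by (intro CollectI bexI[of _ "m + m'"]) (auto simp: inner_add_left intro: int_lattice_add)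
qed

lemma char_lattice_minus:
  assumes "x \<in> char_lattice N u" shows "(\<lambda>i. - x i) \<in> char_lattice N u"
proof -
  obtain m where "m \<in> int_lattice" "\<forall>i<N. real_of_int (x i) = inner m (u i)"
    using assms unfolding char_lattice_def by blast
  then show ?thesis unfolding char_lattice_def
    by (intro CollectI bexI[of _ "- m"]) (auto intro: int_lattice_minus)
qed

lemma char_lattice_diff:
  "x \<in> char_lattice N u \<Longrightarrow> y \<in> char_lattice N u \<Longrightarrow> (\<lambda>i. x i - y i) \<in> char_lattice N u"
  using char_lattice_add[OF _ char_lattice_minus, of x N u y] by simp

lemma char_lattice_cong:
  "x \<in> char_lattice N u \<Longrightarrow> (\<And>i. i < N \<Longrightarrow> y i = x i) \<Longrightarrow> y \<in> char_lattice N u"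
  by (auto simp: char_lattice_def)

lemma principal_iff_char_lattice:
  assumes rays: "rays \<Sigma> = u ` {..<N}" and D: "Poly_Mapping.keys D \<subseteq> rays \<Sigma>"
  shows "D \<in> principal_divisors \<Sigma> \<longleftrightarrow> (\<lambda>i. Poly_Mapping.lookup D (u i)) \<in> char_lattice N u"
  using D unfolding principal_iff char_lattice_def rays by auto

text \<open>On a complete toric variety a regular function is constant: nonnegativity extends from the rays to the
  cones, and hence to the whole space.\<close>

lemma complete_fan_character_nonneg:
  assumes fan: "complete_fan \<Sigma>" and nonneg: "\<And>u. u \<in> rays \<Sigma> \<Longrightarrow> 0 \<le> inner m u"
  shows "m = 0"
proof -
  have "0 \<le> inner m x" for x
  proof -
    obtain \<sigma> where \<sigma>: "\<sigma> \<in> \<Sigma>" "x \<in> \<sigma>" using fan by (auto simp: complete_fan_def)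
    have "convex_cone hull (rays \<Sigma> \<inter> \<sigma>) \<subseteq> {x. 0 \<le> inner m x}"
      using convex_cone_halfspace_ge[of m] by (intro hull_minimal) (use nonneg in auto)
    then show ?thesis using fan_cone_generated_by_rays[OF _ \<sigma>(1)] fan \<sigma>(2) by (auto simp: complete_fan_def)
  qed
  from this[of "- m"] have "inner m m \<le> 0" by simp
  then show ?thesis by (metis inner_eq_zero_iff inner_ge_zero order_antisym)
qed

lemma complete_fan_span_rays:
  assumes fan: "complete_fan \<Sigma>"
  shows "span (rays \<Sigma>) = UNIV"
proof -
  have "x \<in> span (rays \<Sigma>)" for x
  proof -
    obtain \<sigma> where \<sigma>: "\<sigma> \<in> \<Sigma>" "x \<in> \<sigma>" using fan by (auto simp: complete_fan_def)
    have "convex_cone hull (rays \<Sigma> \<inter> \<sigma>) \<subseteq> span (rays \<Sigma>)"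
      by (rule hull_minimal) (auto simp: span_base convex_cone_span)
    then show ?thesis using fan_cone_generated_by_rays[OF _ \<sigma>(1)] fan \<sigma>(2) by (auto simp: complete_fan_def)
  qed
  then show ?thesis by blast
qed

text \<open>Multiples of the two prime divisors are Cartier and hence related modulo principal divisors; the
  resulting character vanishes on all other rays, and by completeness its two remaining values are
  neither both nonnegative nor both nonpositive.\<close>

lemma opposite_sign_character:
  assumes fan: "complete_fan \<Sigma>" and Qf: "Q_factorial \<Sigma>" and rank: "abelian_rank (Pic \<Sigma>) \<le> 1"
    and uv: "u \<in> rays \<Sigma>" "v \<in> rays \<Sigma>" "u \<noteq> v"
  shows "\<exists>m. 0 < inner m u \<and> inner m v < 0 \<and> (\<forall>w\<in>rays \<Sigma> - {u, v}. inner m w = 0)"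
proof -
  have "\<exists>k>0. Cartier \<Sigma> (frag_cmul k (frag_of w))" if "w \<in> rays \<Sigma>" for w
    using Qf that unfolding Q_factorial_def by (simp add: WDiv_def)
  then obtain k l where kl: "0 < k" "Cartier \<Sigma> (frag_cmul k (frag_of u))" "0 < l" "Cartier \<Sigma> (frag_cmul l (frag_of v))"
    using uv by meson
  then obtain a b where ab: "a \<noteq> 0 \<or> b \<noteq> 0"
    "frag_cmul a (frag_cmul k (frag_of u)) + frag_cmul b (frag_cmul l (frag_of v)) \<in> principal_divisors \<Sigma>"
    using rank unfolding Picard_number_le_1_iff by blast
  then obtain m where "\<forall>w\<in>rays \<Sigma>. real_of_int (Poly_Mapping.lookup
      (frag_cmul a (frag_cmul k (frag_of u)) + frag_cmul b (frag_cmul l (frag_of v))) w) = inner m w"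
    unfolding principal_iff by blast
  then have m: "inner m w = real_of_int (a * k * (if w = u then 1 else 0) + b * l * (if w = v then 1 else 0))"
    if "w \<in> rays \<Sigma>" for w
    using that by (simp add: lookup_add)
  have m0: "inner m w = 0" if "w \<in> rays \<Sigma> - {u, v}" for w
    using m[of w] that by auto
  have mu: "inner m u = a * k" and mv: "inner m v = b * l" using m uv by auto
  have "\<not> (0 \<le> a \<and> 0 \<le> b)"
  proof
    assume nn: "0 \<le> a \<and> 0 \<le> b"
    then have "0 \<le> inner m w" if "w \<in> rays \<Sigma>" for w
      using kl that by (simp add: m)
    then have "m = 0" by (rule complete_fan_character_nonneg[OF fan])
    then show False using mu mv ab(1) kl by auto
  qed
  moreover have "\<not> (a \<le> 0 \<and> b \<le> 0)"
  proof
    assume nn: "a \<le> 0 \<and> b \<le> 0"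
    then have "a * k * (if w = u then 1 else 0) + b * l * (if w = v then 1 else 0) \<le> 0" for w
      using kl by (intro add_nonpos_nonpos) (auto simp: mult_nonpos_nonneg)
    then have "0 \<le> inner (- m) w" if "w \<in> rays \<Sigma>" for w
      using that m by (simp only: inner_minus_left) (metis neg_0_le_iff_le of_int_le_0_iff)
    then have "- m = 0" by (rule complete_fan_character_nonneg[OF fan])
    then show False using mu mv ab(1) kl by auto
  qed
  ultimately consider "0 < a" "b < 0" | "a < 0" "0 < b" by linarith
  then show ?thesis
  proof cases
    case 1
    then show ?thesis using mu mv m0 kl
      by (intro exI[of _ m]) (auto simp: mult_neg_pos simp flip: of_int_mult)
  next
    case 2
    then show ?thesis using mu mv m0 kl
      by (intro exI[of _ "- m"]) (auto simp: mult_neg_pos simp flip: of_int_mult)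
  qed
qed

text \<open>With one ray \<open>v\<close> fixed, the characters that separate the other rays from \<open>v\<close> are linearly
  independent.\<close>

lemma card_rays_le:
  fixes \<Sigma> :: "(real ^ 'n) set set"
  assumes fan: "complete_fan \<Sigma>" and Qf: "Q_factorial \<Sigma>" and rank: "abelian_rank (Pic \<Sigma>) \<le> 1"
  shows "card (rays \<Sigma>) \<le> CARD('n) + 1"
proof (cases "rays \<Sigma> = {}")
  case False
  then obtain v where v: "v \<in> rays \<Sigma>" by blast
  have fin: "finite (rays \<Sigma>)" using fan fan_finite_rays by (auto simp: complete_fan_def)
  obtain m where m: "\<And>u. u \<in> rays \<Sigma> - {v} \<Longrightarrow>
      0 < inner (m u) u \<and> inner (m u) v < 0 \<and> (\<forall>w\<in>rays \<Sigma> - {u, v}. inner (m u) w = 0)"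
    using opposite_sign_character[OF assms _ v] by (metis DiffD1 DiffD2 singletonI)
  let ?U = "rays \<Sigma> - {v}"
  have off: "inner (m w) u = 0" if "u \<in> ?U" "w \<in> ?U" "w \<noteq> u" for u w
    using m[OF that(2)] that by blast
  have inj: "inj_on m ?U"
    by (rule inj_onI) (metis m off less_irrefl)
  have "independent (m ` ?U)"
  proof (rule independent_if_scalars_zero)
    fix f x assume f: "(\<Sum>x\<in>m ` ?U. f x *\<^sub>R x) = 0" and "x \<in> m ` ?U"
    then obtain u where u: "u \<in> ?U" "x = m u" by blast
    have "0 = inner (\<Sum>w\<in>?U. f (m w) *\<^sub>R m w) u"
      using f by (simp add: sum.reindex[OF inj])
    also have "\<dots> = (\<Sum>w\<in>?U. f (m w) * inner (m w) u)" by (simp add: inner_sum_left)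
    also have "\<dots> = (\<Sum>w\<in>{u}. f (m w) * inner (m w) u)"
      by (rule sum.mono_neutral_right) (use fin u off in auto)
    finally have "f (m u) * inner (m u) u = 0" by simp
    then show "f x = 0" using m[OF u(1)] u(2) by simp
  qed (use fin in auto)
  then have "card (m ` ?U) \<le> DIM(real ^ 'n)" using independent_bound by blast
  then have "card ?U \<le> CARD('n)" using card_image[OF inj] by simp
  then show ?thesis using v fin by (simp add: card_Diff_singleton)
qed simp

text \<open>Evaluating a relation at a character that has opposite signs on two rays and vanishes elsewhere shows
  that the two coefficients have the same sign. So a nontrivial relation has coefficients of a single
  sign, and it is unique up to scaling since a suitable combination with another one has a zero
  coefficient.\<close>

lemma rays_circuit:
  fixes \<Sigma> :: "(real ^ 'n) set set"
  assumes fan: "complete_fan \<Sigma>" and Qf: "Q_factorial \<Sigma>" and rank: "abelian_rank (Pic \<Sigma>) \<le> 1"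
    and u: "bij_betw u {..<N} (rays \<Sigma>)" and N: "N = CARD('n) + 1"
  shows "\<exists>a. circuit N a u"
proof -
  have inj: "inj_on u {..<N}" and range: "u ` {..<N} = rays \<Sigma>" using u by (auto simp: bij_betw_def)
  have fin: "finite (rays \<Sigma>)" using range by (metis finite_imageI finite_lessThan)
  have sign: "(0 < c i \<and> 0 < c j) \<or> (c i < 0 \<and> c j < 0) \<or> (c i = 0 \<and> c j = 0)"
    if c: "(\<Sum>i<N. c i *\<^sub>R u i) = 0" and ij: "i < N" "j < N" for c i j
  proof (cases "i = j")
    case False
    then have ne: "u i \<noteq> u j" using inj ij by (auto simp: inj_on_def)
    have "u i \<in> rays \<Sigma>" "u j \<in> rays \<Sigma>" using range ij by auto
    then obtain m where m: "0 < inner m (u i)" "inner m (u j) < 0" "\<forall>w\<in>rays \<Sigma> - {u i, u j}. inner m w = 0"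
      using opposite_sign_character[OF fan Qf rank _ _ ne] by blast
    have "0 = inner m (\<Sum>k<N. c k *\<^sub>R u k)" using c by simp
    also have "\<dots> = (\<Sum>k<N. c k * inner m (u k))" by (simp add: inner_sum_right)
    also have "\<dots> = (\<Sum>k\<in>{i,j}. c k * inner m (u k))"
    proof (rule sum.mono_neutral_right)
      show "\<forall>k\<in>{..<N} - {i, j}. c k * inner m (u k) = 0"
        using m(3) range inj ij by (auto simp: inj_on_def)
    qed (use ij in auto)
    finally have eq: "c i * inner m (u i) = c j * (- inner m (u j))" using False by simp
    have "0 < c i \<longleftrightarrow> 0 < c i * inner m (u i)" "c i < 0 \<longleftrightarrow> c i * inner m (u i) < 0"
      "0 < c j \<longleftrightarrow> 0 < c j * (- inner m (u j))" "c j < 0 \<longleftrightarrow> c j * (- inner m (u j)) < 0"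
      using m(1,2) by (auto simp: zero_less_mult_iff mult_less_0_iff)
    then show ?thesis using eq by linarith
  qed auto
  have "card (rays \<Sigma>) = N" using inj range by (metis card_image card_lessThan)
  then have "dependent (rays \<Sigma>)"
    using N independent_bound[of "rays \<Sigma>"] by fastforce
  then obtain f v where f: "(\<Sum>v\<in>rays \<Sigma>. f v *\<^sub>R v) = 0" "v \<in> rays \<Sigma>" "f v \<noteq> 0"
    using dependent_finite[OF fin] by blast
  obtain k where k: "k < N" "v = u k" using f(2) range by auto
  define a where "a i = f (u i) / f v" for i
  have "(\<Sum>i<N. f (u i) *\<^sub>R u i) = 0"
    using f(1) by (simp add: sum.reindex[OF inj] flip: range)
  then have a0: "(\<Sum>i<N. a i *\<^sub>R u i) = 0"
    unfolding a_def by (simp add: divide_inverse mult.commute[of _ "inverse _"] flip: scaleR_scaleR scaleR_sum_right)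
  have "a k = 1" using k f(3) by (simp add: a_def)
  then have pos: "0 < a i" if "i < N" for i using sign[OF a0 that k(1)] by auto
  have "\<exists>t. \<forall>i<N. c i = t * a i" if c: "(\<Sum>i<N. c i *\<^sub>R u i) = 0" for c
  proof -
    have "(\<Sum>i<N. (c i - c k * a i) *\<^sub>R u i) = (\<Sum>i<N. c i *\<^sub>R u i) - c k *\<^sub>R (\<Sum>i<N. a i *\<^sub>R u i)"
      by (simp add: scaleR_diff_left sum_subtractf scaleR_sum_right)
    then have "(\<Sum>i<N. (c i - c k * a i) *\<^sub>R u i) = 0" using c a0 by simp
    from sign[OF this _ k(1)] have "c i - c k * a i = 0" if "i < N" for i
      using that \<open>a k = 1\<close> by fastforce
    then show ?thesis by (intro exI[of _ "c k"]) auto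
  qed
  moreover have "\<exists>c. x = (\<Sum>i<N. c i *\<^sub>R u i)" for x
  proof -
    have "x \<in> span (rays \<Sigma>)" using complete_fan_span_rays[OF fan] by simp
    then obtain g where "x = (\<Sum>v\<in>rays \<Sigma>. g v *\<^sub>R v)" unfolding span_finite[OF fin] by auto
    then have "x = (\<Sum>i<N. g (u i) *\<^sub>R u i)" by (simp add: sum.reindex[OF inj] flip: range)
    then show ?thesis by (rule exI[where x = "\<lambda>i. g (u i)"])
  qed
  ultimately have "circuit N a u" using pos a0 unfolding circuit_def by blast
  then show ?thesis by blast
qed

lemma block_class_union:
  assumes "finite (rays \<Sigma>)" "p \<subseteq> rays \<Sigma>"
  shows "block_class \<Sigma> p = div_class \<Sigma> (\<Sum>u\<in>p. frag_of u)"
  using assms finite_subset by (intro block_class_eq) auto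

text \<open>The difference to a Cartier divisor of the same class is principal, hence Cartier.\<close>

lemma block_Cartier:
  assumes "finite (rays \<Sigma>)" "p \<subseteq> rays \<Sigma>" "block_class \<Sigma> p \<in> carrier (Pic \<Sigma>)"
  shows "Cartier \<Sigma> (\<Sum>u\<in>p. frag_of u)"
proof -
  obtain E where E: "Cartier \<Sigma> E" "div_class \<Sigma> (\<Sum>u\<in>p. frag_of u) = div_class \<Sigma> E"
    using assms block_class_union[of \<Sigma> p] by (auto simp: Pic_def)
  then have "Cartier \<Sigma> ((\<Sum>u\<in>p. frag_of u) - E)"
    by (intro principal_imp_Cartier) (simp add: div_class_eq_iff)
  from Cartier_add[OF this E(1)] show ?thesis by simp
qed

text \<open>No block is a singleton, so \<open>d + 1\<close> blocks exhaust \<open>2d + 2\<close> rays only if each has two elements.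
  The enumeration puts the two elements of a block at distance \<open>d + 1\<close>.\<close>

lemma nef_partition_pairs:
  fixes \<Sigma> :: "(real ^ 'n) set set"
  assumes fin: "finite (rays \<Sigma>)" and nef: "nef_partition \<Sigma> P" and P: "card P = d + 1"
    and le: "card (rays \<Sigma>) \<le> num_rays d"
  shows "\<exists>u. bij_betw u {..<num_rays d} (rays \<Sigma>) \<and> P = (\<lambda>i. {u i, u (i+d+1)}) ` {..d}"
proof -
  have part: "partition_on (rays \<Sigma>) P" using nef by (simp add: nef_partition_def)
  have Un: "\<Union>P = rays \<Sigma>" and dis: "disjoint P" and ne: "\<And>p. p \<in> P \<Longrightarrow> p \<noteq> {}"
    using part by (auto simp: partition_on_def)
  have finp: "finite p" if "p \<in> P" for p using that Un fin by (metis Union_upper finite_subset)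
  have ge2: "2 \<le> card p" if p: "p \<in> P" for p
  proof (rule ccontr)
    assume "\<not> 2 \<le> card p"
    moreover have "card p \<noteq> 0" using ne[OF p] finp[OF p] by simp
    ultimately have "card p = 1" by linarith
    then obtain u where u: "p = {u}" using card_1_singletonE by blast
    then have "u \<in> rays \<Sigma>" using p Un by auto
    then have "block_class \<Sigma> p = div_class \<Sigma> (frag_of u)" using u by (simp add: block_class_eq)
    then show False using nef p \<open>u \<in> rays \<Sigma>\<close> unfolding nef_partition_def by blast
  qed
  have finP: "finite P" using P by (metis Suc_eq_plus1 card.infinite nat.distinct(1))
  have sum: "card (rays \<Sigma>) = (\<Sum>p\<in>P. card p)"
    using card_Union_disjoint[of P] finp dis unfolding Un by (simp add: disjoint_def pairwise_def disjnt_def)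
  have card2: "card p = 2" if p: "p \<in> P" for p
  proof (rule ccontr)
    assume "card p \<noteq> 2"
    then have "(\<Sum>p\<in>P. 2) < (\<Sum>p\<in>P. card p)"
      using ge2 p finP by (intro sum_strict_mono_ex1) (auto intro!: bexI[of _ p] simp: order_less_le)
    then show False using sum le P by (simp add: num_rays_def)
  qed
  have card_rays: "card (rays \<Sigma>) = num_rays d" using sum card2 P by (simp add: num_rays_def)
  obtain h where h: "bij_betw h {..d} P"
    using finite_same_card_bij[of "{..d}" P] finP P by auto
  have "\<exists>x y. h i = {x, y}" if "i \<le> d" for i
    using card2[of "h i"] h that by (auto simp: bij_betw_def card_2_iff)
  then obtain f g where fg: "\<And>i. i \<le> d \<Longrightarrow> h i = {f i, g i}" by metis
  define u where "u i = (if i \<le> d then f i else g (i - d - 1))" for i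
  have hu: "h i = {u i, u (i+d+1)}" if "i \<le> d" for i using fg[OF that] that by (simp add: u_def)
  have P_eq: "P = (\<lambda>i. {u i, u (i+d+1)}) ` {..d}" using h hu by (auto simp: bij_betw_def)
  have "u ` {..<num_rays d} = \<Union>P"
    unfolding P_eq num_rays_two_halves by (auto simp: image_Un image_image)
  then have img: "u ` {..<num_rays d} = rays \<Sigma>" using Un by simp
  then have "inj_on u {..<num_rays d}" using card_rays by (intro eq_card_imp_inj_on) auto
  then have "bij_betw u {..<num_rays d} (rays \<Sigma>)" using img by (simp add: bij_betw_def)
  then show ?thesis using P_eq by blast
qed

lemma circuit_const:
  assumes "circuit N a u" and sum: "(\<Sum>i<N. u i) = 0"
  shows "circuit N (\<lambda>_. 1) u"
proof -
  have rel: "\<exists>t. \<forall>i<N. c i = t * a i" if "(\<Sum>i<N. c i *\<^sub>R u i) = 0" for c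
    using assms(1) that by (simp add: circuit_def)
  obtain t where t: "\<forall>i<N. 1 = t * a i" using rel[of "\<lambda>_. 1"] sum by auto
  have "\<exists>s. \<forall>i<N. c i = s * 1" if c: "(\<Sum>i<N. c i *\<^sub>R u i) = 0" for c
  proof -
    obtain s where s: "\<forall>i<N. c i = s * a i" using rel[OF c] by blast
    have "c i = s / t" if "i < N" for i
    proof -
      have "1 = t * a i" "t \<noteq> 0" using t that by auto
      then show ?thesis using s that by (simp add: field_simps)
    qed
    then show ?thesis by (intro exI[of _ "s / t"]) auto
  qed
  then show ?thesis using assms unfolding circuit_def by simp
qed

text \<open>Principal divisors have degree zero.\<close>

lemma circuit_char_lattice:
  assumes "circuit N a u" "x \<in> char_lattice N u"
  shows "(\<Sum>i<N. a i * real_of_int (x i)) = 0"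
proof -
  obtain m where m: "\<forall>i<N. real_of_int (x i) = inner m (u i)" using assms(2) by (auto simp: char_lattice_def)
  have "(\<Sum>i<N. a i * real_of_int (x i)) = inner m (\<Sum>i<N. a i *\<^sub>R u i)"
    using m by (simp add: inner_sum_right)
  then show ?thesis using assms(1) by (simp add: circuit_def)
qed

lemma sum_unit_at:
  fixes g :: "nat \<Rightarrow> 'a::comm_ring_1"
  shows "i < N \<Longrightarrow> (\<Sum>k<N. g k * of_int (unit_at i k)) = g i"
  by (simp add: unit_at_def if_distrib[of of_int] if_distrib[of "\<lambda>x. _ * x"] cong: if_cong)

lemma sum_unit_at_int: "i < N \<Longrightarrow> (\<Sum>k<N. unit_at i k) = 1"
  by (simp add: unit_at_def)

text \<open>The divisor of a block is principal on the chart of the cone that omits \<open>u\<^sub>j\<close>, so there is a vector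
  of the lattice that agrees with it except at \<open>j\<close>. Its coordinate at \<open>j\<close> is determined by the degrees
  \<open>a\<close>. Omitting an element of the block gives that the degrees of its two elements divide each other,
  and omitting another ray gives that \<open>2 a\<^sub>i\<close> is a multiple \<open>z a\<^sub>j\<close>, where \<open>z = 1\<close> would make the class
  of the block equal to the class of \<open>u\<^sub>j\<close>. Hence \<open>a\<^sub>i \<ge> a\<^sub>j\<close> for all \<open>i\<close> and \<open>j\<close>, so the degrees
  are equal and \<open>z = 2\<close>.\<close>

lemma nef_partition_lattice:
  fixes \<Sigma> :: "(real ^ 'n) set set"
  assumes fwps: "fwps \<Sigma>" and nef: "nef_partition \<Sigma> P" and P: "card P = d + 1"
    and n: "CARD('n) = d + (d + 1)"
  shows "\<exists>u. bij_betw u {..<num_rays d} (rays \<Sigma>) \<and> P = (\<lambda>i. {u i, u (i+d+1)}) ` {..d} \<and>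
    circuit (num_rays d) (\<lambda>_. 1) u \<and> paired_lattice d (char_lattice (num_rays d) u)"
proof -
  define N where "N = num_rays d"
  have N: "N = CARD('n) + 1" using n by (simp add: N_def num_rays_def)
  have fan: "complete_fan \<Sigma>" and Qf: "Q_factorial \<Sigma>" and rank: "abelian_rank (Pic \<Sigma>) \<le> 1"
    using fwps by (auto simp: fwps_def Fano_def)
  have fin: "finite (rays \<Sigma>)" using fan fan_finite_rays by (auto simp: complete_fan_def)
  have "card (rays \<Sigma>) \<le> num_rays d" using card_rays_le[OF fan Qf rank] n by (simp add: num_rays_def)
  then obtain u where u: "bij_betw u {..<N} (rays \<Sigma>)" and P_eq: "P = (\<lambda>i. {u i, u (i+d+1)}) ` {..d}"
    using nef_partition_pairs[OF fin nef P] by (auto simp: N_def)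
  have inj: "inj_on u {..<N}" and range: "rays \<Sigma> = u ` {..<N}" using u by (auto simp: bij_betw_def)
  have u_eq: "u i = u j \<longleftrightarrow> i = j" if "i < N" "j < N" for i j
    using inj that by (auto simp: inj_on_def)
  obtain a where a: "circuit N a u" using rays_circuit[OF fan Qf rank u N] by blast
  have apos: "0 < a i" if "i < N" for i using a that by (simp add: circuit_def)
  have \<Sigma>: "\<Sigma> = proper_cones N u" by (rule complete_fan_eq_proper_cones[OF a N fan range])
  let ?K = "char_lattice N u"
  have ulat: "u i \<in> int_lattice" if "i < N" for i using range that by (auto simp: rays_def primitive_def)
  have iN: "i < N" "i+d+1 < N" if "i \<le> d" for i using that by (auto simp: N_def num_rays_def)
  define D where "D i = frag_of (u i) + frag_of (u (i+d+1))" for i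
  have D: "(\<Sum>v\<in>{u i, u (i+d+1)}. frag_of v) = D i" if "i \<le> d" for i
    using u_eq iN[OF that] by (simp add: D_def)
  have D_lookup: "Poly_Mapping.lookup (D i) (u k) = unit_at i k + unit_at (i+d+1) k" if "i \<le> d" "k < N" for i k
    using u_eq iN[OF that(1)] that(2) by (simp add: D_def lookup_add unit_at_def)
  have D_keys: "Poly_Mapping.keys (D i) \<subseteq> rays \<Sigma>" if "i \<le> d" for i
    using keys_add[of "frag_of (u i)" "frag_of (u (i+d+1))"] iN[OF that] by (auto simp: D_def range)
  have block: "{u i, u (i+d+1)} \<in> P" "{u i, u (i+d+1)} \<subseteq> rays \<Sigma>" if "i \<le> d" for i
    using that iN[OF that] by (auto simp: P_eq range)
  have block_class: "block_class \<Sigma> {u i, u (i+d+1)} = div_class \<Sigma> (D i)" if "i \<le> d" for i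
    using block_class_union[OF fin block(2)[OF that]] D[OF that] by simp
  \<comment> \<open>The local equation of the divisor of a block on the chart of the cone that omits \<open>u j\<close>.\<close>
  have local: "\<exists>x\<in>?K. \<forall>k<N. k \<noteq> j \<longrightarrow> x k = unit_at i k + unit_at (i+d+1) k" if i: "i \<le> d" and j: "j < N" for i j
  proof -
    have "Cartier \<Sigma> (D i)"
      using block_Cartier[OF fin block(2)[OF i]] nef block(1)[OF i] D[OF i] unfolding nef_partition_def by metis
    moreover have "convex_cone hull (u ` ({..<N} - {j})) \<in> \<Sigma>"
      unfolding \<Sigma> proper_cones_def using j by blast
    ultimately obtain m where m: "m \<in> int_lattice"
      "\<forall>v\<in>rays \<Sigma> \<inter> convex_cone hull (u ` ({..<N} - {j})). real_of_int (Poly_Mapping.lookup (D i) v) = inner m v"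
      unfolding Cartier_iff by blast
    define x where "x k = \<lfloor>inner m (u k)\<rfloor>" for k
    have x: "real_of_int (x k) = inner m (u k)" if "k < N" for k
      using int_lattice_inner_ints[OF m(1) ulat[OF that]] by (auto simp: x_def)
    then have "x \<in> ?K" using m(1) by (auto simp: char_lattice_def)
    moreover have "x k = unit_at i k + unit_at (i+d+1) k" if k: "k < N" "k \<noteq> j" for k
    proof -
      have "u k \<in> rays \<Sigma> \<inter> convex_cone hull (u ` ({..<N} - {j}))"
        using k by (auto simp: range intro: hull_inc)
      then have "real_of_int (x k) = real_of_int (Poly_Mapping.lookup (D i) (u k))"
        using m(2) x[OF k(1)] by simp
      then show ?thesis using D_lookup[OF i k(1)] by simp
    qed
    ultimately show ?thesis by blast
  qed
  \<comment> \<open>As principal divisors have degree zero, the coordinate of the local equation at \<open>j\<close> is determined.\<close>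
  have weights: "a i + a (i+d+1) + a j * (x j - unit_at i j - unit_at (i+d+1) j) = 0"
    if i: "i \<le> d" and j: "j < N" and x: "x \<in> ?K" "\<forall>k<N. k \<noteq> j \<longrightarrow> x k = unit_at i k + unit_at (i+d+1) k" for i j x
  proof -
    have "0 = (\<Sum>k<N. a k * real_of_int (x k))" using circuit_char_lattice[OF a x(1)] by simp
    also have "\<dots> = (\<Sum>k<N. a k * of_int (unit_at i k) + a k * of_int (unit_at (i+d+1) k)
        + a k * (x j - unit_at i j - unit_at (i+d+1) j) * of_int (unit_at j k))"
      by (rule sum.cong) (use x(2) in \<open>auto simp: unit_at_def algebra_simps\<close>)
    also have "\<dots> = a i + a (i+d+1) + a j * (x j - unit_at i j - unit_at (i+d+1) j)"
      using iN[OF i] j by (simp add: sum.distrib sum_unit_at)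
    finally show ?thesis by simp
  qed
  have pair: "a (i+d+1) = a i \<and> (\<lambda>k. unit_at i k - unit_at (i+d+1) k) \<in> ?K" if i: "i \<le> d" for i
  proof -
    let ?i = "i + d + 1"
    obtain x where x: "x \<in> ?K" "\<forall>k<N. k \<noteq> i \<longrightarrow> x k = unit_at i k + unit_at ?i k" using local[OF i iN(1)[OF i]] by blast
    obtain x' where x': "x' \<in> ?K" "\<forall>k<N. k \<noteq> ?i \<longrightarrow> x' k = unit_at i k + unit_at ?i k" using local[OF i iN(2)[OF i]] by blast
    have 1: "a ?i = real_of_int (- x i) * a i" using weights[OF i iN(1)[OF i] x] by (simp add: unit_at_def algebra_simps)
    have 2: "a i = real_of_int (- x' ?i) * a ?i" using weights[OF i iN(2)[OF i] x'] by (simp add: unit_at_def algebra_simps)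
    have pos: "0 < a i" "0 < a ?i" using apos iN[OF i] by auto
    have "a i = real_of_int (- x' ?i) * (real_of_int (- x i) * a i)" using 1 2 by simp
    then have "real_of_int ((- x' ?i) * (- x i)) = 1" using pos by simp
    then have "(- x' ?i) * (- x i) = 1" by (simp only: of_int_eq_1_iff)
    moreover have "0 < - x i"
    proof -
      have "0 < real_of_int (- x i) * a i" using 1 pos by simp
      then show ?thesis using pos by (simp only: zero_less_mult_iff of_int_0_less_iff) auto
    qed
    ultimately have xi: "x i = -1" by (metis minus_minus pos_zmult_eq_1_iff mult.commute)
    have "(\<lambda>k. - x k) \<in> ?K" by (rule char_lattice_minus[OF x(1)])
    then have "(\<lambda>k. unit_at i k - unit_at ?i k) \<in> ?K"
      by (rule char_lattice_cong) (use x(2) xi in \<open>auto simp: unit_at_def\<close>)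
    then show ?thesis using 1 xi by simp
  qed
  have other: "\<exists>z\<ge>2. real_of_int z * a j = 2 * a i \<and> (\<lambda>k. unit_at i k + unit_at (i+d+1) k - z * unit_at j k) \<in> ?K"
    if i: "i \<le> d" and j: "j < N" "j \<noteq> i" "j \<noteq> i+d+1" for i j
  proof -
    obtain x where x: "x \<in> ?K" "\<forall>k<N. k \<noteq> j \<longrightarrow> x k = unit_at i k + unit_at (i+d+1) k" using local[OF i j(1)] by blast
    have eq: "real_of_int (- x j) * a j = 2 * a i"
      using weights[OF i j(1) x] pair[OF i] j by (simp add: unit_at_def algebra_simps)
    have mem: "(\<lambda>k. unit_at i k + unit_at (i+d+1) k - (- x j) * unit_at j k) \<in> ?K"
      by (rule char_lattice_cong[OF x(1)]) (use x(2) j in \<open>auto simp: unit_at_def\<close>)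
    have "0 < - x j"
    proof -
      have "0 < real_of_int (- x j) * a j" using eq apos iN[OF i] by simp
      then show ?thesis using apos[OF j(1)] by (simp only: zero_less_mult_iff of_int_0_less_iff) auto
    qed
    moreover have "- x j \<noteq> 1"
    proof
      assume "- x j = 1"
      then have "(\<lambda>k. Poly_Mapping.lookup (D i - frag_of (u j)) (u k)) \<in> ?K"
        using D_lookup[OF i] u_eq j(1)
        by (intro char_lattice_cong[OF mem]) (simp add: lookup_minus unit_at_def)
      moreover have "Poly_Mapping.keys (D i - frag_of (u j)) \<subseteq> rays \<Sigma>"
        using keys_diff[of "D i" "frag_of (u j)"] D_keys[OF i] j(1) by (auto simp: range)
      ultimately have "D i - frag_of (u j) \<in> principal_divisors \<Sigma>"
        using principal_iff_char_lattice[OF range] by blast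
      then have "block_class \<Sigma> {u i, u (i+d+1)} = div_class \<Sigma> (frag_of (u j))"
        unfolding block_class[OF i] div_class_eq_iff .
      then show False using nef block(1)[OF i] j(1) range unfolding nef_partition_def by blast
    qed
    ultimately show ?thesis using eq mem by (intro exI[of _ "- x j"]) auto
  qed
  have rep: "\<exists>k\<le>d. i = k \<or> i = k+d+1" if "i < N" for i
    using that by (intro exI[of _ "if i \<le> d then i else i - d - 1"]) (auto simp: N_def num_rays_def)
  have le: "a j \<le> a i" if ij: "i < N" "j < N" for i j
  proof -
    obtain k where k: "k \<le> d" "i = k \<or> i = k+d+1" using rep[OF ij(1)] by blast
    have ai: "a i = a k" using k pair by auto
    show ?thesis
    proof (cases "j = k \<or> j = k+d+1")
      case True then show ?thesis using ai pair k by auto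
    next
      case False
      then obtain z where z: "2 \<le> z" "real_of_int z * a j = 2 * a k" using other[OF k(1) ij(2)] by blast
      have "2 * a j \<le> real_of_int z * a j" using z(1) apos[OF ij(2)] by (intro mult_right_mono) auto
      then show ?thesis using z(2) ai by simp
    qed
  qed
  have const: "a i = a 0" if "i < N" for i using le[OF that, of 0] le[OF _ that, of 0] N by (auto intro: order_antisym)
  have a0: "0 < a 0" using apos N by simp
  have "a 0 *\<^sub>R (\<Sum>i<N. u i) = (\<Sum>i<N. a i *\<^sub>R u i)"
    unfolding scaleR_sum_right
  proof (rule sum.cong)
    fix i assume "i \<in> {..<N}"
    then have "a i = a 0" using const by blast
    then show "a 0 *\<^sub>R u i = a i *\<^sub>R u i" by (simp only:)
  qed simp
  then have "(\<Sum>i<N. u i) = 0" using a a0 by (simp add: circuit_def)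
  then have circ: "circuit N (\<lambda>_. 1) u" using circuit_const[OF a] by blast
  have sum0: "(\<Sum>i<N. x i) = 0" if "x \<in> ?K" for x
    using circuit_char_lattice[OF circ that] by (simp flip: of_int_sum)
  have double: "(\<lambda>k. unit_at i k + unit_at (i+d+1) k - 2 * unit_at j k) \<in> ?K" if i: "i \<le> d" and j: "j < N" for i j
  proof -
    consider "j = i" | "j = i+d+1" | "j \<noteq> i" "j \<noteq> i+d+1" by blast
    then show ?thesis
    proof cases
      case 1
      show ?thesis by (rule char_lattice_cong[OF char_lattice_minus[OF conjunct2[OF pair[OF i]]]]) (simp add: 1)
    next
      case 2
      show ?thesis by (rule char_lattice_cong[OF conjunct2[OF pair[OF i]]]) (simp add: 2)
    next
      case 3
      obtain z where z: "real_of_int z * a j = 2 * a i" "(\<lambda>k. unit_at i k + unit_at (i+d+1) k - z * unit_at j k) \<in> ?K"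
        using other[OF i j 3] by blast
      have "z = 2" using z(1) const[OF j] const[OF iN(1)[OF i]] a0 by simp
      then show ?thesis using z(2) by simp
    qed
  qed
  have twice: "(\<lambda>k. 2 * unit_at i k - 2 * unit_at j k) \<in> ?K" if ij: "i < N" "j < N" for i j
  proof -
    obtain k where k: "k \<le> d" "i = k \<or> i = k+d+1" using rep[OF ij(1)] by blast
    note pk = conjunct2[OF pair[OF k(1)]] and dk = double[OF k(1) ij(2)]
    from k(2) show ?thesis
    proof
      assume "i = k"
      then show ?thesis by (intro char_lattice_cong[OF char_lattice_add[OF dk pk]]) simp
    next
      assume "i = k+d+1"
      then show ?thesis by (intro char_lattice_cong[OF char_lattice_diff[OF dk pk]]) simp
    qed
  qed
  have "paired_lattice d ?K"
    unfolding paired_lattice_def N_def[symmetric]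
    using char_lattice_diff sum0 twice pair by (auto elim: char_lattice_cong)
  then show ?thesis using u P_eq circ unfolding N_def by blast
qed

text \<open>The lattice of one enumeration, adapted to the nef-partition, determines the rest for every
  enumeration. A block \<open>{i, k}\<close> has the class of twice the prime divisor of \<open>j\<close>, because
  \<open>e\<^sub>i + e\<^sub>k - 2 e\<^sub>j\<close> differs from \<open>e\<^sub>i - e\<^sub>k\<close> by an even vector of coordinate sum zero.\<close>

lemma cyci_pair_structure:
  fixes \<Sigma> :: "(real ^ 'n::finite) set set"
  assumes pair: "(\<Sigma>, \<mu>) \<in> cyci_pairs (d + 1)" and n: "CARD('n) = d + (d + 1)"
  shows "\<exists>u. bij_betw u {..<num_rays d} (rays \<Sigma>) \<and> paired_lattice d (char_lattice (num_rays d) u)"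
    and "bij_betw u {..<num_rays d} (rays \<Sigma>) \<Longrightarrow>
      circuit (num_rays d) (\<lambda>_. 1) u \<and> \<Sigma> = proper_cones (num_rays d) u \<and>
      \<mu> = replicate_mset (d + 1) (div_class \<Sigma> (frag_cmul 2 (frag_of (u 0))))"
proof -
  define N where "N = num_rays d"
  have N: "N = CARD('n) + 1" using n by (simp add: N_def num_rays_def)
  obtain P where P: "fwps \<Sigma>" "nef_partition \<Sigma> P" "card P = d + 1" "\<mu> = multidegree \<Sigma> P"
    using pair by (auto simp: cyci_pairs_def)
  obtain w where w: "bij_betw w {..<N} (rays \<Sigma>)" "P = (\<lambda>i. {w i, w (i+d+1)}) ` {..d}"
    "circuit N (\<lambda>_. 1) w" "paired_lattice d (char_lattice N w)"
    using nef_partition_lattice[OF P(1-3) n] unfolding N_def by blast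
  have inj: "inj_on w {..<N}" and range: "rays \<Sigma> = w ` {..<N}" using w(1) by (auto simp: bij_betw_def)
  have fan: "complete_fan \<Sigma>" and Qf: "Q_factorial \<Sigma>" and rank: "abelian_rank (Pic \<Sigma>) \<le> 1"
    using P(1) by (auto simp: fwps_def Fano_def)
  have fin: "finite (rays \<Sigma>)" by (simp add: range)
  show "\<exists>u. bij_betw u {..<num_rays d} (rays \<Sigma>) \<and> paired_lattice d (char_lattice (num_rays d) u)"
    using w unfolding N_def by blast
  have sum: "(\<Sum>v\<in>rays \<Sigma>. v) = 0"
    using w(3) unfolding range sum.reindex[OF inj] by (simp add: circuit_def)
  assume "bij_betw u {..<num_rays d} (rays \<Sigma>)"
  then have u: "bij_betw u {..<N} (rays \<Sigma>)" by (simp add: N_def)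
  obtain a where a: "circuit N a u" using rays_circuit[OF fan Qf rank u N] by blast
  have "(\<Sum>i<N. u i) = 0" using sum.reindex_bij_betw[OF u, of "\<lambda>v. v"] sum by simp
  then have circ: "circuit N (\<lambda>_. 1) u" by (rule circuit_const[OF a])
  have "rays \<Sigma> = u ` {..<N}" using u by (simp add: bij_betw_def)
  then have \<Sigma>: "\<Sigma> = proper_cones N u" by (rule complete_fan_eq_proper_cones[OF circ N fan])
  have "u 0 \<in> rays \<Sigma>" using u N by (auto simp: bij_betw_def)
  then obtain j where j: "j < N" "u 0 = w j" using range by auto
  have "block_class \<Sigma> p = div_class \<Sigma> (frag_cmul 2 (frag_of (u 0)))" if p: "p \<in> P" for p
  proof -
    obtain i where i: "i \<le> d" "p = {w i, w (i+d+1)}" using p w(2) by auto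
    have iN: "i < N" "i+d+1 < N" using i(1) by (auto simp: N_def num_rays_def)
    have w_eq: "w k = w l \<longleftrightarrow> k = l" if "k < N" "l < N" for k l
      using inj that by (auto simp: inj_on_def)
    have ne: "w i \<noteq> w (i+d+1)" using w_eq[OF iN] by simp
    let ?E = "frag_of (w i) + frag_of (w (i+d+1)) - frag_cmul 2 (frag_of (w j))"
    have "(\<lambda>k. unit_at i k + unit_at (i+d+1) k - 2 * unit_at j k) \<in> char_lattice N w"
      by (rule paired_lattice_parity[OF w(4) paired_lattice_pair[OF w(4) i(1)]])
         (use iN j in \<open>auto simp: sum.distrib sum_subtractf sum_unit_at_int sum_distrib_left[symmetric] simp flip: N_def\<close>)
    then have "(\<lambda>k. Poly_Mapping.lookup ?E (w k)) \<in> char_lattice N w"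
      by (rule char_lattice_cong)
         (use iN j w_eq in \<open>simp add: lookup_add lookup_minus unit_at_def\<close>)
    moreover have "Poly_Mapping.keys ?E \<subseteq> rays \<Sigma>"
    proof -
      have "?E \<in> carrier (WDiv \<Sigma>)"
        unfolding WDiv_def using iN j(1) keys_add keys_diff keys_cmul
        by (auto simp: range dest!: subsetD[OF keys_diff] subsetD[OF keys_add])
      then show ?thesis by (simp add: WDiv_def)
    qed
    ultimately have "?E \<in> principal_divisors \<Sigma>" using principal_iff_char_lattice[OF range] by blast
    moreover have "block_class \<Sigma> p = div_class \<Sigma> (frag_of (w i) + frag_of (w (i+d+1)))"
      using block_class_union[OF fin, of p] i iN ne by (auto simp: range)
    ultimately show ?thesis by (simp add: div_class_eq_iff j(2))
  qed
  then have "\<mu> = image_mset (\<lambda>_. div_class \<Sigma> (frag_cmul 2 (frag_of (u 0)))) (mset_set P)"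
    unfolding P(4) multidegree_def using P(3) by (intro image_mset_cong) (metis Suc_eq_plus1 card.infinite elem_mset_set nat.distinct(1))
  also have "\<dots> = replicate_mset (d + 1) (div_class \<Sigma> (frag_cmul 2 (frag_of (u 0))))"
    by (simp add: image_mset_const_eq P(3))
  finally show "circuit (num_rays d) (\<lambda>_. 1) u \<and> \<Sigma> = proper_cones (num_rays d) u \<and>
      \<mu> = replicate_mset (d + 1) (div_class \<Sigma> (frag_cmul 2 (frag_of (u 0))))"
    using circ \<Sigma> unfolding N_def by blast
qed

section \<open>Fans with a prescribed paired lattice\<close>

text \<open>A triangular basis: among the vectors whose coordinates beyond \<open>k\<close> vanish there is one whose
  \<open>k\<close>-th coordinate divides that of all others. This coordinate can be taken to be \<open>1\<close> if some
  \<open>k\<close>-th coordinate is odd, and otherwise \<open>2\<close>, by \<open>2 e\<^sub>k - 2 e\<^sub>0\<close>. The coordinate at \<open>0\<close> is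
  determined by the others.\<close>

lemma paired_lattice_basis:
  assumes K: "paired_lattice d K"
  shows "\<exists>b. (\<forall>k\<in>{1..<num_rays d}. b k \<in> K) \<and>
    (\<forall>x\<in>K. \<exists>z. \<forall>i<num_rays d. x i = (\<Sum>k\<in>{1..<num_rays d}. z k * b k i))"
proof -
  define N where "N = num_rays d"
  have N0: "0 < N" by (simp add: N_def num_rays_def)
  define V where "V k = {x \<in> K. \<forall>j. k < j \<and> j < N \<longrightarrow> x j = 0}" for k
  have twice: "(\<lambda>j. 2 * unit_at k j - 2 * unit_at 0 j) \<in> V k" if "1 \<le> k" "k < N" for k
    using paired_lattice_twice[OF K, of k 0] that N0 by (auto simp: V_def unit_at_def N_def)
  have "\<exists>b. b \<in> V k \<and> (\<forall>x\<in>V k. b k dvd x k)" if k: "1 \<le> k" "k < N" for k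
  proof (cases "\<exists>x\<in>V k. odd (x k)")
    case True
    then obtain x where x: "x \<in> V k" "odd (x k)" by blast
    \<comment> \<open>Subtracting a multiple of \<open>2 e\<^sub>k - 2 e\<^sub>0\<close> reduces the odd coordinate at \<open>k\<close> to \<open>1\<close>.\<close>
    define b where "b j = x j - (x k div 2) * (2 * unit_at k j - 2 * unit_at 0 j)" for j
    have "b \<in> V k"
      using x(1) twice[OF k] paired_lattice_diff[OF K _ paired_lattice_scale[OF K]]
      by (auto simp: V_def b_def[abs_def])
    moreover have "b k = 1" using x(2) k by (auto simp: b_def unit_at_def minus_div_mult_eq_mod elim!: oddE)
    ultimately show ?thesis by (intro exI[of _ b]) auto
  next
    case False
    then have "\<forall>x\<in>V k. (2 * unit_at k k - 2 * unit_at 0 k) dvd x k" using k by (auto simp: unit_at_def)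
    then show ?thesis using twice[OF k] by blast
  qed
  then obtain b where b: "\<And>k. 1 \<le> k \<Longrightarrow> k < N \<Longrightarrow> b k \<in> V k"
    "\<And>k x. 1 \<le> k \<Longrightarrow> k < N \<Longrightarrow> x \<in> V k \<Longrightarrow> b k k dvd x k" by metis
  have bK: "b k \<in> K" if "k \<in> {1..<N}" for k using b(1)[of k] that by (auto simp: V_def)
  have "\<exists>z. \<forall>i<N. x i = (\<Sum>k\<in>{1..<Suc m}. z k * b k i)" if "m < N" "x \<in> V m" for m x
    using that
  proof (induction m arbitrary: x)
    case 0
    have "x i = 0" if "i < N" for i
    proof (cases "i = 0")
      case True
      have "(\<Sum>i<N. x i) = (\<Sum>i\<in>{0}. x i)"
        by (rule sum.mono_neutral_right) (use 0 in \<open>auto simp: V_def\<close>)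
      then show ?thesis using paired_lattice_sum_eq_0[OF K, of x] 0 True by (simp add: V_def N_def)
    next
      case False
      then show ?thesis using 0 that by (auto simp: V_def)
    qed
    then show ?case by simp
  next
    case (Suc m)
    obtain q where q: "x (Suc m) = b (Suc m) (Suc m) * q"
      using b(2)[of "Suc m" x] Suc.prems by (auto elim: dvdE)
    define y where "y j = x j - q * b (Suc m) j" for j
    have "y \<in> V m"
    proof -
      have "y \<in> K"
        using paired_lattice_diff[OF K _ paired_lattice_scale[OF K bK]] Suc.prems
        by (auto simp: y_def[abs_def] V_def)
      moreover have "y j = 0" if "m < j" "j < N" for j
        using that Suc.prems b(1)[of "Suc m"] q by (cases "j = Suc m") (auto simp: y_def V_def)
      ultimately show ?thesis by (auto simp: V_def)
    qed
    then obtain z where z: "\<forall>i<N. y i = (\<Sum>k\<in>{1..<Suc m}. z k * b k i)" using Suc by auto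
    have "x i = (\<Sum>k\<in>{1..<Suc (Suc m)}. (z(Suc m := q)) k * b k i)" if "i < N" for i
    proof -
      have "(\<Sum>k\<in>{1..<Suc (Suc m)}. (z(Suc m := q)) k * b k i)
          = (\<Sum>k\<in>{1..<Suc m}. (z(Suc m := q)) k * b k i) + q * b (Suc m) i"
        by (simp add: sum.atLeastLessThan_Suc)
      also have "(\<Sum>k\<in>{1..<Suc m}. (z(Suc m := q)) k * b k i) = (\<Sum>k\<in>{1..<Suc m}. z k * b k i)"
        by (rule sum.cong) auto
      also have "\<dots> = y i" using z that by simp
      finally show ?thesis by (simp add: y_def)
    qed
    then show ?case by blast
  qed
  note expand = this
  have "\<exists>z. \<forall>i<N. x i = (\<Sum>k\<in>{1..<N}. z k * b k i)" if "x \<in> K" for x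
  proof -
    have "x \<in> V (N - 1)" using that by (auto simp: V_def)
    then show ?thesis using expand[of "N - 1" x] N0 by simp
  qed
  then show ?thesis using bK unfolding N_def by blast
qed

text \<open>The vectors \<open>u\<^sub>i\<close> are the rows of the matrix whose columns form a basis of \<open>K\<close>; the characters
  then evaluate to the integer combinations of the columns.\<close>

lemma paired_lattice_realization:
  assumes K: "paired_lattice d K" and n: "CARD('n::finite) = d + (d + 1)"
  shows "\<exists>u :: nat \<Rightarrow> real ^ 'n. (\<forall>i. u i \<in> int_lattice) \<and> char_lattice (num_rays d) u = K"
proof -
  define N where "N = num_rays d"
  obtain b where b: "\<And>k. k \<in> {1..<N} \<Longrightarrow> b k \<in> K"
    "\<And>x. x \<in> K \<Longrightarrow> \<exists>z. \<forall>i<N. x i = (\<Sum>k\<in>{1..<N}. z k * b k i)"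
    using paired_lattice_basis[OF K] unfolding N_def by blast
  obtain g :: "'n \<Rightarrow> nat" where g: "bij_betw g UNIV {1..<N}"
    using finite_same_card_bij[of "UNIV :: 'n set" "{1..<N}"] n by (auto simp: N_def num_rays_def)
  define u :: "nat \<Rightarrow> real ^ 'n" where "u i = (\<chi> c. real_of_int (b (g c) i))" for i
  have ulat: "u i \<in> int_lattice" for i by (simp add: u_def int_lattice_def)
  have inner: "inner m (u i) = real_of_int (\<Sum>k\<in>{1..<N}. z k * b k i)"
    if m: "\<And>c. vec_nth m c = real_of_int (z (g c))" for m z i
  proof -
    have "inner m (u i) = (\<Sum>c\<in>UNIV. real_of_int (z (g c) * b (g c) i))"
      by (simp add: inner_vec_def m u_def)
    also have "\<dots> = (\<Sum>k\<in>{1..<N}. real_of_int (z k * b k i))"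
      by (rule sum.reindex_bij_betw[OF g])
    finally show ?thesis by simp
  qed
  have "x \<in> K" if x: "x \<in> char_lattice N u" for x
  proof -
    obtain m where m: "m \<in> int_lattice" "\<forall>i<N. real_of_int (x i) = inner m (u i)"
      using x by (auto simp: char_lattice_def)
    define z where "z k = \<lfloor>vec_nth m (inv_into UNIV g k)\<rfloor>" for k
    have "vec_nth m c = real_of_int (z (g c))" for c
      using m(1) g by (auto simp: z_def int_lattice_def bij_betw_def elim: Ints_cases)
    then have "real_of_int (x i) = real_of_int (\<Sum>k\<in>{1..<N}. z k * b k i)" if "i < N" for i
      using m(2) that inner[of m z i] by simp
    then have eq: "x i = (\<Sum>k\<in>{1..<N}. z k * b k i)" if "i < N" for i using that of_int_eq_iff by blast
    have "(\<lambda>i. \<Sum>k\<in>{1..<N}. z k * b k i) \<in> K" by (rule paired_lattice_lincomb[OF K]) (use b in auto)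
    then show ?thesis by (rule paired_lattice_cong[OF K]) (use eq in \<open>auto simp: N_def\<close>)
  qed
  moreover have "x \<in> char_lattice N u" if x: "x \<in> K" for x
  proof -
    obtain z where z: "\<forall>i<N. x i = (\<Sum>k\<in>{1..<N}. z k * b k i)" using b(2)[OF x] by blast
    define m :: "real ^ 'n" where "m = (\<chi> c. real_of_int (z (g c)))"
    have "m \<in> int_lattice" by (simp add: m_def int_lattice_def)
    moreover have "\<forall>i<N. real_of_int (x i) = inner m (u i)"
      using z inner[of m z] by (simp add: m_def)
    ultimately show ?thesis by (auto simp: char_lattice_def)
  qed
  ultimately show ?thesis using ulat unfolding N_def by blast
qed

context
  fixes d :: nat and u :: "nat \<Rightarrow> real ^ 'n"
  assumes n: "CARD('n) = d + (d + 1)"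
    and ulat: "\<And>i. u i \<in> int_lattice"
    and K: "paired_lattice d (char_lattice (num_rays d) u)"
begin

text \<open>Evaluate the relation at a character with values \<open>2\<close> at \<open>i\<close> and \<open>-2\<close> at \<open>0\<close>.\<close>

lemma realization_relation_const:
  assumes c: "(\<Sum>i<num_rays d. c i *\<^sub>R u i) = 0" and i: "i < num_rays d"
  shows "c i = c 0"
proof -
  have 0: "0 < num_rays d" by (simp add: num_rays_def)
  obtain m where m: "\<forall>k<num_rays d. real_of_int (2 * unit_at i k - 2 * unit_at 0 k) = inner m (u k)"
    using paired_lattice_twice[OF K i 0] by (auto simp: char_lattice_def)
  have "0 = inner m (\<Sum>k<num_rays d. c k *\<^sub>R u k)" using c by simp
  also have "\<dots> = (\<Sum>k<num_rays d. c k * real_of_int (2 * unit_at i k - 2 * unit_at 0 k))"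
    unfolding inner_sum_right by (rule sum.cong) (use m in auto)
  also have "\<dots> = (\<Sum>k<num_rays d. 2 * (c k * of_int (unit_at i k))) - (\<Sum>k<num_rays d. 2 * (c k * of_int (unit_at 0 k)))"
    by (simp add: algebra_simps flip: sum_subtractf)
  also have "\<dots> = 2 * c i - 2 * c 0"
    unfolding sum_distrib_left[symmetric] using i 0 by (simp add: sum_unit_at)
  finally show ?thesis by simp
qed

lemma realization_inj: "inj_on u {..<num_rays d}"
proof (rule inj_onI)
  fix i j assume ij: "i \<in> {..<num_rays d}" "j \<in> {..<num_rays d}" "u i = u j"
  show "i = j"
  proof (rule ccontr)
    assume ne: "i \<noteq> j"
    define c where "c k = (if k = i then 1 else 0) - (if k = j then 1 else 0 :: real)" for k
    have "(\<Sum>k<num_rays d. c k *\<^sub>R u k) = u i - u j"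
      using ij by (simp add: c_def scaleR_diff_left sum_subtractf if_distrib[of "\<lambda>x. x *\<^sub>R _"] cong: if_cong)
    then have "(\<Sum>k<num_rays d. c k *\<^sub>R u k) = 0" using ij(3) by simp
    from realization_relation_const[OF this] have "c i = c j" using ij by (metis lessThan_iff)
    then show False using ne by (simp add: c_def)
  qed
qed

lemma realization_circuit: "circuit (num_rays d) (\<lambda>_. 1) u"
proof -
  let ?N = "num_rays d"
  have "vec_nth (\<Sum>i<?N. u i) c = 0" for c
  proof -
    define x where "x i = \<lfloor>vec_nth (u i) c\<rfloor>" for i
    have x: "real_of_int (x i) = vec_nth (u i) c" for i
      using ulat[of i] by (auto simp: x_def int_lattice_def elim: Ints_cases)
    have "axis c 1 \<in> int_lattice" by (simp add: int_lattice_def axis_def)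
    moreover have "real_of_int (x i) = inner (axis c 1) (u i)" for i by (simp add: x inner_axis')
    ultimately have "x \<in> char_lattice ?N u" by (auto simp: char_lattice_def)
    from paired_lattice_sum_eq_0[OF K this] have "(\<Sum>i<?N. real_of_int (x i)) = 0" by (simp flip: of_int_sum)
    then show ?thesis by (simp add: x)
  qed
  then have sum: "(\<Sum>i<?N. u i) = 0" by (simp add: Finite_Cartesian_Product.vec_eq_iff)
  have rel: "\<exists>t. \<forall>i<?N. c i = t" if "(\<Sum>i<?N. c i *\<^sub>R u i) = 0" for c
    using realization_relation_const[OF that] by blast
  have inj: "inj_on u {1..<?N}" by (rule inj_on_subset[OF realization_inj]) auto
  have "independent (u ` {1..<?N})"
    by (rule constant_relations_independent[OF realization_inj]) (rule realization_relation_const)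
  moreover have "card (u ` {1..<?N}) = CARD('n)"
    using card_image[OF inj] n by (simp add: num_rays_def)
  ultimately have "UNIV \<subseteq> span (u ` {1..<?N})"
    by (intro card_ge_dim_independent) auto
  have "\<exists>c. x = (\<Sum>i<?N. c i *\<^sub>R u i)" for x
  proof -
    have "u ` {1..<?N} \<subseteq> u ` {..<?N}" by auto
    then have "x \<in> span (u ` {..<?N})"
      using \<open>UNIV \<subseteq> span (u ` {1..<?N})\<close> span_mono by blast
    then obtain g where "x = (\<Sum>v\<in>u ` {..<?N}. g v *\<^sub>R v)"
      unfolding span_finite[OF finite_imageI[OF finite_lessThan]] by blast
    then have "x = (\<Sum>i<?N. g (u i) *\<^sub>R u i)" by (simp add: sum.reindex[OF realization_inj])
    then show ?thesis by (rule exI[where x = "\<lambda>i. g (u i)"])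
  qed
  then show ?thesis using sum rel by (simp add: circuit_def)
qed

text \<open>Some character takes the value \<open>1\<close> or \<open>-1\<close> on \<open>u\<^sub>i\<close>, by the pairing.\<close>

lemma realization_primitive:
  assumes i: "i < num_rays d"
  shows "primitive (u i)"
proof -
  obtain j where j: "j \<le> d" "i = j \<or> i = j+d+1"
    using i by (intro that[of "if i \<le> d then i else i - d - 1"]) (auto simp: num_rays_def)
  obtain m where m: "m \<in> int_lattice"
    "\<forall>k<num_rays d. real_of_int (unit_at j k - unit_at (j+d+1) k) = inner m (u k)"
    using paired_lattice_pair[OF K j(1)] by (auto simp: char_lattice_def)
  have "inner m (u i) = real_of_int (unit_at j i - unit_at (j+d+1) i)" using m(2) i by metis
  then have abs: "\<bar>inner m (u i)\<bar> = 1" using j by (auto simp: unit_at_def)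
  show ?thesis
    unfolding primitive_def
  proof (intro conjI ballI allI impI)
    show "u i \<noteq> 0" using abs by auto
    fix v k assume v: "v \<in> int_lattice" "u i = real k *\<^sub>R v"
    obtain z where z: "inner m v = real_of_int z" using int_lattice_inner_ints[OF m(1) v(1)] by blast
    have "\<bar>real_of_int (int k * z)\<bar> = 1" using abs v(2) z by simp
    then have "\<bar>int k * z\<bar> = 1" by (simp only: of_int_abs[symmetric] of_int_eq_1_iff)
    then have "int k dvd 1" by (metis dvd_abs_iff dvd_triv_left)
    then show "k = 1" by simp
  qed (rule ulat)
qed

lemma realization_N: "num_rays d = CARD('n) + 1"
  using n by (simp add: num_rays_def)

lemma realization_complete_fan: "complete_fan (proper_cones (num_rays d) u)"
  by (rule proper_cones_complete_fan[OF realization_circuit realization_N]) (rule ulat)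

lemma realization_rays: "rays (proper_cones (num_rays d) u) = u ` {..<num_rays d}"
  by (rule rays_proper_cones[OF realization_circuit realization_N]) (rule realization_primitive)

text \<open>Every cone of the fan omits some ray \<open>u\<^sub>j\<close>.\<close>

lemma realization_Cartier:
  assumes keys: "Poly_Mapping.keys D \<subseteq> u ` {..<num_rays d}"
    and local: "\<And>j. j < num_rays d \<Longrightarrow> \<exists>x\<in>char_lattice (num_rays d) u.
      \<forall>i<num_rays d. i \<noteq> j \<longrightarrow> x i = Poly_Mapping.lookup D (u i)"
  shows "Cartier (proper_cones (num_rays d) u) D"
  unfolding Cartier_iff realization_rays
proof (intro conjI ballI)
  let ?N = "num_rays d"
  fix \<sigma> assume "\<sigma> \<in> proper_cones ?N u"
  then obtain I where I: "I \<subset> {..<?N}" "\<sigma> = convex_cone hull (u ` I)" by (auto simp: proper_cones_def)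
  then obtain j where j: "j < ?N" "j \<notin> I" by auto
  obtain x m where x: "m \<in> int_lattice" "\<forall>i<?N. real_of_int (x i) = inner m (u i)"
    "\<forall>i<?N. i \<noteq> j \<longrightarrow> x i = Poly_Mapping.lookup D (u i)"
    using local[OF j(1)] by (auto simp: char_lattice_def)
  have "real_of_int (Poly_Mapping.lookup D v) = inner m v" if v: "v \<in> u ` {..<?N} \<inter> \<sigma>" for v
  proof -
    obtain i where i: "i < ?N" "v = u i" using v by auto
    then have "i \<in> I"
      using v mem_cone_generator_iff[OF realization_circuit realization_N I(1) i(1)] I(2) by auto
    then have "i \<noteq> j" using j by auto
    then show ?thesis using x i by metis
  qed
  then show "\<exists>m\<in>int_lattice. \<forall>v\<in>u ` {..<?N} \<inter> \<sigma>. real_of_int (Poly_Mapping.lookup D v) = inner m v"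
    using x(1) by blast
qed (fact keys)

lemma realization_even_mem:
  assumes "(\<Sum>i<num_rays d. x i) = 0" "\<And>i. i < num_rays d \<Longrightarrow> even (x i)"
  shows "x \<in> char_lattice (num_rays d) u"
  by (rule paired_lattice_parity[OF K paired_lattice_zero[OF K]]) (use assms in auto)

text \<open>An even divisor becomes principal after a change of its multiplicity along \<open>u\<^sub>j\<close> that makes its
  degree zero.\<close>

lemma realization_even_Cartier:
  assumes keys: "Poly_Mapping.keys D \<subseteq> u ` {..<num_rays d}"
    and even: "\<And>v. even (Poly_Mapping.lookup D v)"
  shows "Cartier (proper_cones (num_rays d) u) D"
proof (rule realization_Cartier[OF keys])
  let ?N = "num_rays d"
  fix j assume j: "j < ?N"
  define x where "x i = Poly_Mapping.lookup D (u i) - (\<Sum>k<?N. Poly_Mapping.lookup D (u k)) * unit_at j i" for i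
  have "x \<in> char_lattice ?N u"
  proof (rule realization_even_mem)
    show "(\<Sum>i<?N. x i) = 0"
      using j by (simp add: x_def sum_subtractf sum_unit_at_int flip: sum_distrib_left)
    show "even (x i)" if "i < ?N" for i using even by (simp add: x_def dvd_sum)
  qed
  then show "\<exists>x\<in>char_lattice ?N u. \<forall>i<?N. i \<noteq> j \<longrightarrow> x i = Poly_Mapping.lookup D (u i)"
    by (rule bexI[rotated]) (simp add: x_def unit_at_def)
qed

lemma realization_principal_iff:
  assumes "Poly_Mapping.keys D \<subseteq> u ` {..<num_rays d}"
  shows "D \<in> principal_divisors (proper_cones (num_rays d) u) \<longleftrightarrow>
    (\<lambda>i. Poly_Mapping.lookup D (u i)) \<in> char_lattice (num_rays d) u"
  using principal_iff_char_lattice[OF realization_rays] assms realization_rays by simp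

lemma realization_Q_factorial: "Q_factorial (proper_cones (num_rays d) u)"
  unfolding Q_factorial_def WDiv_def realization_rays
proof
  fix D assume D: "D \<in> carrier (free_Abelian_group (u ` {..<num_rays d}))"
  have "Cartier (proper_cones (num_rays d) u) (frag_cmul 2 D)"
    by (rule realization_even_Cartier) (use D in auto)
  then show "\<exists>k>0. Cartier (proper_cones (num_rays d) u) (frag_cmul k D)" by (intro exI[of _ 2]) simp
qed

lemma realization_anticanonical_lookup:
  "i < num_rays d \<Longrightarrow> Poly_Mapping.lookup (\<Sum>v\<in>u ` {..<num_rays d}. frag_of v) (u i) = 1"
  by (simp add: lookup_sum)

text \<open>On the maximal cone omitting \<open>u\<^sub>j\<close>, twice the anticanonical divisor is given by the character with value
  \<open>-2\<close> on the rays of the cone; its value on \<open>u\<^sub>j\<close> is \<open>2N - 2\<close>, as the degree is zero.\<close>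

lemma realization_Fano: "Fano (proper_cones (num_rays d) u)"
  unfolding Fano_def realization_rays
proof (intro conjI exI[of _ 2])
  let ?N = "num_rays d" and ?\<Sigma> = "proper_cones (num_rays d) u"
  let ?D = "frag_cmul 2 (\<Sum>v\<in>u ` {..<?N}. frag_of v)"
  show "complete_fan ?\<Sigma>" by (rule realization_complete_fan)
  have lookup: "Poly_Mapping.lookup ?D (u i) = 2" if "i < ?N" for i
    using realization_anticanonical_lookup[OF that] by simp
  show "ample ?\<Sigma> ?D"
    unfolding ample_def realization_rays
  proof (intro conjI ballI impI)
    show "complete_fan ?\<Sigma>" by (rule realization_complete_fan)
    have "(\<Sum>v\<in>u ` {..<?N}. frag_of v) \<in> carrier (free_Abelian_group (u ` {..<?N}))"
      by (rule sum_closed_free_Abelian_group) simp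
    then show "Cartier ?\<Sigma> ?D" by (intro realization_even_Cartier) auto
  next
    fix \<sigma> assume \<sigma>: "\<sigma> \<in> ?\<Sigma>" "interior \<sigma> \<noteq> {}"
    then obtain I where I: "I \<subset> {..<?N}" "\<sigma> = convex_cone hull (u ` I)" by (auto simp: proper_cones_def)
    then obtain j where j: "j < ?N" "j \<notin> I" by auto
    have in_I: "i \<in> I" if i: "i < ?N" "i \<noteq> j" for i
      using cone_interior_empty[OF realization_circuit realization_N, of I i j] I j i \<sigma>(2) by auto
    \<comment> \<open>The only vector with value \<open>-2\<close> off \<open>j\<close> and coordinate sum zero.\<close>
    define x where "x i = 2 * int ?N * unit_at j i - 2" for i
    have "x \<in> char_lattice ?N u"
      by (rule realization_even_mem)
        (use j in \<open>simp_all add: x_def sum_subtractf sum_unit_at_int flip: sum_distrib_left\<close>)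
    then obtain m where m: "m \<in> int_lattice" "\<forall>i<?N. real_of_int (x i) = inner m (u i)"
      by (auto simp: char_lattice_def)
    have "inner m v = - real_of_int (Poly_Mapping.lookup ?D v)" if v: "v \<in> u ` {..<?N} \<inter> \<sigma>" for v
    proof -
      obtain i where i: "i < ?N" "v = u i" using v by auto
      then have "i \<in> I"
        using v mem_cone_generator_iff[OF realization_circuit realization_N I(1) i(1)] I(2) by auto
      then have "x i = - 2" using j by (auto simp: x_def unit_at_def)
      then show ?thesis using m(2) i lookup[OF i(1)] by (metis of_int_minus)
    qed
    moreover have "- real_of_int (Poly_Mapping.lookup ?D v) < inner m v" if v: "v \<in> u ` {..<?N} - \<sigma>" for v
    proof -
      obtain i where i: "i < ?N" "v = u i" using v by auto
      have "i \<notin> I" using v i I(2) by (auto intro: hull_inc)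
      then have "i = j" using in_I i(1) by blast
      then have "x i = 2 * int ?N - 2" by (simp add: x_def unit_at_def)
      then have "- 2 < x i" using j by simp
      then have "real_of_int (- 2) < real_of_int (x i)" by (simp only: of_int_less_iff)
      then show ?thesis using m(2) i lookup[OF i(1)] by (metis of_int_minus)
    qed
    ultimately show "\<exists>m\<in>int_lattice.
        (\<forall>v\<in>u ` {..<?N} \<inter> \<sigma>. inner m v = - real_of_int (Poly_Mapping.lookup ?D v)) \<and>
        (\<forall>v\<in>u ` {..<?N} - \<sigma>. - real_of_int (Poly_Mapping.lookup ?D v) < inner m v)"
      using m(1) by blast
  qed
qed simp

text \<open>Twice a divisor of degree zero is principal, and two divisors always have a nontrivial combination
  of degree zero. A divisor of nonzero degree is not torsion.\<close>

lemma realization_Picard_number: "abelian_rank (Pic (proper_cones (num_rays d) u)) = 1"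
proof (rule order_antisym)
  let ?N = "num_rays d" and ?\<Sigma> = "proper_cones (num_rays d) u"
  define deg :: "((real ^ 'n) \<Rightarrow>\<^sub>0 int) \<Rightarrow> int" where "deg D = (\<Sum>i<?N. Poly_Mapping.lookup D (u i))" for D
  show "abelian_rank (Pic ?\<Sigma>) \<le> 1"
    unfolding Picard_number_le_1_iff
  proof (intro allI impI)
    fix D E assume "Cartier ?\<Sigma> D" "Cartier ?\<Sigma> E"
    then have keys: "Poly_Mapping.keys D \<subseteq> u ` {..<?N}" "Poly_Mapping.keys E \<subseteq> u ` {..<?N}"
      by (auto simp: Cartier_iff realization_rays)
    have principal: "frag_cmul (2 * a) D + frag_cmul (2 * b) E \<in> principal_divisors ?\<Sigma>"
      if "a * deg D + b * deg E = 0" for a b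
    proof -
      have keys': "Poly_Mapping.keys (frag_cmul (2 * a) D + frag_cmul (2 * b) E) \<subseteq> u ` {..<?N}"
        using keys keys_add[of "frag_cmul (2 * a) D" "frag_cmul (2 * b) E"] by auto
      have "(\<Sum>i<?N. Poly_Mapping.lookup (frag_cmul (2 * a) D + frag_cmul (2 * b) E) (u i))
          = 2 * (a * deg D + b * deg E)"
        by (simp add: lookup_add deg_def sum.distrib sum_distrib_left algebra_simps)
      then show ?thesis
        using that by (subst realization_principal_iff[OF keys']) (auto intro!: realization_even_mem simp: lookup_add)
    qed
    show "\<exists>a b. (a \<noteq> 0 \<or> b \<noteq> 0) \<and> frag_cmul a D + frag_cmul b E \<in> principal_divisors ?\<Sigma>"
    proof (cases "deg D = 0 \<and> deg E = 0")
      case True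
      then show ?thesis using principal[of 1 0] by (intro exI[of _ 2] exI[of _ 0]) simp
    next
      case False
      then show ?thesis using principal[of "deg E" "- deg D"]
        by (intro exI[of _ "2 * deg E"] exI[of _ "2 * (- deg D)"]) (auto simp: mult.commute)
    qed
  qed
  have 0: "0 < ?N" by (simp add: num_rays_def)
  show "1 \<le> abelian_rank (Pic ?\<Sigma>)"
  proof (rule Picard_number_ge_1)
    show "Cartier ?\<Sigma> (frag_cmul 2 (frag_of (u 0)))"
      by (rule realization_even_Cartier) (use 0 in auto)
    fix a assume *: "frag_cmul a (frag_cmul 2 (frag_of (u 0))) \<in> principal_divisors ?\<Sigma>"
    have keys: "Poly_Mapping.keys (frag_cmul a (frag_cmul 2 (frag_of (u 0)))) \<subseteq> u ` {..<?N}"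
      using * by (simp only: principal_iff realization_rays)
    have mem: "(\<lambda>i. Poly_Mapping.lookup (frag_cmul a (frag_cmul 2 (frag_of (u 0)))) (u i)) \<in> char_lattice ?N u"
      using * realization_principal_iff[OF keys] by blast
    have "(\<Sum>i<?N. Poly_Mapping.lookup (frag_cmul a (frag_cmul 2 (frag_of (u 0)))) (u i))
        = (\<Sum>i<?N. (if i = 0 then 2 * a else 0))"
    proof (rule sum.cong)
      fix i assume "i \<in> {..<?N}"
      then have "u i = u 0 \<longleftrightarrow> i = 0" using realization_inj 0 by (auto simp: inj_on_def)
      then show "Poly_Mapping.lookup (frag_cmul a (frag_cmul 2 (frag_of (u 0)))) (u i) = (if i = 0 then 2 * a else 0)"
        by simp
    qed simp
    then show "a = 0" using paired_lattice_sum_eq_0[OF K mem] 0 by simp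
  qed
qed

lemma realization_fwps: "fwps (proper_cones (num_rays d) u)"
  using realization_complete_fan realization_Q_factorial realization_Fano realization_Picard_number
  by (auto simp: fwps_def complete_fan_def)

text \<open>The class of a block has degree two, which distinguishes it from the classes of prime divisors.\<close>

lemma realization_nef_partition:
  defines "P \<equiv> (\<lambda>i. {u i, u (i+d+1)}) ` {..d}"
  shows "nef_partition (proper_cones (num_rays d) u) P \<and> card P = d + 1"
proof
  let ?N = "num_rays d" and ?\<Sigma> = "proper_cones (num_rays d) u"
  have iN: "i < ?N" "i+d+1 < ?N" if "i \<le> d" for i using that by (auto simp: num_rays_def)
  have u_eq: "u i = u j \<longleftrightarrow> i = j" if "i < ?N" "j < ?N" for i j
    using realization_inj that by (auto simp: inj_on_def)
  have blocks: "i = j" if "i \<le> d" "j \<le> d" "v \<in> {u i, u (i+d+1)}" "v \<in> {u j, u (j+d+1)}" for i j v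
    using that u_eq[OF iN(1) iN(1)] u_eq[OF iN(1) iN(2)] u_eq[OF iN(2) iN(1)] u_eq[OF iN(2) iN(2)]
    by (auto simp del: add_Suc_right)
  have inj: "inj_on (\<lambda>i. {u i, u (i+d+1)}) {..d}"
    by (rule inj_onI) (metis atMost_iff blocks insertI1)
  show "card P = d + 1" unfolding P_def card_image[OF inj] by simp
  have "partition_on (u ` {..<?N}) P"
  proof (rule partition_onI)
    have "u ` {..<?N} = u ` {..d} \<union> (\<lambda>i. u (i+d+1)) ` {..d}"
      by (simp add: num_rays_two_halves image_Un image_image)
    then show "\<Union>P = u ` {..<?N}" by (auto simp: P_def)
    show "{} \<notin> P" by (auto simp: P_def)
    fix p q assume "p \<in> P" "q \<in> P" "p \<noteq> q"
    then show "disjnt p q" unfolding P_def disjnt_iff using blocks by blast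
  qed
  moreover have "block_class ?\<Sigma> p \<in> carrier (Pic ?\<Sigma>) \<and>
      (\<forall>v\<in>rays ?\<Sigma>. block_class ?\<Sigma> p \<noteq> div_class ?\<Sigma> (frag_of v))" if p: "p \<in> P" for p
  proof -
    obtain i where i: "i \<le> d" "p = {u i, u (i+d+1)}" using p by (auto simp: P_def)
    define D where "D = frag_of (u i) + frag_of (u (i+d+1))"
    have ne: "u i \<noteq> u (i+d+1)" using u_eq[OF iN[OF i(1)]] by simp
    have bc: "block_class ?\<Sigma> p = div_class ?\<Sigma> D"
      using block_class_eq[of p ?\<Sigma>] i iN[OF i(1)] ne by (auto simp: realization_rays D_def)
    have keys: "Poly_Mapping.keys D \<subseteq> u ` {..<?N}"
      using keys_add[of "frag_of (u i)" "frag_of (u (i+d+1))"] iN[OF i(1)] by (auto simp: D_def)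
    have lookup: "Poly_Mapping.lookup D (u k) = unit_at i k + unit_at (i+d+1) k" if "k < ?N" for k
      using u_eq[OF that iN(1)[OF i(1)]] u_eq[OF that iN(2)[OF i(1)]] by (simp add: D_def lookup_add unit_at_def)
    have "Cartier ?\<Sigma> D"
    proof (rule realization_Cartier[OF keys])
      fix j assume j: "j < ?N"
      have "(\<lambda>k. unit_at i k + unit_at (i+d+1) k - 2 * unit_at j k) \<in> char_lattice ?N u"
        by (rule paired_lattice_parity[OF K paired_lattice_pair[OF K i(1)]])
           (use iN[OF i(1)] j in \<open>auto simp: sum.distrib sum_subtractf sum_unit_at_int simp flip: sum_distrib_left\<close>)
      then show "\<exists>x\<in>char_lattice ?N u. \<forall>k<?N. k \<noteq> j \<longrightarrow> x k = Poly_Mapping.lookup D (u k)"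
        by (rule bexI[rotated]) (use lookup in \<open>auto simp: unit_at_def\<close>)
    qed
    moreover have "block_class ?\<Sigma> p \<noteq> div_class ?\<Sigma> (frag_of v)" if v: "v \<in> rays ?\<Sigma>" for v
    proof
      assume "block_class ?\<Sigma> p = div_class ?\<Sigma> (frag_of v)"
      then have pr: "D - frag_of v \<in> principal_divisors ?\<Sigma>" by (simp add: bc div_class_eq_iff)
      obtain j where j: "j < ?N" "v = u j" using v by (auto simp: realization_rays)
      have keys': "Poly_Mapping.keys (D - frag_of v) \<subseteq> u ` {..<?N}"
        using pr by (simp only: principal_iff realization_rays)
      have mem: "(\<lambda>k. Poly_Mapping.lookup (D - frag_of v) (u k)) \<in> char_lattice ?N u"
        using pr realization_principal_iff[OF keys'] by blast
      have "(\<Sum>k<?N. Poly_Mapping.lookup (D - frag_of v) (u k)) = (\<Sum>k<?N. unit_at i k + unit_at (i+d+1) k - unit_at j k)"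
        by (rule sum.cong) (use lookup u_eq j in \<open>auto simp: lookup_minus unit_at_def\<close>)
      also have "\<dots> = 1" using iN[OF i(1)] j by (simp add: sum.distrib sum_subtractf sum_unit_at_int)
      finally show False using paired_lattice_sum_eq_0[OF K mem] by simp
    qed
    ultimately show ?thesis using bc by (auto simp: Pic_def)
  qed
  ultimately show "nef_partition ?\<Sigma> P" by (simp add: nef_partition_def realization_rays)
qed

end

lemma paired_lattice_has_cyci_pair:
  assumes K: "paired_lattice d K" and n: "CARD('n::finite) = d + (d + 1)"
  shows "\<exists>\<Sigma> \<mu> (u :: nat \<Rightarrow> real ^ 'n). (\<Sigma>, \<mu>) \<in> cyci_pairs (d + 1) \<and>
    bij_betw u {..<num_rays d} (rays \<Sigma>) \<and> char_lattice (num_rays d) u = K"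
proof -
  obtain u :: "nat \<Rightarrow> real ^ 'n" where u: "\<And>i. u i \<in> int_lattice" "char_lattice (num_rays d) u = K"
    using paired_lattice_realization[OF K n] by blast
  have K': "paired_lattice d (char_lattice (num_rays d) u)" using K u(2) by simp
  let ?\<Sigma> = "proper_cones (num_rays d) u" and ?P = "(\<lambda>i. {u i, u (i+d+1)}) ` {..d}"
  have "(?\<Sigma>, multidegree ?\<Sigma> ?P) \<in> cyci_pairs (d + 1)"
    unfolding cyci_pairs_def using realization_fwps[OF n u(1) K'] realization_nef_partition[OF n u(1) K'] by blast
  moreover have "bij_betw u {..<num_rays d} (rays ?\<Sigma>)"
    using realization_inj[OF n u(1) K'] realization_rays[OF n u(1) K'] by (simp add: bij_betw_def)
  ultimately show ?thesis using u(2) by blast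
qed

section \<open>Isomorphisms of fans\<close>

definition fan_labels :: "nat \<Rightarrow> 'n::finite cyci_pair \<Rightarrow> (nat \<Rightarrow> int) set set" where
  "fan_labels d = (\<lambda>(\<Sigma>, \<mu>).
     {char_lattice (num_rays d) u | u. bij_betw u {..<num_rays d} (rays \<Sigma>)})"

lemma char_lattice_permute:
  assumes p: "p permutes {..<N}"
  shows "char_lattice N (u \<circ> p) = permute_lattice p (char_lattice N u)"
proof (intro subset_antisym subsetI)
  fix x assume "x \<in> char_lattice N (u \<circ> p)"
  then obtain m where m: "m \<in> int_lattice" "\<forall>i<N. real_of_int (x i) = inner m (u (p i))"
    by (auto simp: char_lattice_def)
  have "real_of_int (x (inv_into UNIV p i)) = inner m (u i)" if "i < N" for i
    using m(2) that permutes_in_image[OF permutes_inv[OF p], of i] permutes_inverses(1)[OF p] by auto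
  then show "x \<in> permute_lattice p (char_lattice N u)"
    using m(1) by (auto simp: permute_lattice_def char_lattice_def)
next
  fix x assume "x \<in> permute_lattice p (char_lattice N u)"
  then obtain m where m: "m \<in> int_lattice" "\<forall>i<N. real_of_int (x (inv_into UNIV p i)) = inner m (u i)"
    by (auto simp: permute_lattice_def char_lattice_def)
  have "real_of_int (x i) = inner m (u (p i))" if "i < N" for i
    using m(2) that permutes_in_image[OF p, of i] permutes_inverses(2)[OF p, of i] by fastforce
  then show "x \<in> char_lattice N (u \<circ> p)"
    using m(1) by (auto simp: char_lattice_def)
qed

lemma char_lattice_family_cong: "(\<And>i. i < N \<Longrightarrow> u' i = u i) \<Longrightarrow> char_lattice N u' = char_lattice N u"
  by (simp add: char_lattice_def)

lemma fan_labels_orbit: "label_orbit (num_rays d) (fan_labels d a)"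
proof -
  obtain \<Sigma> \<mu> where a: "a = (\<Sigma>, \<mu>)" by (cases a)
  let ?N = "num_rays d"
  {
    fix u K' assume u: "bij_betw u {..<?N} (rays \<Sigma>)"
    have "K' \<in> fan_labels d a \<longleftrightarrow> (\<exists>p. p permutes {..<?N} \<and> K' = permute_lattice p (char_lattice ?N u))"
    proof
      assume "K' \<in> fan_labels d a"
      then obtain u' where u': "K' = char_lattice ?N u'" "bij_betw u' {..<?N} (rays \<Sigma>)"
        by (auto simp: a fan_labels_def)
      define p where "p i = (if i < ?N then the_inv_into {..<?N} u (u' i) else i)" for i
      have "bij_betw (the_inv_into {..<?N} u \<circ> u') {..<?N} {..<?N}"
        using u'(2) bij_betw_the_inv_into[OF u] by (rule bij_betw_trans)
      then have "bij_betw p {..<?N} {..<?N}"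
        by (rule bij_betw_cong[THEN iffD1, rotated]) (simp add: p_def)
      then have p: "p permutes {..<?N}" by (rule bij_imp_permutes) (simp add: p_def)
      have "u' i = (u \<circ> p) i" if "i < ?N" for i
      proof -
        have "u' i \<in> u ` {..<?N}" using u u'(2) that by (auto simp: bij_betw_def)
        then show ?thesis using u that by (simp add: p_def bij_betw_def f_the_inv_into_f)
      qed
      then have "K' = char_lattice ?N (u \<circ> p)" unfolding u'(1) by (rule char_lattice_family_cong)
      then show "\<exists>p. p permutes {..<?N} \<and> K' = permute_lattice p (char_lattice ?N u)"
        using p char_lattice_permute by blast
    next
      assume "\<exists>p. p permutes {..<?N} \<and> K' = permute_lattice p (char_lattice ?N u)"
      then obtain p where p: "p permutes {..<?N}" "K' = char_lattice ?N (u \<circ> p)"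
        using char_lattice_permute by blast
      have "bij_betw (u \<circ> p) {..<?N} (rays \<Sigma>)"
        using permutes_imp_bij[OF p(1)] u by (rule bij_betw_trans)
      with p(2) show "K' \<in> fan_labels d a" unfolding a fan_labels_def by blast
    qed
  }
  then show ?thesis by (auto simp: label_orbit_def a fan_labels_def)
qed

lemma fan_iso_inverse:
  assumes "fan_iso \<phi> \<Sigma> \<Sigma>'"
  shows "fan_iso (inv_into UNIV \<phi>) \<Sigma>' \<Sigma>"
proof -
  have \<phi>: "linear \<phi>" "bij \<phi>" "\<phi> ` int_lattice = int_lattice" "image \<phi> ` \<Sigma> = \<Sigma>'"
    using assms by (auto simp: fan_iso_def)
  have inv: "inv_into UNIV \<phi> (\<phi> x) = x" for x using \<phi>(2) by (simp add: bij_is_inj)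
  have img: "inv_into UNIV \<phi> ` \<phi> ` S = S" for S by (simp add: image_image inv)
  have "linear (inv_into UNIV \<phi>)"
    using \<phi>(1,2) by (metis bij_betw_def inj_linear_imp_inv_linear)
  moreover have "bij (inv_into UNIV \<phi>)" using \<phi>(2) by (rule bij_imp_bij_inv)
  moreover have "inv_into UNIV \<phi> ` int_lattice = int_lattice" using img[of int_lattice] \<phi>(3) by simp
  moreover have "image (inv_into UNIV \<phi>) ` \<Sigma>' = \<Sigma>" unfolding \<phi>(4)[symmetric] by (simp add: image_image inv)
  ultimately show ?thesis by (simp add: fan_iso_def)
qed

lemma fan_iso_rays_subset:
  assumes "fan_iso \<phi> \<Sigma> \<Sigma>'"
  shows "\<phi> ` rays \<Sigma> \<subseteq> rays \<Sigma>'"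
proof
  have \<phi>: "linear \<phi>" "bij \<phi>" "\<phi> ` int_lattice = int_lattice" "image \<phi> ` \<Sigma> = \<Sigma>'"
    using assms by (auto simp: fan_iso_def)
  fix v assume "v \<in> \<phi> ` rays \<Sigma>"
  then obtain u where u: "primitive u" "convex_cone hull {u} \<in> \<Sigma>" "v = \<phi> u" by (auto simp: rays_def)
  have "primitive v"
    unfolding primitive_def
  proof (intro conjI ballI allI impI)
    show "v \<in> int_lattice" using u \<phi>(3) by (auto simp: primitive_def)
    show "v \<noteq> 0" using u \<phi>(1,2) by (metis bij_is_inj injD linear_0 primitive_def)
  next
    fix w k assume "w \<in> int_lattice" "v = real k *\<^sub>R w"
    moreover from this obtain w' where w': "w' \<in> int_lattice" "w = \<phi> w'" using \<phi>(3) by blast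
    ultimately have "\<phi> u = \<phi> (real k *\<^sub>R w')" using u(3) \<phi>(1) by (simp add: linear_scale)
    then have "u = real k *\<^sub>R w'" using \<phi>(2) by (metis bij_is_inj injD)
    then show "k = 1" using u(1) w'(1) by (auto simp: primitive_def)
  qed
  moreover have "convex_cone hull {v} = \<phi> ` (convex_cone hull {u})"
    using convex_cone_hull_linear_image[OF \<phi>(1), of "{u}"] u(3) by simp
  then have "convex_cone hull {v} \<in> \<Sigma>'" using u(2) \<phi>(4) by blast
  ultimately show "v \<in> rays \<Sigma>'" by (simp add: rays_def)
qed

lemma fan_iso_rays:
  assumes "fan_iso \<phi> \<Sigma> \<Sigma>'"
  shows "\<phi> ` rays \<Sigma> = rays \<Sigma>'"
proof
  show "\<phi> ` rays \<Sigma> \<subseteq> rays \<Sigma>'" by (rule fan_iso_rays_subset[OF assms])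
  have surj: "\<phi> (inv_into UNIV \<phi> x) = x" for x
    using assms by (simp add: fan_iso_def bij_is_surj surj_f_inv_f)
  show "rays \<Sigma>' \<subseteq> \<phi> ` rays \<Sigma>"
    using fan_iso_rays_subset[OF fan_iso_inverse[OF assms]] surj by (metis image_eqI image_subset_iff subsetI)
qed

text \<open>The adjoint of an integral linear map is integral.\<close>

lemma lattice_map_pullback:
  fixes \<phi> :: "real ^ 'n \<Rightarrow> real ^ 'n"
  assumes \<phi>: "linear \<phi>" "\<phi> ` int_lattice \<subseteq> int_lattice" and m: "m \<in> int_lattice"
  shows "\<exists>m'\<in>int_lattice. \<forall>x. inner m' x = inner m (\<phi> x)"
proof (intro bexI allI)
  show "inner (adjoint \<phi> m) x = inner m (\<phi> x)" for x using adjoint_clauses(2)[OF \<phi>(1)] .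
  show "adjoint \<phi> m \<in> int_lattice"
    unfolding int_lattice_def
  proof (intro CollectI allI)
    fix i :: 'n
    have "(axis i 1 :: real ^ 'n) \<in> int_lattice" by (simp add: int_lattice_def axis_def)
    then have "inner m (\<phi> (axis i 1)) \<in> \<int>" using \<phi>(2) m by (intro int_lattice_inner) auto
    then show "vec_nth (adjoint \<phi> m) i \<in> \<int>"
      using adjoint_clauses(2)[OF \<phi>(1), of m "axis i 1"] by (simp add: inner_axis)
  qed
qed

lemma char_lattice_fan_iso:
  assumes "fan_iso \<phi> \<Sigma> \<Sigma>'"
  shows "char_lattice N (\<phi> \<circ> u) = char_lattice N u"
proof -
  have \<phi>: "linear \<phi>" "\<phi> ` int_lattice \<subseteq> int_lattice" using assms by (auto simp: fan_iso_def)
  have \<psi>: "linear (inv_into UNIV \<phi>)" "inv_into UNIV \<phi> ` int_lattice \<subseteq> int_lattice"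
    using fan_iso_inverse[OF assms] by (auto simp: fan_iso_def)
  have inv: "inv_into UNIV \<phi> (\<phi> x) = x" for x using assms by (simp add: fan_iso_def bij_is_inj)
  have "x \<in> char_lattice N u" if "x \<in> char_lattice N (\<phi> \<circ> u)" for x
  proof -
    obtain m where m: "m \<in> int_lattice" "\<forall>i<N. real_of_int (x i) = inner m (\<phi> (u i))"
      using \<open>x \<in> char_lattice N (\<phi> \<circ> u)\<close> by (auto simp: char_lattice_def)
    obtain m' where "m' \<in> int_lattice" "\<forall>x. inner m' x = inner m (\<phi> x)"
      using lattice_map_pullback[OF \<phi> m(1)] by blast
    then show ?thesis using m(2) by (auto simp: char_lattice_def intro!: bexI[of _ m'])
  qed
  moreover have "x \<in> char_lattice N (\<phi> \<circ> u)" if "x \<in> char_lattice N u" for x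
  proof -
    obtain m where m: "m \<in> int_lattice" "\<forall>i<N. real_of_int (x i) = inner m (u i)"
      using \<open>x \<in> char_lattice N u\<close> by (auto simp: char_lattice_def)
    obtain m' where "m' \<in> int_lattice" "\<forall>x. inner m' x = inner m (inv_into UNIV \<phi> x)"
      using lattice_map_pullback[OF \<psi> m(1)] by blast
    then show ?thesis using m(2) inv by (auto simp: char_lattice_def intro!: bexI[of _ m'])
  qed
  ultimately show ?thesis by blast
qed

lemma push_lookup:
  assumes "inj \<phi>"
  shows "Poly_Mapping.lookup (frag_extend (\<lambda>u. frag_of (\<phi> u)) D) (\<phi> u) = Poly_Mapping.lookup D u"
proof -
  have "Poly_Mapping.lookup (frag_extend (\<lambda>u. frag_of (\<phi> u)) D) (\<phi> u)
      = (\<Sum>v\<in>Poly_Mapping.keys D. if v = u then Poly_Mapping.lookup D v else 0)"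
    unfolding frag_extend_def lookup_sum
    by (rule sum.cong) (use assms in \<open>auto simp: inj_eq\<close>)
  then show ?thesis by (simp add: in_keys_iff)
qed

lemma push_keys:
  "Poly_Mapping.keys D \<subseteq> S \<Longrightarrow> Poly_Mapping.keys (frag_extend (\<lambda>u. frag_of (\<phi> u)) D) \<subseteq> \<phi> ` S"
  by (rule order_trans[OF keys_frag_extend]) auto

lemma push_principal:
  assumes iso: "fan_iso \<phi> \<Sigma> \<Sigma>'" and D: "D \<in> principal_divisors \<Sigma>"
  shows "frag_extend (\<lambda>u. frag_of (\<phi> u)) D \<in> principal_divisors \<Sigma>'"
proof -
  have inj: "inj \<phi>" using iso by (simp add: fan_iso_def bij_is_inj)
  obtain m where keys: "Poly_Mapping.keys D \<subseteq> rays \<Sigma>"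
    and m: "m \<in> int_lattice" "\<forall>u\<in>rays \<Sigma>. real_of_int (Poly_Mapping.lookup D u) = inner m u"
    using D by (auto simp: principal_iff)
  have "linear (inv_into UNIV \<phi>)" "inv_into UNIV \<phi> ` int_lattice \<subseteq> int_lattice"
    using fan_iso_inverse[OF iso] by (auto simp: fan_iso_def)
  from lattice_map_pullback[OF this m(1)] obtain m' where m': "m' \<in> int_lattice"
    "\<forall>x. inner m' x = inner m (inv_into UNIV \<phi> x)" by blast
  show ?thesis
    unfolding principal_iff fan_iso_rays[OF iso, symmetric]
    using push_keys[OF keys, of \<phi>] m m' by (auto intro!: bexI[of _ m'] simp: push_lookup[OF inj] inv_f_f[OF inj])
qed

text \<open>The isomorphism and its inverse carry principal divisors to principal divisors, so cosets are
  carried onto cosets.\<close>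

lemma push_class_div_class:
  assumes iso: "fan_iso \<phi> \<Sigma> \<Sigma>'"
  shows "push_class \<phi> (div_class \<Sigma> D) = div_class \<Sigma>' (frag_extend (\<lambda>u. frag_of (\<phi> u)) D)"
proof -
  let ?push = "frag_extend (\<lambda>u. frag_of (\<phi> u))"
  have surj: "\<phi> (inv_into UNIV \<phi> x) = x" for x
    using iso by (simp add: fan_iso_def bij_is_surj surj_f_inv_f)
  have "?push ` principal_divisors \<Sigma> = principal_divisors \<Sigma>'"
  proof
    show "?push ` principal_divisors \<Sigma> \<subseteq> principal_divisors \<Sigma>'" using push_principal[OF iso] by blast
    show "principal_divisors \<Sigma>' \<subseteq> ?push ` principal_divisors \<Sigma>"
    proof
      fix Q assume Q: "Q \<in> principal_divisors \<Sigma>'"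
      have "?push (frag_extend (\<lambda>u. frag_of (inv_into UNIV \<phi> u)) Q) = Q"
      proof -
        have "?push (frag_extend (frag_of \<circ> inv_into UNIV \<phi>) Q) = frag_extend (\<lambda>u. frag_of (\<phi> (inv_into UNIV \<phi> u))) Q"
          by (subst frag_extend_compose) (simp add: comp_def)
        then show ?thesis by (simp add: surj comp_def flip: frag_expansion)
      qed
      then show "Q \<in> ?push ` principal_divisors \<Sigma>"
        using push_principal[OF fan_iso_inverse[OF iso] Q] by (metis image_eqI)
    qed
  qed
  then show ?thesis
    unfolding push_class_def div_class_eq by (force simp: image_image frag_extend_add)
qed

text \<open>All but one of the \<open>u\<^sub>i\<close> are independent, and the relation with constant coefficients transports the
  prescribed values to the remaining one.\<close>

lemma circuit_linear_map:
  fixes u u' :: "nat \<Rightarrow> real ^ 'n"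
  assumes u: "circuit N (\<lambda>_. 1) u" and u': "circuit N (\<lambda>_. 1) u'" and inj: "inj_on u {..<N}"
  shows "\<exists>\<phi>. linear \<phi> \<and> (\<forall>i<N. \<phi> (u i) = u' i)"
proof -
  have "c i = c 0" if c: "(\<Sum>i<N. c i *\<^sub>R u i) = 0" and i: "i < N" for c i
  proof -
    obtain t where "\<forall>k<N. c k = t * 1" using u c unfolding circuit_def by blast
    then show ?thesis using i by auto
  qed
  then have "independent (u ` {1..<N})" by (intro constant_relations_independent[OF inj])
  from linear_independent_extend[OF this, of "\<lambda>x. u' (the_inv_into {..<N} u x)"]
  obtain \<phi> where \<phi>: "linear \<phi>" "\<forall>x\<in>u ` {1..<N}. \<phi> x = u' (the_inv_into {..<N} u x)"
    by blast
  have 1: "\<phi> (u i) = u' i" if "i \<in> {1..<N}" for i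
    using \<phi>(2) that the_inv_into_f_f[OF inj, of i] by auto
  have split: "(\<Sum>i<N. f i) = f 0 + (\<Sum>i\<in>{1..<N}. f i)" if "0 < N" for f :: "nat \<Rightarrow> real ^ 'n"
    using that by (simp add: lessThan_atLeast0 sum.atLeast_Suc_lessThan)
  have "\<phi> (u i) = u' i" if i: "i < N" for i
  proof (cases "i = 0")
    case True
    then have N: "0 < N" using i by simp
    have "u 0 = - (\<Sum>i\<in>{1..<N}. u i)" "u' 0 = - (\<Sum>i\<in>{1..<N}. u' i)"
      using u u' split[OF N, of u] split[OF N, of u'] by (simp_all add: circuit_def eq_neg_iff_add_eq_0)
    then show ?thesis using True 1 \<phi>(1) by (simp add: linear_neg linear_sum)
  qed (use i 1 in auto)
  then show ?thesis using \<phi>(1) by blast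
qed

text \<open>A coordinate of \<open>\<phi> x\<close> is the value of a character at \<open>\<phi> x\<close>. By the inclusion of lattices, the pullback
  of this character along \<open>\<phi>\<close> agrees on the \<open>u\<^sub>i\<close>, hence everywhere, with a character.\<close>

lemma circuit_lattice_map:
  fixes \<phi> :: "real ^ 'n \<Rightarrow> real ^ 'n"
  assumes u: "circuit N a u" and \<phi>: "linear \<phi>" "\<And>i. i < N \<Longrightarrow> \<phi> (u i) = u' i"
    and sub: "char_lattice N u' \<subseteq> char_lattice N u" and u': "\<And>i. i < N \<Longrightarrow> u' i \<in> int_lattice"
  shows "\<phi> ` int_lattice \<subseteq> int_lattice"
proof
  fix y assume "y \<in> \<phi> ` int_lattice"
  then obtain x where x: "x \<in> int_lattice" "y = \<phi> x" by blast
  show "y \<in> int_lattice"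
    unfolding int_lattice_def
  proof (intro CollectI allI)
    fix k :: 'n
    have axis: "(axis k 1 :: real ^ 'n) \<in> int_lattice" by (simp add: int_lattice_def axis_def)
    define z where "z i = \<lfloor>inner (axis k 1) (u' i)\<rfloor>" for i
    have z: "real_of_int (z i) = inner (axis k 1) (u' i)" if "i < N" for i
      using int_lattice_inner_ints[OF axis u'[OF that]] by (auto simp: z_def)
    then have "z \<in> char_lattice N u'" using axis by (auto simp: char_lattice_def intro!: bexI[of _ "axis k 1"])
    then have "z \<in> char_lattice N u" using sub by blast
    then obtain m where m: "m \<in> int_lattice" "\<forall>i<N. real_of_int (z i) = inner m (u i)"
      by (auto simp: char_lattice_def)
    obtain c where c: "x = (\<Sum>i<N. c i *\<^sub>R u i)" using u unfolding circuit_def by blast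
    have "vec_nth y k = inner (axis k 1) (\<phi> x)" by (simp add: x(2) inner_axis')
    also have "\<dots> = (\<Sum>i<N. c i * inner (axis k 1) (u' i))"
      using \<phi> by (simp add: c linear_sum linear_scale inner_sum_right)
    also have "\<dots> = (\<Sum>i<N. c i * inner m (u i))" by (rule sum.cong) (use m(2) z in auto)
    also have "\<dots> = inner m x" by (simp add: c inner_sum_right)
    finally show "vec_nth y k \<in> \<int>" using int_lattice_inner[OF m(1) x(1)] by simp
  qed
qed

lemma equal_char_lattices_fan_iso:
  fixes u u' :: "nat \<Rightarrow> real ^ 'n"
  assumes u: "circuit N (\<lambda>_. 1) u" "inj_on u {..<N}" "\<And>i. i < N \<Longrightarrow> u i \<in> int_lattice"
    and u': "circuit N (\<lambda>_. 1) u'" "inj_on u' {..<N}" "\<And>i. i < N \<Longrightarrow> u' i \<in> int_lattice"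
    and eq: "char_lattice N u = char_lattice N u'"
  shows "\<exists>\<phi>. fan_iso \<phi> (proper_cones N u) (proper_cones N u') \<and> (\<forall>i<N. \<phi> (u i) = u' i)"
proof -
  obtain \<phi> where \<phi>: "linear \<phi>" "\<forall>i<N. \<phi> (u i) = u' i" using circuit_linear_map[OF u(1) u'(1) u(2)] by blast
  obtain \<psi> where \<psi>: "linear \<psi>" "\<forall>i<N. \<psi> (u' i) = u i" using circuit_linear_map[OF u'(1) u(1) u'(2)] by blast
  have \<psi>\<phi>: "\<psi> (\<phi> x) = x" for x
  proof -
    obtain c where c: "x = (\<Sum>i<N. c i *\<^sub>R u i)" using u(1) unfolding circuit_def by blast
    show ?thesis using \<phi> \<psi> by (simp add: c linear_sum linear_scale)
  qed
  have \<phi>\<psi>: "\<phi> (\<psi> x) = x" for x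
  proof -
    obtain c where c: "x = (\<Sum>i<N. c i *\<^sub>R u' i)" using u'(1) unfolding circuit_def by blast
    show ?thesis using \<phi> \<psi> by (simp add: c linear_sum linear_scale)
  qed
  have "bij \<phi>" using \<psi>\<phi> \<phi>\<psi> by (intro bijI') metis+
  moreover have "\<phi> ` int_lattice = int_lattice"
  proof
    show "\<phi> ` int_lattice \<subseteq> int_lattice"
      by (rule circuit_lattice_map[OF u(1) \<phi>(1)]) (use \<phi>(2) eq u'(3) in auto)
    have "\<psi> ` int_lattice \<subseteq> int_lattice"
      by (rule circuit_lattice_map[OF u'(1) \<psi>(1)]) (use \<psi>(2) eq u(3) in auto)
    then show "int_lattice \<subseteq> \<phi> ` int_lattice" using \<phi>\<psi> by (metis image_eqI image_subset_iff subsetI)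
  qed
  moreover have "image \<phi> ` proper_cones N u = proper_cones N u'"
  proof -
    have "\<phi> ` (convex_cone hull (u ` I)) = convex_cone hull (u' ` I)" if "I \<subset> {..<N}" for I
    proof -
      have "\<phi> ` u ` I = u' ` I" using \<phi>(2) that by (auto simp: image_image intro!: image_cong)
      then show ?thesis using convex_cone_hull_linear_image[OF \<phi>(1), of "u ` I"] by simp
    qed
    moreover have "proper_cones N v = (\<lambda>I. convex_cone hull (v ` I)) ` {I. I \<subset> {..<N}}" for v :: "nat \<Rightarrow> real ^ 'n"
      by (auto simp: proper_cones_def)
    ultimately show ?thesis by (simp add: image_image cong: image_cong_simp)
  qed
  ultimately show ?thesis using \<phi> by (auto simp: fan_iso_def)
qed

text \<open>The isomorphism built from equal lattices matches the rays \<open>u 0\<close> and \<open>u' 0\<close>, hence also the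
  multidegrees, which consist of copies of the class of twice such a ray.\<close>

lemma cyci_iso_iff_labels_meet:
  fixes a b :: "'n::finite cyci_pair"
  assumes n: "CARD('n) = d + (d + 1)" and ab: "a \<in> cyci_pairs (d + 1)" "b \<in> cyci_pairs (d + 1)"
  shows "(a, b) \<in> cyci_iso (d + 1) \<longleftrightarrow> fan_labels d a \<inter> fan_labels d b \<noteq> {}"
proof -
  let ?N = "num_rays d"
  obtain \<Sigma> \<mu> \<Sigma>' \<mu>' where a: "a = (\<Sigma>, \<mu>)" and b: "b = (\<Sigma>', \<mu>')" by (cases a; cases b)
  note A = cyci_pair_structure[OF ab(1)[unfolded a] n] and B = cyci_pair_structure[OF ab(2)[unfolded b] n]
  show ?thesis
  proof
    assume "(a, b) \<in> cyci_iso (d + 1)"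
    then obtain \<phi> where iso: "fan_iso \<phi> \<Sigma> \<Sigma>'" by (auto simp: cyci_iso_def a b)
    obtain u where u: "bij_betw u {..<?N} (rays \<Sigma>)" using A(1) by blast
    have "inj_on \<phi> (rays \<Sigma>)" using iso by (auto simp: fan_iso_def intro: inj_on_subset bij_is_inj)
    then have "bij_betw \<phi> (rays \<Sigma>) (rays \<Sigma>')" using fan_iso_rays[OF iso] by (simp add: bij_betw_def)
    then have "bij_betw (\<phi> \<circ> u) {..<?N} (rays \<Sigma>')" using bij_betw_trans[OF u] by blast
    then have "char_lattice ?N (\<phi> \<circ> u) \<in> fan_labels d b" unfolding b fan_labels_def by blast
    moreover have "char_lattice ?N u \<in> fan_labels d a" using u unfolding a fan_labels_def by blast
    ultimately show "fan_labels d a \<inter> fan_labels d b \<noteq> {}" using char_lattice_fan_iso[OF iso] by auto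
  next
    assume "fan_labels d a \<inter> fan_labels d b \<noteq> {}"
    then obtain u u' where u: "bij_betw u {..<?N} (rays \<Sigma>)" and u': "bij_betw u' {..<?N} (rays \<Sigma>')"
      and eq: "char_lattice ?N u = char_lattice ?N u'" by (auto simp: a b fan_labels_def)
    note A' = A(2)[OF u] and B' = B(2)[OF u']
    have lat: "u i \<in> int_lattice" "u' i \<in> int_lattice" if "i < ?N" for i
      using u u' that by (auto simp: bij_betw_def rays_def primitive_def)
    obtain \<phi> where \<phi>: "fan_iso \<phi> \<Sigma> \<Sigma>'" "\<forall>i<?N. \<phi> (u i) = u' i"
      using equal_char_lattices_fan_iso[of ?N u u'] A' B' u u' lat eq by (auto simp: bij_betw_def)
    have "\<phi> (u 0) = u' 0" using \<phi>(2) by (simp add: num_rays_def)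
    then have "push_class \<phi> (div_class \<Sigma> (frag_cmul 2 (frag_of (u 0)))) = div_class \<Sigma>' (frag_cmul 2 (frag_of (u' 0)))"
      by (simp add: push_class_div_class[OF \<phi>(1)] frag_extend_cmul)
    then have "\<mu>' = image_mset (push_class \<phi>) \<mu>" using A' B' by simp
    then show "(a, b) \<in> cyci_iso (d + 1)" using \<phi>(1) ab by (auto simp: cyci_iso_def a b)
  qed
qed

section \<open>The bijection\<close>

text \<open>Both quotients are compared with their sets of labels in this way.\<close>

lemma quotient_bij_image:
  assumes R: "\<And>a b. a \<in> A \<Longrightarrow> b \<in> A \<Longrightarrow> (a, b) \<in> R \<longleftrightarrow> J a = J b" and sub: "R \<subseteq> A \<times> A"
  shows "bij_betw (\<lambda>X. the_elem (J ` X)) (A // R) (J ` A)"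
proof -
  have cls: "R `` {a} = {b \<in> A. J b = J a}" if "a \<in> A" for a
    using R that sub by auto
  have J: "J ` (R `` {a}) = {J a}" if "a \<in> A" for a using cls[OF that] that by auto
  have "inj_on (\<lambda>X. the_elem (J ` X)) (A // R)"
  proof (rule inj_onI)
    fix X Y assume "X \<in> A // R" "Y \<in> A // R" and eq: "the_elem (J ` X) = the_elem (J ` Y)"
    then obtain a b where ab: "a \<in> A" "X = R `` {a}" "b \<in> A" "Y = R `` {b}" by (meson quotientE)
    then have "J a = J b" using eq J by simp
    then show "X = Y" using ab cls by simp
  qed
  moreover have "(\<lambda>X. the_elem (J ` X)) ` (A // R) = J ` A"
    by (auto simp: quotient_def J image_iff)
  ultimately show ?thesis by (simp add: bij_betw_def)
qed

theorem proposition4p2: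
  fixes d :: nat
  assumes "d \<ge> 1"
    and "CARD('n::finite) = d + (d + 1)"
  shows "\<exists>f. bij_betw f (CYCI (d + 1) :: 'n cyci_pair set set) (AGL_orbits d)"
proof -
  let ?A = "cyci_pairs (d + 1) :: 'n cyci_pair set" and ?B = "point_configs d"
  note n = assms(2)
  have fan_label: "\<exists>K\<in>fan_labels d a. paired_lattice d K" if "a \<in> ?A" for a :: "'n cyci_pair"
    using cyci_pair_structure(1)[of "fst a" "snd a" d] that n by (fastforce simp: fan_labels_def case_prod_beta)
  have meet_fan: "fan_labels d a \<inter> fan_labels d b \<noteq> {} \<longleftrightarrow> fan_labels d a = fan_labels d b"
    if "a \<in> ?A" for a b :: "'n cyci_pair"
    using label_orbits_eq[OF fan_labels_orbit fan_labels_orbit, of d a b] fan_label[OF that] by blast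
  have meet_config: "config_labels d a \<inter> config_labels d b \<noteq> {} \<longleftrightarrow> config_labels d a = config_labels d b"
    if "a \<in> ?B" for a b
    using label_orbits_eq[OF config_labels_orbit config_labels_orbit, of d a b] config_has_paired_label[OF that] by blast
  have "bij_betw (\<lambda>X. the_elem (fan_labels d ` X)) (CYCI (d + 1) :: 'n cyci_pair set set) (fan_labels d ` ?A)"
    unfolding CYCI_def
  proof (rule quotient_bij_image)
    show "(a, b) \<in> cyci_iso (d + 1) \<longleftrightarrow> fan_labels d a = fan_labels d b" if "a \<in> ?A" "b \<in> ?A" for a b
      using cyci_iso_iff_labels_meet[OF n that] meet_fan[OF that(1)] by blast
  qed (auto simp: cyci_iso_def)
  moreover have "bij_betw (\<lambda>X. the_elem (config_labels d ` X)) (AGL_orbits d) (config_labels d ` ?B)"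
    unfolding AGL_orbits_def
  proof (rule quotient_bij_image)
    show "(a, b) \<in> AGL_rel d \<longleftrightarrow> config_labels d a = config_labels d b" if "a \<in> ?B" "b \<in> ?B" for a b
      using AGL_rel_iff_labels_meet[OF that] meet_config[OF that(1)] by blast
  qed (auto simp: AGL_rel_def)
  moreover have "fan_labels d ` ?A = config_labels d ` ?B"
  proof -
    have orbits: "fan_labels d a = config_labels d b" if "K \<in> fan_labels d a" "K \<in> config_labels d b"
      for K b and a :: "'n cyci_pair"
      using label_orbits_eq[OF fan_labels_orbit config_labels_orbit, of d a b] that by blast
    have "fan_labels d a \<in> config_labels d ` ?B" if a: "a \<in> ?A" for a :: "'n cyci_pair"
    proof -
      obtain K where K: "K \<in> fan_labels d a" "paired_lattice d K" using fan_label[OF a] by blast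
      obtain b where "b \<in> ?B" "K \<in> config_labels d b" using paired_lattice_has_config[OF K(2)] by blast
      then show ?thesis using orbits[OF K(1)] by blast
    qed
    moreover have "config_labels d b \<in> fan_labels d ` ?A" if b: "b \<in> ?B" for b
    proof -
      obtain K where K: "K \<in> config_labels d b" "paired_lattice d K"
        using config_has_paired_label[OF b] by blast
      obtain \<Sigma> \<mu> and u :: "nat \<Rightarrow> real ^ 'n" where a: "(\<Sigma>, \<mu>) \<in> ?A"
        "bij_betw u {..<num_rays d} (rays \<Sigma>)" "char_lattice (num_rays d) u = K"
        using paired_lattice_has_cyci_pair[OF K(2) n] by blast
      have "K \<in> fan_labels d (\<Sigma>, \<mu>)" using a(2,3) by (auto simp: fan_labels_def)
      from orbits[OF this K(1)] show ?thesis using a(1) by (metis image_eqI)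
    qed
    ultimately show ?thesis by blast
  qed
  ultimately show ?thesis using bij_betw_trans bij_betw_inv_into by metis
qed

end
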